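(* Let $l\ge 2$, let $\mathfrak g_l$ be the complex simple Lie algebra of type $A_l$, let $\lambda=(\lambda_1,\dots,\lambda_l)=\sum_{i=1}^l\lambda_i\omega_i$ be a dominant integral weight, and let $\mu$ be a weight of the finite-dimensional irreducible $\mathfrak g_l$-module $V(\lambda)$ of highest weight $\lambda$. Then the multiplicity $m_\lambda(\mu)=\dim V(\lambda)_\mu$ of $\mu$ in $V(\lambda)$ is $$m_\lambda(\mu)=\sum_{P\in\Pi'_\lambda,\;P\alpha\ll\lambda-\mu}\dim V\big((\lambda-P\alpha)_{\mathfrak g_{l-1}}\big)_{\mu_{\mathfrak g_{l-1}}}=\sum_{P\in\Pi'_\lambda,\;P\alpha\ll\lambda-\mu}m_{(\lambda-P\alpha)_{\mathfrak g_{l-1}}}\big(\mu_{\mathfrak g_{l-1}}\big).$$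
   Context: Let $\alpha_1,\dots,\alpha_l$ be the simple roots of $\mathfrak g_l$ (numbered in the standard way along the Dynkin diagram), $\omega_1,\dots,\omega_l$ the corresponding fundamental weights, and $e_i,f_i,h_i$ ($1\le i\le l$) the Chevalley generators. A weight $\nu=\sum_{i=1}^l\nu_i\omega_i$ is written $(\nu_1,\dots,\nu_l)$. $\mathbb N$ denotes the non-negative integers. $\mathfrak g_{l-1}$ denotes the subalgebra of $\mathfrak g_l$ of type $A_{l-1}$ generated by $e_i,f_i,h_i$ with $1\le i\le l-1$. For a weight $\nu=(\nu_1,\dots,\nu_l)$ of $\mathfrak g_l$, its restriction to $\mathfrak g_{l-1}$ is the weight $\nu_{\mathfrak g_{l-1}}=(\nu_1,\dots,\nu_{l-1})$ of $\mathfrak g_{l-1}$. For a dominant integral weight $\nu$ of $\mathfrak g_{l-1}$, $V(\nu)$ is the finite-dimensional irreducible $\mathfrak g_{l-1}$-module of highest weight $\nu$, $V(\nu)_\kappa$ is its $\kappa$-weight space, and $m_\nu(\kappa)=\dim V(\nu)_\kappa$ (zero if $\kappa$ is not a weight of $V(\nu)$). The index set $\Pi'_\lambda$ is the (finite) set of tuples $P=(p_l,p_{l-1},\dots,p_1)\in\mathbb N^l$ such that $p_l\ge p_{l-1}\ge\cdots\ge p_1$ and, with $p_0:=0$, $p_i-p_{i-1}\le\lambda_i$ for all $1\le i\le l$. For such $P$ put $P\alpha=\sum_{i=1}^l p_i\alpha_i$. For $\sum_{i=1}^l a_i\alpha_i$ with $a_i\in\mathbb N$, one writes $P\alpha\ll\sum_{i=1}^l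 a_i\alpha_i$ if and only if $p_l=a_l$ and $p_i\le a_i$ for all $i=1,\dots,l-1$. *)

theory Defs
  imports Complex_Main "Jordan_Normal_Form.Matrix"
begin

section \<open>The Lie algebras\<close>

text \<open>The simple Lie algebra of type \<open>A\<^sub>l\<close> is realized as the trace-zero complex matrices of
  size \<open>l + 1\<close>. Simple roots and Chevalley generators are numbered from 1, while rows and
  columns of the matrices are numbered from 0.\<close>

definition lie_bracket :: "complex mat \<Rightarrow> complex mat \<Rightarrow> complex mat" where
  "lie_bracket A B = A * B - B * A"

definition type_A_algebra :: "nat \<Rightarrow> complex mat set" where
  "type_A_algebra l = {A \<in> carrier_mat (l + 1) (l + 1). (\<Sum>i<l + 1. A $$ (i, i)) = 0}"

definition elementary_mat :: "nat \<Rightarrow> nat \<Rightarrow> nat \<Rightarrow> complex mat" where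
  "elementary_mat k i j = mat k k (\<lambda>(r, c). if r = i \<and> c = j then 1 else 0)"

definition chevalley_e :: "nat \<Rightarrow> nat \<Rightarrow> complex mat" where
  "chevalley_e l i = elementary_mat (l + 1) (i - 1) i"

definition chevalley_f :: "nat \<Rightarrow> nat \<Rightarrow> complex mat" where
  "chevalley_f l i = elementary_mat (l + 1) i (i - 1)"

definition chevalley_h :: "nat \<Rightarrow> nat \<Rightarrow> complex mat" where
  "chevalley_h l i = elementary_mat (l + 1) (i - 1) (i - 1) - elementary_mat (l + 1) i i"

inductive_set lie_subalgebra_generated :: "nat \<Rightarrow> complex mat set \<Rightarrow> complex mat set"
  for k :: nat and S :: "complex mat set" where
  generator: "A \<in> S \<Longrightarrow> A \<in> lie_subalgebra_generated k S"
| zero: "0\<^sub>m k k \<in> lie_subalgebra_generated k S"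
| add: "A \<in> lie_subalgebra_generated k S \<Longrightarrow> B \<in> lie_subalgebra_generated k S \<Longrightarrow>
    A + B \<in> lie_subalgebra_generated k S"
| smult: "A \<in> lie_subalgebra_generated k S \<Longrightarrow> c \<cdot>\<^sub>m A \<in> lie_subalgebra_generated k S"
| bracket: "A \<in> lie_subalgebra_generated k S \<Longrightarrow> B \<in> lie_subalgebra_generated k S \<Longrightarrow>
    lie_bracket A B \<in> lie_subalgebra_generated k S"

text \<open>The subalgebra of type \<open>A\<^sub>n\<close> inside the algebra of type \<open>A\<^sub>l\<close>, for \<open>n \<le> l\<close>; its elements
  remain matrices of size \<open>l + 1\<close>.\<close>

definition type_A_subalgebra :: "nat \<Rightarrow> nat \<Rightarrow> complex mat set" where
  "type_A_subalgebra l n = lie_subalgebra_generated (l + 1)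
     (\<Union>i\<in>{1..n}. {chevalley_e l i, chevalley_f l i, chevalley_h l i})"


section \<open>Weights\<close>

text \<open>An integral weight \<open>\<nu>\<close> of type \<open>A\<^sub>n\<close> is given by its coordinates \<open>\<nu> 1, \<dots>, \<nu> n\<close> with respect to
  the fundamental weights, and by 0 at every other argument.\<close>

definition integral_weights :: "nat \<Rightarrow> (nat \<Rightarrow> int) set" where
  "integral_weights n = {\<nu>. \<forall>i. i \<notin> {1..n} \<longrightarrow> \<nu> i = 0}"

definition dominant_weights :: "nat \<Rightarrow> (nat \<Rightarrow> int) set" where
  "dominant_weights n = {\<nu> \<in> integral_weights n. \<forall>i\<in>{1..n}. 0 \<le> \<nu> i}"

definition restrict_weight :: "nat \<Rightarrow> (nat \<Rightarrow> int) \<Rightarrow> nat \<Rightarrow> int" where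
  "restrict_weight n \<nu> = (\<lambda>i. if i \<in> {1..n} then \<nu> i else 0)"

text \<open>Fundamental-weight coordinates of the simple root \<open>\<alpha>\<^sub>j\<close>, i.e. the entries of the Cartan
  matrix.\<close>

definition simple_root :: "nat \<Rightarrow> nat \<Rightarrow> nat \<Rightarrow> int" where
  "simple_root l j = (\<lambda>i. if i \<notin> {1..l} then 0
     else if i = j then 2 else if i = j + 1 \<or> j = i + 1 then - 1 else 0)"

definition root_comb :: "nat \<Rightarrow> (nat \<Rightarrow> nat) \<Rightarrow> nat \<Rightarrow> int" where
  "root_comb l a = (\<lambda>i. \<Sum>j = 1..l. int (a j) * simple_root l j i)"

text \<open>A tuple \<open>P = (p\<^sub>l, \<dots>, p\<^sub>1)\<close> is the function \<open>i \<mapsto> p\<^sub>i\<close>, extended by 0; this includes the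
  convention \<open>p\<^sub>0 = 0\<close>.\<close>

definition Pi_prime :: "nat \<Rightarrow> (nat \<Rightarrow> int) \<Rightarrow> (nat \<Rightarrow> nat) set" where
  "Pi_prime l lam = {P. (\<forall>i. i \<notin> {1..l} \<longrightarrow> P i = 0) \<and>
     (\<forall>i\<in>{1..l}. P (i - 1) \<le> P i \<and> int (P i) - int (P (i - 1)) \<le> lam i)}"

definition branch_weight :: "nat \<Rightarrow> (nat \<Rightarrow> int) \<Rightarrow> (nat \<Rightarrow> nat) \<Rightarrow> nat \<Rightarrow> int" where
  "branch_weight l lam P = restrict_weight (l - 1) (\<lambda>i. lam i - root_comb l P i)"

text \<open>\<open>root_ll l P \<beta>\<close> is \<open>P\<alpha> \<lless> \<beta>\<close>. It includes that \<open>\<beta>\<close> is a combination of the simple roots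
  with non-negative integral coefficients.\<close>

definition root_ll :: "nat \<Rightarrow> (nat \<Rightarrow> nat) \<Rightarrow> (nat \<Rightarrow> int) \<Rightarrow> bool" where
  "root_ll l P \<beta> \<longleftrightarrow>
     (\<exists>a. \<beta> = root_comb l a \<and> P l = a l \<and> (\<forall>i\<in>{1..l - 1}. P i \<le> a i))"


section \<open>Modules and weight multiplicities\<close>

text \<open>A module over a matrix Lie algebra \<open>L\<close> is carried by a subspace \<open>V\<close> of an arbitrary complex
  vector space with scalar multiplication \<open>smul\<close>.\<close>

locale lie_module = vector_space smul
  for smul :: "complex \<Rightarrow> 'v::ab_group_add \<Rightarrow> 'v" +
  fixes L :: "complex mat set"
    and V :: "'v set"
    and act :: "complex mat \<Rightarrow> 'v \<Rightarrow> 'v"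
  assumes subspace_V: "subspace V"
    and act_closed: "A \<in> L \<Longrightarrow> v \<in> V \<Longrightarrow> act A v \<in> V"
    and act_add_right: "A \<in> L \<Longrightarrow> v \<in> V \<Longrightarrow> w \<in> V \<Longrightarrow> act A (v + w) = act A v + act A w"
    and act_scale_right: "A \<in> L \<Longrightarrow> v \<in> V \<Longrightarrow> act A (smul c v) = smul c (act A v)"
    and act_add_left: "A \<in> L \<Longrightarrow> B \<in> L \<Longrightarrow> v \<in> V \<Longrightarrow> act (A + B) v = act A v + act B v"
    and act_smult_left: "A \<in> L \<Longrightarrow> v \<in> V \<Longrightarrow> act (c \<cdot>\<^sub>m A) v = smul c (act A v)"
    and act_bracket: "A \<in> L \<Longrightarrow> B \<in> L \<Longrightarrow> v \<in> V \<Longrightarrow>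
      act (lie_bracket A B) v = act A (act B v) - act B (act A v)"

locale fd_irreducible_lie_module = lie_module +
  assumes finite_dimensional: "\<exists>B. finite B \<and> V \<subseteq> span B"
    and nonzero: "V \<noteq> {0}"
    and irreducible: "subspace U \<Longrightarrow> U \<subseteq> V \<Longrightarrow> (\<And>A u. A \<in> L \<Longrightarrow> u \<in> U \<Longrightarrow> act A u \<in> U) \<Longrightarrow>
      U = {0} \<or> U = V"

text \<open>The \<open>\<kappa>\<close>-weight space for the Cartan subalgebra spanned by \<open>h\<^sub>1, \<dots>, h\<^sub>n\<close>, which are
  matrices of size \<open>l + 1\<close>.\<close>

definition weight_space :: "nat \<Rightarrow> nat \<Rightarrow> (complex \<Rightarrow> 'v::ab_group_add \<Rightarrow> 'v) \<Rightarrow> 'v set \<Rightarrow>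
    (complex mat \<Rightarrow> 'v \<Rightarrow> 'v) \<Rightarrow> (nat \<Rightarrow> int) \<Rightarrow> 'v set" where
  "weight_space l n smul V act \<kappa> =
     {v \<in> V. \<forall>i\<in>{1..n}. act (chevalley_h l i) v = smul (of_int (\<kappa> i)) v}"

definition weight_multiplicity :: "nat \<Rightarrow> nat \<Rightarrow> (complex \<Rightarrow> 'v::ab_group_add \<Rightarrow> 'v) \<Rightarrow> 'v set \<Rightarrow>
    (complex mat \<Rightarrow> 'v \<Rightarrow> 'v) \<Rightarrow> (nat \<Rightarrow> int) \<Rightarrow> nat" where
  "weight_multiplicity l n smul V act \<kappa> =
     vector_space.dim smul (weight_space l n smul V act \<kappa>)"

definition is_weight :: "nat \<Rightarrow> nat \<Rightarrow> (complex \<Rightarrow> 'v::ab_group_add \<Rightarrow> 'v) \<Rightarrow> 'v set \<Rightarrow>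
    (complex mat \<Rightarrow> 'v \<Rightarrow> 'v) \<Rightarrow> (nat \<Rightarrow> int) \<Rightarrow> bool" where
  "is_weight l n smul V act \<kappa> \<longleftrightarrow>
     \<kappa> \<in> integral_weights n \<and> weight_space l n smul V act \<kappa> \<noteq> {0}"

text \<open>\<open>V\<close> is an irreducible module with highest weight \<open>\<nu>\<close> over \<open>L\<close>, which has Chevalley
  generators \<open>e\<^sub>i, f\<^sub>i, h\<^sub>i\<close> for \<open>1 \<le> i \<le> n\<close>. By irreducibility the highest weight vector
  generates \<open>V\<close>.\<close>

locale irreducible_highest_weight_module =
  fd_irreducible_lie_module smul L V act
  for smul :: "complex \<Rightarrow> 'v::ab_group_add \<Rightarrow> 'v" and L V act +
  fixes l n :: nat and \<nu> :: "nat \<Rightarrow> int"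
  assumes highest_weight_vector:
    "\<exists>v \<in> weight_space l n smul V act \<nu>. v \<noteq> 0 \<and> (\<forall>i\<in>{1..n}. act (chevalley_e l i) v = 0)"

end

(* Every irreducible highest weight module is realized inside a tensor power of the natural module
   C^(l+1), where matrix units E_ab and E_ba are adjoint for the standard Hermitian form, so that all
   submodules have invariant complements. Let v be the highest weight vector and C the module that
   it generates; write D_a = E_(a,l) for a < l (indices from 0 to l).

   A vector s of C that is killed by the raising operators of the smaller algebra is determined by
   the scalars <D^b s, v>, because the span of all D^b s is stable under all raising operators; and
   <D^b s, v> = 0 unless b_a <= lambda_(a+1) for all a, because b can be moved along E_(a,a+1) onto a
   power of E_(a+1,a) that kills v. Conversely, in the tensor product of exterior powers that contains
   v, replacing e_a by e_l in b_a of the factors of rank a + 1 gives a highest weight vector xi for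
   the smaller algebra with D^b xi a nonzero multiple of v, so its projection to C is nonzero. Hence
   C is the orthogonal sum of one irreducible module of the smaller algebra for each such b, and
   p_i = b_0 + ... + b_(i-1) translates b into the index set of the theorem. *)

theory Submission
  imports Defs "HOL-Library.Function_Algebras"
begin

section \<open>Tensor powers of the natural module\<close>

text \<open>Replacing a letter a by l subtracts \<alpha>_(a+1) + ... + \<alpha>_l from a weight.
  This is the origin of p_i, and P\<alpha> is the drop from \<lambda> to the highest weight of a
  component. The two halves of \<open>root_ll\<close> follow: p_l = a_l because the smaller algebra
  cannot change the number of letters l, and p_i \<le> a_i because its lowering operators only move
  weights down. Tensors carry an action of all E_ab, not only of trace-zero matrices, so weights are
  letter counts. The counts separate the components, which yields orthogonality for different b at
  once; and since they add up to N, the first l - 1 coordinates of \<mu> together with the count of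
  l determine its last coordinate. The span of all D^b s is stable because the D_a commute and, for
  a < c < l, [E_(a,c), D_d] is D_a if c = d and 0 otherwise. The obstacle on the abstract side is
  that the given modules are not known to be sums of weight spaces. They are compared with tensors
  through the submodule of the product generated by a pair of highest weight vectors.\<close>

text \<open>A tensor in the \<open>N\<close>-th power of the natural module with basis \<open>e\<^sub>0, \<dots>, e\<^sub>l\<close> is given by its
  coefficients: \<open>f [i\<^sub>1, \<dots>, i\<^sub>N]\<close> is the coefficient of \<open>e\<^sub>i\<^sub>1 \<otimes> \<dots> \<otimes> e\<^sub>i\<^sub>N\<close>.\<close>

type_synonym tensor = "nat list \<Rightarrow> complex"

definition scl :: "complex \<Rightarrow> tensor \<Rightarrow> tensor" where
  "scl c f = (\<lambda>w. c * f w)"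

lemma scl_apply: "scl c f w = c * f w"
  by (simp add: scl_def)

lemmas pointwise = plus_fun_apply zero_fun_apply minus_apply uminus_apply scl_apply

text \<open>The simplifier applies these rules in eta-contracted form as well and would unfold every sum of
  tensors.\<close>

declare pointwise [simp del]

interpretation ten: vector_space scl
  by unfold_locales (auto simp: pointwise fun_eq_iff algebra_simps)

text \<open>The action of the matrix unit \<open>E\<^sub>a\<^sub>b\<close>, which maps \<open>e\<^sub>b\<close> to \<open>e\<^sub>a\<close>, as a derivation.\<close>

fun glop :: "nat \<Rightarrow> nat \<Rightarrow> tensor \<Rightarrow> tensor" where
  "glop a b f [] = 0"
| "glop a b f (x # w) = (if x = a then f (b # w) else 0) + glop a b (\<lambda>u. f (x # u)) w"

lemma glop_plus_apply: "glop a b (\<lambda>w. f w + g w) w = glop a b f w + glop a b g w"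
  by (induction w arbitrary: f g) auto

lemma glop_times_apply: "glop a b (\<lambda>w. c * f w) w = c * glop a b f w"
  by (induction w arbitrary: f) (auto simp: algebra_simps)

lemma glop_add: "glop a b (f + g) = glop a b f + glop a b g"
  by (auto simp: fun_eq_iff plus_fun_def glop_plus_apply)

lemma glop_scl: "glop a b (scl c f) = scl c (glop a b f)"
  by (auto simp: fun_eq_iff scl_def glop_times_apply)

lemma glop_0 [simp]: "glop a b 0 = 0"
  using glop_scl[of a b 0 0] by (simp add: scl_def zero_fun_def)

lemma glop_uminus: "glop a b (- f) = - glop a b f"
  using glop_scl[of a b "-1" f] by (simp add: scl_def fun_Compl_def)

lemma glop_diff: "glop a b (f - g) = glop a b f - glop a b g"
  using glop_add[of a b f "- g"] by (simp add: glop_uminus)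

lemma glop_sum: "glop a b (\<Sum>i\<in>I. f i) = (\<Sum>i\<in>I. glop a b (f i))"
  by (induction I rule: infinite_finite_induct) (auto simp: glop_add)

text \<open>A derivation never changes the length of a word. Identities that hold at one length
  only, as for \<open>tens\<close>, can therefore be used under \<open>glop\<close>.\<close>

lemma glop_cong:
  assumes "\<And>u. length u = length w \<Longrightarrow> f u = g u"
  shows "glop a b f w = glop a b g w"
  using assms
proof (induction w arbitrary: f g)
  case (Cons x w)
  have "glop a b (\<lambda>u. f (x # u)) w = glop a b (\<lambda>u. g (x # u)) w"
    by (rule Cons.IH) (simp add: Cons.prems)
  then show ?case using Cons.prems by simp
qed simp

lemma glop_append:
  "glop a b f (u @ w) = glop a b (\<lambda>u'. f (u' @ w)) u + glop a b (\<lambda>w'. f (u @ w')) w"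
  by (induction u arbitrary: f) (auto simp: algebra_simps)

text \<open>The bracket of gl: [E_ab, E_cd] = \<delta>_bc E_ad - \<delta>_da E_cb. Operators on
  different tensor factors commute, so only the terms in which both hit the same letter
  survive.\<close>

lemma glop_commutator:
  "glop a b (glop c d f) = glop c d (glop a b f)
     + (if b = c then glop a d f else 0) - (if d = a then glop c b f else 0)"
proof -
  have "glop a b (glop c d f) w = glop c d (glop a b f) w
     + (if b = c then glop a d f w else 0) - (if d = a then glop c b f w else 0)" for w
  proof (induction w arbitrary: f)
    case (Cons x w)
    have *: "glop p q (\<lambda>u. glop r s f (x # u)) w
       = (if x = r then glop p q (\<lambda>u. f (s # u)) w else 0) + glop p q (glop r s (\<lambda>u. f (x # u))) w"
      for p q r s
      by (cases "x = r") (simp_all add: glop_plus_apply)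
    show ?case
      by (simp only: glop.simps(2)[where w = w] *) (auto simp: Cons.IH)
  qed simp
  then show ?thesis by (auto simp: fun_eq_iff pointwise)
qed

text \<open>Each letter a contributes one. Every later weight computation becomes a count of letters
  in the support.\<close>

lemma glop_diag: "glop a a f w = of_nat (count_list w a) * f w"
  by (induction w arbitrary: f) (auto simp: algebra_simps)

text \<open>Some summand of the derivation is nonzero. The direction matters: E_ab maps e_b to e_a,
  so the word in the support of \<open>f\<close> carries b where \<open>w\<close> carries a.\<close>

lemma glop_nonzeroE:
  assumes "glop a b f w \<noteq> 0"
  obtains p where "p < length w" "w ! p = a" "f (w[p := b]) \<noteq> 0"
proof -
  have "\<exists>p<length w. w ! p = a \<and> f (w[p := b]) \<noteq> 0"
    using assms
  proof (induction w arbitrary: f)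
    case (Cons x w)
    show ?case
    proof (cases "x = a \<and> f (b # w) \<noteq> 0")
      case True
      then show ?thesis by (intro exI[of _ 0]) auto
    next
      case False
      then have "glop a b (\<lambda>u. f (x # u)) w \<noteq> 0" using Cons.prems by (auto split: if_splits)
      from Cons.IH[OF this] obtain p where "p < length w" "w ! p = a" "f (x # w[p := b]) \<noteq> 0"
        by auto
      then show ?thesis by (intro exI[of _ "Suc p"]) auto
    qed
  qed simp
  then show thesis using that by blast
qed

section \<open>Words over the letters 0, ..., l and the N-th tensor power\<close>

definition words :: "nat \<Rightarrow> nat \<Rightarrow> nat list set" where
  "words l N = {w. set w \<subseteq> {..l} \<and> length w = N}"

lemma finite_words [simp]: "finite (words l N)"
  unfolding words_def by (rule finite_lists_length_eq) simp

lemma words_0: "words l 0 = {[]}"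
  by (auto simp: words_def)

lemma words_Suc: "words l (Suc N) = (\<lambda>(x, w). x # w) ` ({..l} \<times> words l N)"
  by (auto simp: words_def length_Suc_conv image_iff)

definition tensors :: "nat \<Rightarrow> nat \<Rightarrow> tensor set" where
  "tensors l N = {f. \<forall>w. f w \<noteq> 0 \<longrightarrow> w \<in> words l N}"

lemma subspace_tensors: "ten.subspace (tensors l N)"
  unfolding ten.subspace_def tensors_def
  by (auto simp: pointwise) (metis add_0)

lemma tensors_0 [simp]: "0 \<in> tensors l N"
  and tensors_scl: "f \<in> tensors l N \<Longrightarrow> scl c f \<in> tensors l N"
  and tensors_diff: "f \<in> tensors l N \<Longrightarrow> g \<in> tensors l N \<Longrightarrow> f - g \<in> tensors l N"
  using subspace_tensors ten.subspace_0 ten.subspace_scale ten.subspace_diff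
  by blast+

lemma glop_tensors:
  assumes "f \<in> tensors l N" "a \<le> l"
  shows "glop a b f \<in> tensors l N"
  unfolding tensors_def
proof (intro CollectI allI impI)
  fix w assume "glop a b f w \<noteq> 0"
  then obtain p where p: "p < length w" "w ! p = a" "f (w[p := b]) \<noteq> 0" by (rule glop_nonzeroE)
  then have "w[p := b] \<in> words l N" using assms by (auto simp: tensors_def)
  then have *: "length w = N" "set (w[p := b]) \<subseteq> {..l}" by (auto simp: words_def)
  have "w ! q \<le> l" if "q < length w" for q
  proof (cases "q = p")
    case False
    then have "w ! q = w[p := b] ! q" by simp
    then show ?thesis using *(2) that by (metis atMost_iff length_list_update nth_mem subsetD)
  qed (use p assms in simp)
  then show "w \<in> words l N" using * by (auto simp: words_def in_set_conv_nth)
qed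

text \<open>The standard Hermitian form, for which \<open>E\<^sub>a\<^sub>b\<close> and \<open>E\<^sub>b\<^sub>a\<close> are adjoint.\<close>

definition ip :: "nat \<Rightarrow> nat \<Rightarrow> tensor \<Rightarrow> tensor \<Rightarrow> complex" where
  "ip l N f g = (\<Sum>w\<in>words l N. f w * cnj (g w))"

lemma ip_add_left: "ip l N (f + g) h = ip l N f h + ip l N g h"
  and ip_scl_left: "ip l N (scl c f) h = c * ip l N f h"
  and ip_add_right: "ip l N h (f + g) = ip l N h f + ip l N h g"
  and ip_scl_right: "ip l N h (scl c f) = cnj c * ip l N h f"
  and ip_diff_left: "ip l N (f - g) h = ip l N f h - ip l N g h"
  and ip_diff_right: "ip l N h (f - g) = ip l N h f - ip l N h g"
  and ip_0_left [simp]: "ip l N 0 h = 0"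
  and ip_0_right [simp]: "ip l N h 0 = 0"
  by (auto simp: ip_def pointwise algebra_simps sum.distrib sum_distrib_left sum_subtractf)

lemma ip_sum_left: "ip l N (\<Sum>i\<in>I. f i) h = (\<Sum>i\<in>I. ip l N (f i) h)"
  by (induction I rule: infinite_finite_induct) (auto simp: ip_add_left)

lemma ip_commute: "ip l N g f = cnj (ip l N f g)"
  by (simp add: ip_def mult.commute)

lemma ip_eq_0_commute: "ip l N f g = 0 \<Longrightarrow> ip l N g f = 0"
  by (subst ip_commute) simp

lemma ip_self_eq_0:
  assumes "f \<in> tensors l N" "ip l N f f = 0"
  shows "f = 0"
proof -
  have "ip l N f f = of_real (\<Sum>w\<in>words l N. (cmod (f w))\<^sup>2)"
    by (simp add: ip_def complex_norm_square[symmetric])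
  then have "(\<Sum>w\<in>words l N. (cmod (f w))\<^sup>2) = 0"
    using assms(2) by (metis of_real_eq_0_iff)
  then have "\<forall>w\<in>words l N. f w = 0"
    by (subst (asm) sum_nonneg_eq_0_iff) auto
  then show ?thesis using assms(1) by (auto simp: tensors_def fun_eq_iff pointwise)
qed

lemma ip_glop:
  assumes "a \<le> l" "b \<le> l"
  shows "ip l N (glop a b f) g = ip l N f (glop b a g)"
proof (induction N arbitrary: f g)
  case 0
  then show ?case by (simp add: ip_def words_0)
next
  case (Suc N)
  have split: "ip l (Suc N) F G = (\<Sum>x\<le>l. ip l N (\<lambda>w. F (x # w)) (\<lambda>w. G (x # w)))" for F G
    unfolding ip_def words_Suc
    by (subst sum.reindex) (auto simp: inj_on_def sum.cartesian_product case_prod_beta)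
  have cons: "(\<lambda>w. glop p q F (x # w))
      = (if x = p then (\<lambda>w. F (q # w)) else 0) + glop p q (\<lambda>w. F (x # w))" for p q F x
    by (auto simp: fun_eq_iff pointwise)
  have "ip l (Suc N) (glop a b f) g
     = (\<Sum>x\<le>l. if x = a then ip l N (\<lambda>w. f (b # w)) (\<lambda>w. g (a # w)) else 0)
       + (\<Sum>x\<le>l. ip l N (glop a b (\<lambda>w. f (x # w))) (\<lambda>w. g (x # w)))"
    unfolding split cons ip_add_left sum.distrib
    by (intro arg_cong2[where f = "(+)"] sum.cong) auto
  \<comment> \<open>The head term is the same number on both sides, found at x = a on the left and
    at x = b on the right; the bounds on a and b put both into the range of summation.\<close>
  also have "\<dots> = (\<Sum>x\<le>l. if x = b then ip l N (\<lambda>w. f (b # w)) (\<lambda>w. g (a # w)) else 0)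
       + (\<Sum>x\<le>l. ip l N (\<lambda>w. f (x # w)) (glop b a (\<lambda>w. g (x # w))))"
    using assms by (simp add: Suc.IH)
  also have "\<dots> = ip l (Suc N) f (glop b a g)"
    unfolding split cons ip_add_right sum.distrib
    by (intro arg_cong2[where f = "(+)"] sum.cong) auto
  finally show ?case .
qed

section \<open>Finite dimension and orthogonal projection\<close>

lemma sum_tensor_apply: "(\<Sum>i\<in>I. f i) w = (\<Sum>i\<in>I. f i w)" for f :: "'a \<Rightarrow> tensor"
  by (induction I rule: infinite_finite_induct) (auto simp: pointwise)

lemma finite_dim_tensors: "\<exists>B. finite B \<and> tensors l N \<subseteq> ten.span B"
proof (intro exI conjI subsetI)
  let ?d = "\<lambda>w u. if u = w then 1 else (0::complex)"
  show "finite (?d ` words l N)" by simp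
  fix f assume f: "f \<in> tensors l N"
  have "f = (\<Sum>w\<in>words l N. scl (f w) (?d w))"
  proof
    fix u
    have "(\<Sum>w\<in>words l N. scl (f w) (?d w)) u = (\<Sum>w\<in>words l N. if u = w then f w else 0)"
      by (simp add: if_distrib sum_tensor_apply pointwise cong: if_cong) 
    also have "\<dots> = f u" using f by (auto simp: tensors_def)
    finally show "f u = (\<Sum>w\<in>words l N. scl (f w) (?d w)) u" by simp
  qed
  then show "f \<in> ten.span (?d ` words l N)"
    by (metis (no_types, lifting) ten.span_sum ten.span_scale ten.span_base image_eqI)
qed

text \<open>Gram-Schmidt, one generator at a time: \<open>d\<close> is the part of \<open>a\<close>
  orthogonal to the earlier span, and the projection gains its component along
  \<open>d\<close>.\<close>

lemma orthogonal_projection_span: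
  assumes "finite B" "B \<subseteq> tensors l N"
  shows "\<exists>y\<in>ten.span B. \<forall>u\<in>ten.span B. ip l N (x - y) u = 0"
  using assms
proof (induction B arbitrary: x)
  case empty
  then show ?case by auto
next
  case (insert a B)
  have sp: "ten.span B \<subseteq> tensors l N"
    using insert.prems by (intro ten.span_minimal subspace_tensors) auto
  obtain p where p: "p \<in> ten.span B" "\<And>u. u \<in> ten.span B \<Longrightarrow> ip l N (a - p) u = 0"
    using insert by (metis insert_subset)
  obtain q where q: "q \<in> ten.span B" "\<And>u. u \<in> ten.span B \<Longrightarrow> ip l N (x - q) u = 0"
    using insert by (metis insert_subset)
  define d where "d = a - p"
  have dT: "d \<in> tensors l N"
    unfolding d_def using insert.prems p sp by (intro tensors_diff) auto
  have spB: "z \<in> ten.span (insert a B)" if "z \<in> ten.span B" for z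
    using that ten.span_mono[of B "insert a B"] by auto
  have dsp: "d \<in> ten.span (insert a B)"
    unfolding d_def by (intro ten.span_diff ten.span_base spB p) simp
  define c where "c = ip l N (x - q) d / ip l N d d"
  have cd: "c * ip l N d d = ip l N (x - q) d"
  \<comment> \<open>If \<open>a\<close> already lies in the earlier span, then d = 0 and the
    quotient defining \<open>c\<close> has denominator 0; the equation survives because both sides
    vanish.\<close>
  proof (cases "ip l N d d = 0")
    case True
    then show ?thesis using ip_self_eq_0[OF dT True] by simp
  qed (simp add: c_def)
  have "ip l N (x - (q + scl c d)) u = 0" if u: "u \<in> ten.span (insert a B)" for u
  proof -
    obtain k where k: "u - scl k a \<in> ten.span B" using u ten.span_breakdown_eq by metis
    then have k': "u - scl k d \<in> ten.span B"
      using ten.span_add[OF k ten.span_scale[OF p(1), of k]]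
      by (simp add: d_def ten.scale_right_diff_distrib algebra_simps)
    have "ip l N (x - (q + scl c d)) u
       = ip l N (x - q) (u - scl k d) + cnj k * ip l N (x - q) d
         - c * (ip l N d (u - scl k d) + cnj k * ip l N d d)"
      by (simp add: ip_diff_left ip_diff_right ip_add_left ip_scl_left ip_scl_right algebra_simps)
    also have "\<dots> = cnj k * (ip l N (x - q) d - c * ip l N d d)"
      using q(2)[OF k'] p(2)[OF k'] by (simp add: d_def algebra_simps)
    finally show ?thesis by (simp add: cd)
  qed
  moreover have "q + scl c d \<in> ten.span (insert a B)"
    by (intro ten.span_add ten.span_scale spB q dsp)
  ultimately show ?case by blast
qed

lemma orthogonal_projection:
  assumes U: "ten.subspace U" "U \<subseteq> tensors l N"
  obtains y where "y \<in> U" "\<And>u. u \<in> U \<Longrightarrow> ip l N (x - y) u = 0"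
proof -
  obtain S where S: "finite S" "tensors l N \<subseteq> ten.span S" using finite_dim_tensors by blast
  obtain B where B: "B \<subseteq> U" "ten.independent B" "U \<subseteq> ten.span B" using ten.basis_exists[of U] by metis
  have "finite B" using ten.independent_span_bound[OF S(1) B(2)] B(1) U(2) S(2) by blast
  moreover have "ten.span B = U" using B U(1) ten.span_minimal by blast
  ultimately show thesis
    using orthogonal_projection_span[of B l N x] B(1) U(2) that by (metis subset_trans)
qed

section \<open>Cyclic highest weight modules\<close>

inductive_set gen :: "(nat \<times> nat) set \<Rightarrow> tensor \<Rightarrow> tensor set" for P v where
  base: "v \<in> gen P v"
| add: "x \<in> gen P v \<Longrightarrow> y \<in> gen P v \<Longrightarrow> x + y \<in> gen P v"
| scl: "x \<in> gen P v \<Longrightarrow> scl c x \<in> gen P v"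
| glop: "x \<in> gen P v \<Longrightarrow> (a, b) \<in> P \<Longrightarrow> glop a b x \<in> gen P v"

lemma scl_0_left [simp]: "scl 0 x = 0"
  by (rule ten.scale_zero_left)

lemma scl_0_right [simp]: "scl c 0 = 0"
  by (rule ten.scale_zero_right)

lemma gen_0: "0 \<in> gen P v"
  using gen.scl[OF gen.base[of v P], of 0] by simp

lemma subspace_gen: "ten.subspace (gen P v)"
  by (auto simp: ten.subspace_def gen_0 gen.add gen.scl)

lemma gen_diff: "x \<in> gen P v \<Longrightarrow> y \<in> gen P v \<Longrightarrow> x - y \<in> gen P v"
  using subspace_gen ten.subspace_diff by blast

lemma gen_minimal:
  assumes "x \<in> gen P v" "ten.subspace U" "v \<in> U"
    and "\<And>a b y. (a, b) \<in> P \<Longrightarrow> y \<in> U \<Longrightarrow> glop a b y \<in> U"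
  shows "x \<in> U"
  using assms(1)
  by induction (use assms in \<open>auto intro: ten.subspace_add ten.subspace_scale\<close>)

text \<open>Each operator used to build \<open>x\<close> is moved to the other side of the form,
  where its adjoint keeps \<open>Z\<close> stable, until only \<open>v\<close> is left.\<close>

lemma gen_orthogonal:
  assumes "x \<in> gen P v" "P \<subseteq> {..l} \<times> {..l}"
    and "\<And>z. z \<in> Z \<Longrightarrow> ip l N z v = 0"
    and "\<And>z a b. z \<in> Z \<Longrightarrow> (a, b) \<in> P \<Longrightarrow> glop b a z \<in> Z"
    and "z \<in> Z"
  shows "ip l N z x = 0"
  using assms(1,5)
proof (induction arbitrary: z)
  case (glop x a b)
  then have "ip l N z (glop a b x) = ip l N (glop b a z) x"
    using assms(2) by (subst ip_glop) auto
  then show ?case using glop assms(4) by auto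
qed (auto simp: assms(3) ip_add_right ip_scl_right)

definition lowering :: "nat \<Rightarrow> (nat \<times> nat) set" where
  "lowering n = {(a, b). b < a \<and> a \<le> n}"

abbreviation cyc :: "nat \<Rightarrow> tensor \<Rightarrow> tensor set" where
  "cyc n v \<equiv> gen (lowering n) v"

definition singular :: "nat \<Rightarrow> tensor \<Rightarrow> bool" where
  "singular n v \<longleftrightarrow> (\<forall>b\<le>n. \<forall>a<b. glop a b v = 0)"

text \<open>These are weights of gl: eigenvalues of the E_aa themselves, hence natural numbers,
  instead of those of the differences h_i.\<close>

definition weight_vec :: "nat \<Rightarrow> (nat \<Rightarrow> nat) \<Rightarrow> tensor \<Rightarrow> bool" where
  "weight_vec n \<kappa> v \<longleftrightarrow> (\<forall>a\<le>n. glop a a v = scl (of_nat (\<kappa> a)) v)"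

lemma cyc_tensors:
  assumes "x \<in> cyc n v" "n \<le> l" "v \<in> tensors l N"
  shows "x \<in> tensors l N"
  using assms by (intro gen_minimal[OF assms(1) subspace_tensors])
    (auto simp: lowering_def intro!: glop_tensors)

text \<open>For a highest weight vector the lowering units already generate a full submodule. Moving
  E_cd past the last lowering unit leaves units applied to the shorter element, so an induction over
  all (c, d) at once suffices.\<close>

lemma cyc_closed:
  assumes "x \<in> cyc n v" "singular n v" "weight_vec n \<kappa> v" "c \<le> n" "d \<le> n"
  shows "glop c d x \<in> cyc n v"
  using assms(1,4,5)
proof (induction arbitrary: c d)
  case base
  consider "d < c" | "c < d" | "c = d" by linarith
  then show ?case
    using assms(2,3) base
    by cases (auto simp: singular_def weight_vec_def lowering_def gen_0 intro: gen.intros)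
next
  case (glop x a b)
  then have ab: "a \<le> n" "b \<le> n" by (auto simp: lowering_def)
  have "glop a b (glop c d x) \<in> cyc n v" "glop c b x \<in> cyc n v" "glop a d x \<in> cyc n v"
    using glop ab by (auto intro: gen.glop)
  then show ?case
    unfolding glop_commutator[of c d a b] by (auto intro!: gen.add gen_diff gen_0)
qed (auto simp: glop_add glop_scl intro: gen.intros)

text \<open>Adjoints of lowering units are raising units, and these send \<open>z\<close> to 0. So
  {z, 0} is stable.\<close>

lemma singular_orthogonal:
  assumes "x \<in> cyc n v" "n \<le> l" "singular n z" "ip l N z v = 0"
  shows "ip l N z x = 0"
  by (rule gen_orthogonal[OF assms(1), where Z = "{z, 0}"])
    (use assms in \<open>auto simp: lowering_def singular_def\<close>)

lemma singular_diff: "singular n x \<Longrightarrow> singular n y \<Longrightarrow> singular n (x - y)"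
  and singular_scl: "singular n x \<Longrightarrow> singular n (scl c x)"
  by (auto simp: singular_def glop_diff glop_scl glop_add)

text \<open>The component of \<open>x\<close> orthogonal to \<open>v\<close> is again singular,
  hence orthogonal to all of \<open>cyc n v\<close> and in particular to itself.\<close>

lemma singular_in_cyc:
  assumes "x \<in> cyc n v" "singular n x" "n \<le> l" "v \<in> tensors l N" "singular n v"
  obtains c where "x = scl c v"
proof -
  define c where "c = ip l N x v / ip l N v v"
  let ?d = "x - scl c v"
  have d: "?d \<in> cyc n v" using assms by (intro gen_diff gen.scl gen.base)
  have dT: "?d \<in> tensors l N" using cyc_tensors[OF d] assms by blast
  have "ip l N ?d v = 0"
    using ip_self_eq_0[OF assms(4)] by (cases "ip l N v v = 0") (auto simp: c_def ip_diff_left ip_scl_left)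
  then have "ip l N ?d ?d = 0"
    using assms by (intro singular_orthogonal[OF d]) (auto intro: singular_diff singular_scl)
  then have "?d = 0" using ip_self_eq_0 dT by blast
  then show thesis using that[of c] by simp
qed

text \<open>E_(a,b+1) = [E_(a,b), E_(b,b+1)], and likewise for the transposes.\<close>

lemma simple_closed:
  assumes U: "ten.subspace U"
    and up: "\<And>i x. i < n \<Longrightarrow> x \<in> U \<Longrightarrow> glop i (Suc i) x \<in> U"
    and down: "\<And>i x. i < n \<Longrightarrow> x \<in> U \<Longrightarrow> glop (Suc i) i x \<in> U"
    and ab: "a < b" "b \<le> n" "x \<in> U"
  shows "glop a b x \<in> U" "glop b a x \<in> U"
proof -
  have "glop a b x \<in> U \<and> glop b a x \<in> U" using ab
  proof (induction b arbitrary: x)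
    case (Suc b)
    show ?case
    proof (cases "a = b")
      case True
      then show ?thesis using Suc up down by auto
    next
      case False
      then have lt: "a < b" using Suc by auto
      have 1: "glop a (Suc b) x = glop a b (glop b (Suc b) x) - glop b (Suc b) (glop a b x)"
        using glop_commutator[of a b b "Suc b" x] lt by simp
      have 2: "glop (Suc b) a x = glop (Suc b) b (glop b a x) - glop b a (glop (Suc b) b x)"
        using glop_commutator[of "Suc b" b b a x] lt by simp
      show ?thesis
        unfolding 1 2 using Suc lt up down by (auto intro!: ten.subspace_diff[OF U])
    qed
  qed simp
  then show "glop a b x \<in> U" "glop b a x \<in> U" by auto
qed

text \<open>The projection \<open>u\<close> of \<open>v\<close> to \<open>U\<close> is singular,
  because E_ab u is orthogonal to itself: E_ab v = 0, and v - u is orthogonal to \<open>U\<close>.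
  So \<open>u\<close> is a multiple of \<open>v\<close>. Either it is 0, and then \<open>U\<close>
  is orthogonal to \<open>v\<close> and to everything generated from it, or \<open>U\<close>
  contains \<open>v\<close>.\<close>

lemma cyc_irreducible:
  assumes hw: "n \<le> l" "v \<in> tensors l N" "singular n v"
    and U: "ten.subspace U" "U \<subseteq> cyc n v"
    and up: "\<And>i x. i < n \<Longrightarrow> x \<in> U \<Longrightarrow> glop i (Suc i) x \<in> U"
    and down: "\<And>i x. i < n \<Longrightarrow> x \<in> U \<Longrightarrow> glop (Suc i) i x \<in> U"
  shows "U = {0} \<or> U = cyc n v"
proof -
  have UT: "U \<subseteq> tensors l N" using U(2) cyc_tensors hw by blast
  note closed = simple_closed[OF U(1) up down]
  obtain u where u: "u \<in> U" "\<And>z. z \<in> U \<Longrightarrow> ip l N (v - u) z = 0"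
    using orthogonal_projection[OF U(1) UT] by blast
  have "glop a b u = 0" if ab: "a < b" "b \<le> n" for a b
  proof -
    have "glop a b u \<in> U" "glop b a (glop a b u) \<in> U" using closed ab u by auto
    moreover have "glop a b v = 0" using hw ab by (auto simp: singular_def)
    then have "ip l N (glop a b u) (glop a b u) = - ip l N (glop a b (v - u)) (glop a b u)"
      by (simp only: glop_diff ip_diff_left) simp
    then have "ip l N (glop a b u) (glop a b u) = - ip l N (v - u) (glop b a (glop a b u))"
      using ip_glop[of a l b N "v - u"] ab hw(1) by simp
    ultimately show ?thesis using u(2) ip_self_eq_0[of "glop a b u"] UT by auto
  qed
  then have "singular n u" by (auto simp: singular_def)
  then obtain c where c: "u = scl c v"
    using singular_in_cyc[of u n v l N] u(1) U(2) hw by blast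
  show ?thesis
  proof (cases "c = 0")
    case True
    then have z0: "ip l N z v = 0" if "z \<in> U" for z
      using u(2)[OF that] c ip_eq_0_commute by auto
    have "ip l N z x = 0" if "z \<in> U" "x \<in> cyc n v" for z x
      by (rule gen_orthogonal[OF that(2)]) (use that z0 hw closed in \<open>auto simp: lowering_def\<close>)
    then show ?thesis using U UT ip_self_eq_0 ten.subspace_0[OF U(1)] by blast
  next
    case False
    then have "v = scl (inverse c) u" by (simp add: c)
    then have "v \<in> U" using u(1) U(1) ten.subspace_scale by blast
    then have "cyc n v \<subseteq> U"
      by (auto elim!: gen_minimal intro!: U closed simp: lowering_def)
    then show ?thesis using U by auto
  qed
qed

section \<open>Strings of the sl2 triple E_ab, E_ba, E_aa - E_bb\<close>

lemma raise_lower_power: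
  assumes ab: "a \<noteq> b" and ev: "glop a b v = 0"
    and wa: "glop a a v = scl x v" and wb: "glop b b v = scl y v"
  shows "glop a a ((glop b a ^^ k) v) = scl (x - of_nat k) ((glop b a ^^ k) v)"
    and "glop b b ((glop b a ^^ k) v) = scl (y + of_nat k) ((glop b a ^^ k) v)"
    and "glop a b ((glop b a ^^ Suc k) v) = scl (of_nat (Suc k) * (x - y - of_nat k)) ((glop b a ^^ k) v)"
proof -
  let ?w = "\<lambda>k. (glop b a ^^ k) v"
  have A: "glop a a (?w k) = scl (x - of_nat k) (?w k)" for k
  proof (induction k)
    case (Suc k)
    have "glop a a (?w (Suc k)) = glop b a (glop a a (?w k)) - scl 1 (?w (Suc k))"
      using glop_commutator[of a a b a "?w k"] ab by simp
    also have "\<dots> = scl (x - of_nat k - 1) (?w (Suc k))"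
      by (simp only: Suc glop_scl funpow.simps o_apply glop_diff
          ten.scale_left_diff_distrib)
    finally show ?case by (simp add: algebra_simps)
  qed (simp add: wa)
  have B: "glop b b (?w k) = scl (y + of_nat k) (?w k)" for k
  proof (induction k)
    case (Suc k)
    have "glop b b (?w (Suc k)) = glop b a (glop b b (?w k)) + scl 1 (?w (Suc k))"
      using glop_commutator[of b b b a "?w k"] ab by simp
    also have "\<dots> = scl (y + of_nat k + 1) (?w (Suc k))"
      by (simp only: Suc glop_scl funpow.simps o_apply glop_add
          ten.scale_left_distrib)
    finally show ?case by (simp add: algebra_simps)
  qed (simp add: wb)
  show "glop a a (?w k) = scl (x - of_nat k) (?w k)"
    and "glop b b (?w k) = scl (y + of_nat k) (?w k)" by (fact A B)+
  show "glop a b (?w (Suc k)) = scl (of_nat (Suc k) * (x - y - of_nat k)) (?w k)"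
  proof (induction k)
    case 0
    then show ?case using glop_commutator[of a b b a v] by (simp add: ev wa wb ten.scale_left_diff_distrib)
  next
    case (Suc k)
    have "glop a b (?w (Suc (Suc k))) = glop b a (glop a b (?w (Suc k)))
        + glop a a (?w (Suc k)) - glop b b (?w (Suc k))"
      using glop_commutator[of a b b a "?w (Suc k)"] by simp
    also have "\<dots> = scl (of_nat (Suc k) * (x - y - of_nat k)) (?w (Suc k))
        + scl (x - of_nat (Suc k)) (?w (Suc k)) - scl (y + of_nat (Suc k)) (?w (Suc k))"
      unfolding Suc.IH A B glop_scl by simp
    also have "\<dots> = scl (of_nat (Suc k) * (x - y - of_nat k) + (x - of_nat (Suc k)) - (y + of_nat (Suc k)))
         (?w (Suc k))"
      by (simp only: ten.scale_left_distrib ten.scale_left_diff_distrib)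
    also have "of_nat (Suc k) * (x - y - of_nat k) + (x - of_nat (Suc k)) - (y + of_nat (Suc k))
        = of_nat (Suc (Suc k)) * (x - y - of_nat (Suc k))"
      by (simp add: algebra_simps)
    finally show ?case .
  qed
qed

lemma glop_funpow_0 [simp]: "(glop a b ^^ k) 0 = 0"
  by (induction k) auto

text \<open>At the exponent x - y + 1 the coefficient in the string formula vanishes, so this power
  is killed by E_ab; being in the image of E_ba, it is orthogonal to itself. Positivity of the form
  replaces the representation theory of sl2.\<close>

lemma lower_power_eq_0:
  assumes ab: "a \<le> l" "b \<le> l" "a \<noteq> b" and v: "v \<in> tensors l N" and ev: "glop a b v = 0"
    and wa: "glop a a v = scl (of_nat x) v" and wb: "glop b b v = scl (of_nat y) v"
    and k: "x < y + k" "y \<le> x"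
  shows "(glop b a ^^ k) v = 0"
proof -
  define m where "m = x - y"
  let ?w = "\<lambda>k. (glop b a ^^ k) v"
  have T: "?w k \<in> tensors l N" for k
    by (induction k) (auto intro!: glop_tensors v ab)
  have "glop a b (?w (Suc m)) = 0"
    using raise_lower_power(3)[OF ab(3) ev wa wb, of m] k by (simp add: m_def of_nat_diff)
  then have "ip l N (?w (Suc m)) (?w (Suc m)) = 0"
    using ip_glop[of b l a N "?w m" "?w (Suc m)"] ab by simp
  then have 0: "?w (Suc m) = 0" using ip_self_eq_0 T by blast
  obtain j where "k = j + Suc m" using k m_def by (metis add.commute le_Suc_ex less_diff_conv2 Suc_leI)
  then show ?thesis using 0 by (simp only: funpow_add o_apply glop_funpow_0)
qed

section \<open>Highest weight vectors in tensor powers\<close>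

text \<open>The type of a tensor does not record its degree, so the position \<open>k\<close> at
  which words are split has to be passed along.\<close>

definition tens :: "nat \<Rightarrow> tensor \<Rightarrow> tensor \<Rightarrow> tensor" where
  "tens k f g = (\<lambda>w. f (take k w) * g (drop k w))"

lemma tens_0_left [simp]: "tens k 0 g = 0"
  and tens_0_right [simp]: "tens k f 0 = 0"
  and tens_scl_left: "tens k (scl c f) g = scl c (tens k f g)"
  and tens_scl_right: "tens k f (scl c g) = scl c (tens k f g)"
  by (auto simp: tens_def fun_eq_iff pointwise algebra_simps)

lemma tens_tensors:
  assumes "f \<in> tensors l k" "g \<in> tensors l M"
  shows "tens k f g \<in> tensors l (k + M)"
  unfolding tensors_def
proof (intro CollectI allI impI)
  fix w assume "tens k f g w \<noteq> 0"
  then have "take k w \<in> words l k" "drop k w \<in> words l M"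
    using assms by (auto simp: tens_def tensors_def)
  moreover have "set w = set (take k w) \<union> set (drop k w)"
    by (metis append_take_drop_id set_append)
  ultimately show "w \<in> words l (k + M)" by (auto simp: words_def)
qed

lemma tens_nonzero:
  assumes "f \<in> tensors l k" "f \<noteq> 0" "g \<noteq> 0"
  shows "tens k f g \<noteq> 0"
proof -
  obtain u w where "f u \<noteq> 0" "g w \<noteq> 0"
    using assms by (auto simp: fun_eq_iff pointwise)
  moreover then have "length u = k" using assms(1) by (auto simp: tensors_def words_def)
  ultimately have "tens k f g (u @ w) \<noteq> 0" by (simp add: tens_def)
  then show ?thesis by (auto simp: pointwise)
qed

lemma glop_tens:
  assumes f: "f \<in> tensors l k"
  shows "glop a b (tens k f g) = tens k (glop a b f) g + tens k f (glop a b g)"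
proof
  fix w
  show "glop a b (tens k f g) w = (tens k (glop a b f) g + tens k f (glop a b g)) w"
  proof (cases "k \<le> length w")
    case True
    define u w' where "u = take k w" and "w' = drop k w"
    have w: "w = u @ w'" and len: "length u = k"
      using True by (auto simp: u_def w'_def)
    have "glop a b (\<lambda>u'. tens k f g (u' @ w')) u = glop a b (\<lambda>u'. g w' * f u') u"
      by (rule glop_cong) (simp add: tens_def len)
    moreover have "(\<lambda>w''. tens k f g (u @ w'')) = (\<lambda>w''. f u * g w'')"
      by (simp add: tens_def len)
    ultimately show ?thesis
      by (simp add: w glop_append glop_times_apply pointwise) (simp add: tens_def len)
  next
    case False
    \<comment> \<open>Words too short to contain a full first block: \<open>f\<close> vanishes on
      them, which makes both sides 0.\<close>
    have f0: "f u = 0" if "length u < k" for u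
      using f that by (auto simp: tensors_def words_def)
    have "glop a b h w = 0" if "\<And>u. length u < k \<Longrightarrow> h u = 0" for h
      using False that by (metis glop_nonzeroE length_list_update not_le)
    from this[of f] this[of "tens k f g"] have "glop a b f w = 0" "glop a b (tens k f g) w = 0"
      using f0 by (simp_all add: tens_def)
    then show ?thesis using False f0 by (simp add: tens_def pointwise)
  qed
qed

lemma singular_tens:
  assumes "f \<in> tensors l k" "singular n f" "singular n g"
  shows "singular n (tens k f g)"
  using assms by (auto simp: singular_def glop_tens)

lemma weight_vec_tens:
  assumes "f \<in> tensors l k" "weight_vec n \<kappa> f" "weight_vec n \<kappa>' g"
  shows "weight_vec n (\<lambda>a. \<kappa> a + \<kappa>' a) (tens k f g)"
  using assms
  by (auto simp: weight_vec_def glop_tens tens_scl_left tens_scl_right ten.scale_left_distrib)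

lemma funpow_glop_tens:
  assumes "f \<in> tensors l k" "glop a b f = 0"
  shows "(glop a b ^^ j) (tens k f g) = tens k f ((glop a b ^^ j) g)"
  using assms by (induction j) (auto simp: glop_tens)

text \<open>Two applications to the first factor give 0, so the Leibniz expansion has only two
  terms; the coefficient counts which of the j + 1 applications hits the first factor.\<close>

lemma funpow_glop_tens':
  assumes "f \<in> tensors l k" "f' \<in> tensors l k" "glop a b f = f'" "glop a b f' = 0"
  shows "(glop a b ^^ Suc j) (tens k f g)
    = tens k f ((glop a b ^^ Suc j) g) + scl (of_nat (Suc j)) (tens k f' ((glop a b ^^ j) g))"
proof (induction j)
  case 0
  then show ?case using assms by (simp add: glop_tens add.commute)
next
  case (Suc j)
  let ?g = "\<lambda>j. (glop a b ^^ j) g"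
  have "(glop a b ^^ Suc (Suc j)) (tens k f g) = glop a b ((glop a b ^^ Suc j) (tens k f g))"
    by simp
  also have "\<dots> = tens k f (?g (Suc (Suc j)))
      + (scl 1 (tens k f' (?g (Suc j))) + scl (of_nat (Suc j)) (tens k f' (?g (Suc j))))"
    unfolding Suc.IH using assms
    by (simp add: glop_add glop_scl glop_tens[where l = l] algebra_simps)
  also have "scl 1 (tens k f' (?g (Suc j))) + scl (of_nat (Suc j)) (tens k f' (?g (Suc j)))
      = scl (of_nat (Suc (Suc j))) (tens k f' (?g (Suc j)))"
    by (subst ten.scale_left_distrib[symmetric]) simp
  finally show ?case .
qed

section \<open>Fundamental vectors: tensors expanded along the first factor\<close>

fun consT :: "(nat \<Rightarrow> tensor) \<Rightarrow> tensor" where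
  "consT F [] = 0"
| "consT F (x # w) = F x w"

lemma glop_consT: "glop a b (consT F) = consT (\<lambda>x. (if x = a then F b else 0) + glop a b (F x))"
proof
  fix w show "glop a b (consT F) w = consT (\<lambda>x. (if x = a then F b else 0) + glop a b (F x)) w"
    by (cases w) (auto simp: pointwise)
qed

lemma consT_0: "consT (\<lambda>x. 0) = 0"
proof
  fix w show "consT (\<lambda>x. 0) w = 0 w" by (cases w) (auto simp: pointwise)
qed

lemma scl_consT: "scl c (consT F) = consT (\<lambda>x. scl c (F x))"
proof
  fix w show "scl c (consT F) w = consT (\<lambda>x. scl c (F x)) w" by (cases w) (auto simp: pointwise)
qed

lemma consT_tensors:
  assumes "\<And>x. F x \<in> tensors l N" "\<And>x. l < x \<Longrightarrow> F x = 0"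
  shows "consT F \<in> tensors l (Suc N)"
  unfolding tensors_def
proof (intro CollectI allI impI)
  fix w assume nz: "consT F w \<noteq> 0"
  then obtain x u where w: "w = x # u" by (cases w) auto
  then have "F x u \<noteq> 0" using nz by simp
  then have "u \<in> words l N" "x \<le> l" using assms
    by (auto simp: tensors_def) (metis not_le zero_fun_apply)
  then show "w \<in> words l (Suc N)" by (auto simp: w words_def)
qed

definition unit_tensor :: tensor where
  "unit_tensor = (\<lambda>w. if w = [] then 1 else 0)"

lemma glop_unit_tensor [simp]: "glop a b unit_tensor = 0"
proof
  fix w show "glop a b unit_tensor w = 0 w"
    by (rule ccontr, unfold zero_fun_apply, erule glop_nonzeroE) (auto simp: unit_tensor_def split: if_splits)
qed

lemma unit_tensor_props:
  "unit_tensor \<in> tensors l 0" "unit_tensor \<noteq> 0"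
  by (auto simp: unit_tensor_def tensors_def words_def fun_eq_iff pointwise)

text \<open>The witness is \<open>e\<^sub>0 \<and> \<dots> \<and> e\<^sub>k\<close>, expanded along its first tensor factor: replacing \<open>e\<^sub>x\<close> by
  \<open>e\<^sub>k\<close> in \<open>v = e\<^sub>0 \<and> \<dots> \<and> e\<^sub>k\<^sub>-\<^sub>1\<close> is the action of \<open>E\<^sub>k\<^sub>x\<close>.\<close>

lemma ex_fundamental_vector:
  assumes "k \<le> Suc l"
  shows "\<exists>f\<in>tensors l k. f \<noteq> 0 \<and> singular l f \<and> weight_vec l (\<lambda>a. if a < k then 1 else 0) f"
  using assms
proof (induction k)
  case 0
  show ?case
    by (rule bexI[of _ unit_tensor])
      (auto simp: unit_tensor_props singular_def weight_vec_def)
next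
  case (Suc k)
  then obtain v where v: "v \<in> tensors l k" "v \<noteq> 0" "singular l v"
      "weight_vec l (\<lambda>a. if a < k then 1 else 0) v" by auto
  have kl: "k \<le> l" using Suc.prems by simp
  have up: "glop a b v = 0" if "a < b" "b \<le> l" for a b
    using v(3) that by (auto simp: singular_def)
  have wt: "glop a a v = scl (of_nat (if a < k then 1 else 0)) v" if "a \<le> l" for a
    using v(4) that by (auto simp: weight_vec_def)
  \<comment> \<open>Replacing one factor of the wedge by another repeats a vector. For a < b this is
    singularity; for a > b it is the string of length 0 between the equal weights 1 and 1.\<close>
  have off: "glop a b v = 0" if "a < k" "b < k" "a \<noteq> b" for a b
  proof (cases "a < b")
    case True
    then show ?thesis using up that kl by auto
  next
    case False
    then show ?thesis
      using lower_power_eq_0[of b l a v k 1 1 1] v(1) up[of b a] wt[of a] wt[of b] that kl by simp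
  qed
  \<comment> \<open>The minus sign is that of the transposition of e_x and e_k; the normalization
    gives e_k the coefficient \<open>v\<close>.\<close>
  define F where "F x = (if x = k then v else if x < k then - glop k x v else 0)" for x
  have "(if x = a then F b else 0) + glop a b (F x) = 0" if ab: "a < b" "b \<le> l" for a b x
  proof -
    have c: "glop a b (glop k y v) = (if b = k then glop a y v else 0) - (if y = a then glop k b v else 0)"
      for y using glop_commutator[of a b k y v] up[OF ab] by simp
    show ?thesis
      using ab kl up off[of a x] up[of k b]
      by (auto simp: F_def glop_uminus c wt)
  qed
  then have sing: "singular l (consT F)"
    by (auto simp: singular_def glop_consT consT_0)
  have "(if x = a then F a else 0) + glop a a (F x) = scl (of_nat (if a < Suc k then 1 else 0)) (F x)"
    if a: "a \<le> l" for a x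
  proof -
    have c: "glop a a (glop k x v) = glop k x (glop a a v)
        + (if a = k then glop k x v else 0) - (if x = a then glop k x v else 0)"
      using glop_commutator[of a a k x v] by (auto split: if_splits)
    show ?thesis
      using kl by (auto simp: F_def glop_uminus c wt[OF a] less_Suc_eq)
  qed
  then have wt': "weight_vec l (\<lambda>a. if a < Suc k then 1 else 0) (consT F)"
    by (auto simp: weight_vec_def glop_consT scl_consT)
  have T: "consT F \<in> tensors l (Suc k)"
  proof (rule consT_tensors)
    show "F x \<in> tensors l k" for x
      using glop_tensors[OF v(1) kl, of x] tensors_scl[of "glop k x v" l k "-1"] v(1)
      by (auto simp: F_def)
  qed (use kl in \<open>auto simp: F_def\<close>)
  obtain w where "v w \<noteq> 0" using v(2) by (auto simp: fun_eq_iff pointwise)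
  then have "consT F (k # w) \<noteq> 0" by (simp add: F_def)
  then have "consT F \<noteq> 0" by (metis zero_fun_apply)
  then show ?case using sing wt' T by blast
qed

text \<open>The monomial D^b restricted to its factors E_(i,l) with i < k, with E_(0,l) applied
  first. The fixed order allows arguments by induction on the number of factors.\<close>

primrec Dseq :: "nat \<Rightarrow> (nat \<Rightarrow> nat) \<Rightarrow> nat \<Rightarrow> tensor \<Rightarrow> tensor" where
  "Dseq l b 0 x = x"
| "Dseq l b (Suc k) x = (glop k l ^^ b k) (Dseq l b k x)"

lemma Dseq_cong: "(\<And>i. i < k \<Longrightarrow> b i = b' i) \<Longrightarrow> Dseq l b k x = Dseq l b' k x"
  by (induction k) auto

lemma funpow_glop_scl: "(glop a b ^^ k) (scl c x) = scl c ((glop a b ^^ k) x)"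
  by (induction k) (auto simp: glop_scl)

lemma Dseq_tens:
  assumes "f \<in> tensors l k" "\<And>i. i < j \<Longrightarrow> glop i l f = 0"
  shows "Dseq l b j (tens k f x) = tens k f (Dseq l b j x)"
  using assms(2) by (induction j) (auto simp: funpow_glop_tens[OF assms(1)])

section \<open>Branching vectors, built one tensor factor at a time\<close>

text \<open>Over-application of the raising operators gives 0. This is what makes the first summand of
  \<open>funpow_glop_tens'\<close> disappear when a tensor factor is added.\<close>

definition vanishing :: "nat \<Rightarrow> (nat \<Rightarrow> nat) \<Rightarrow> tensor \<Rightarrow> bool" where
  "vanishing l b x \<longleftrightarrow> (\<forall>k<l. (glop k l ^^ Suc (b k)) (Dseq l b k x) = 0)"

text \<open>\<open>\<xi>\<close> is a highest weight vector for the smaller algebra which is not orthogonal to the module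
  generated by \<open>v\<close>, since raising operators lead from \<open>\<xi>\<close> to a multiple of \<open>v\<close>.\<close>

definition branch_vec :: "nat \<Rightarrow> nat \<Rightarrow> (nat \<Rightarrow> nat) \<Rightarrow> (nat \<Rightarrow> nat) \<Rightarrow> tensor \<Rightarrow> tensor \<Rightarrow> bool" where
  "branch_vec n N m b v \<xi> \<longleftrightarrow> \<xi> \<in> tensors (Suc n) N \<and> singular n \<xi> \<and>
     weight_vec (Suc n) (\<lambda>a. if a \<le> n then (\<Sum>i=a..n. m i) - b a else \<Sum>i\<le>n. b i) \<xi> \<and>
     (\<exists>c. c \<noteq> 0 \<and> Dseq (Suc n) b (Suc n) \<xi> = scl c v) \<and> vanishing (Suc n) b \<xi>"

lemma singular_mono: "singular l x \<Longrightarrow> n \<le> l \<Longrightarrow> singular n x"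
  by (auto simp: singular_def)

text \<open>The new factor e_0 \<and> ... \<and> e_i stays as it is. Every E_(a,l) kills it, so D^b
  acts on \<xi> alone.\<close>

lemma branch_vec_step_fix:
  assumes i: "i \<le> n" and f: "f \<in> tensors (Suc n) k" "singular (Suc n) f"
      "weight_vec (Suc n) (\<lambda>a. if a \<le> i then 1 else 0) f"
    and \<xi>: "branch_vec n N m b v \<xi>" and b: "\<And>a. a \<le> n \<Longrightarrow> b a \<le> m a"
  shows "branch_vec n (k + N) (m(i := Suc (m i))) b (tens k f v) (tens k f \<xi>)"
proof -
  have f0: "glop a (Suc n) f = 0" if "a < Suc n" for a
    using f(2) that by (auto simp: singular_def)
  have D: "Dseq (Suc n) b j (tens k f \<xi>) = tens k f (Dseq (Suc n) b j \<xi>)" if "j \<le> Suc n" for j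
    using that by (intro Dseq_tens[OF f(1)] f0) auto
  have van: "vanishing (Suc n) b (tens k f \<xi>)"
    unfolding vanishing_def
  proof (intro allI impI)
    fix j assume j: "j < Suc n"
    have "(glop j (Suc n) ^^ Suc (b j)) (Dseq (Suc n) b j \<xi>) = 0"
      using \<xi> j by (auto simp: branch_vec_def vanishing_def)
    then show "(glop j (Suc n) ^^ Suc (b j)) (Dseq (Suc n) b j (tens k f \<xi>)) = 0"
      using j by (simp only: D less_imp_le funpow_glop_tens[OF f(1) f0[OF j]] tens_0_right)
  qed
  have "weight_vec (Suc n) (\<lambda>a. (if a \<le> i then 1 else 0)
      + (if a \<le> n then (\<Sum>i=a..n. m i) - b a else \<Sum>i\<le>n. b i)) (tens k f \<xi>)"
    using \<xi> f by (intro weight_vec_tens) (auto simp: branch_vec_def)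
  moreover have "(if a \<le> i then 1 else 0) + (if a \<le> n then (\<Sum>i=a..n. m i) - b a else \<Sum>i\<le>n. b i)
     = (if a \<le> n then (\<Sum>j=a..n. (m(i := Suc (m i))) j) - b a else \<Sum>i\<le>n. b i)" for a
  proof (cases "a \<le> n")
    case True
    have "(\<Sum>j=a..n. (m(i := Suc (m i))) j) = (\<Sum>j=a..n. m j + (if j = i then 1 else 0))"
      by (intro sum.cong) auto
    then have "(\<Sum>j=a..n. (m(i := Suc (m i))) j) = (\<Sum>j=a..n. m j) + (if a \<le> i then 1 else 0)"
      using i by (simp add: sum.distrib)
    \<comment> \<open>The weight is a difference of natural numbers; this bound keeps it exact, so
      that the increment of the sum can be pulled out.\<close>
    moreover have "b a \<le> (\<Sum>j=a..n. m j)"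
      using b[OF True] member_le_sum[of a "{a..n}" m] True by auto
    ultimately show ?thesis using True by simp
  qed (use i in auto)
  ultimately have "weight_vec (Suc n) (\<lambda>a. if a \<le> n then (\<Sum>j=a..n. (m(i := Suc (m i))) j) - b a
      else \<Sum>i\<le>n. b i) (tens k f \<xi>)"
    by simp
  moreover obtain c where "c \<noteq> 0" "Dseq (Suc n) b (Suc n) \<xi> = scl c v"
    using \<xi> by (auto simp: branch_vec_def)
  then have "c \<noteq> 0" "Dseq (Suc n) b (Suc n) (tens k f \<xi>) = scl c (tens k f v)"
    using D[OF le_refl] by (simp_all add: tens_scl_right del: Dseq.simps)
  moreover have "tens k f \<xi> \<in> tensors (Suc n) (k + N)"
    using \<xi> f(1) by (intro tens_tensors) (auto simp: branch_vec_def)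
  moreover have "singular n (tens k f \<xi>)"
    using \<xi> singular_mono[OF f(2), of n] by (intro singular_tens[OF f(1)]) (auto simp: branch_vec_def)
  ultimately show ?thesis
    using van unfolding branch_vec_def by blast
qed

lemma Dseq_scl: "Dseq l b k (scl c x) = scl c (Dseq l b k x)"
  by (induction k) (auto simp: funpow_glop_scl)

text \<open>In the new factor e_i becomes e_l. The E_(a,l) with a < i kill this factor because e_a
  is still present; E_(i,l) restores \<open>f\<close>, and it does so in b_i + 1 ways since the term
  in which it never hits the factor is 0 by \<open>vanishing\<close>; the later ones kill
  \<open>f\<close>. Hence D^b leads to a nonzero multiple of \<open>tens k f v\<close>.\<close>

lemma branch_vec_step_move:
  assumes i: "i \<le> n" and f: "f \<in> tensors (Suc n) k" "singular (Suc n) f"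
      "weight_vec (Suc n) (\<lambda>a. if a \<le> i then 1 else 0) f"
    and \<xi>: "branch_vec n N m b v \<xi>" and b: "\<And>a. a \<le> n \<Longrightarrow> b a \<le> m a"
  shows "branch_vec n (k + N) (m(i := Suc (m i))) (b(i := Suc (b i))) (tens k f v)
    (tens k (glop (Suc n) i f) \<xi>)"
proof -
  let ?l = "Suc n"
  let ?b = "b(i := Suc (b i))"
  let ?g = "glop ?l i f"
  have up: "glop a c f = 0" if "a < c" "c \<le> ?l" for a c
    using f(2) that by (auto simp: singular_def)
  have wt: "glop a a f = scl (of_nat (if a \<le> i then 1 else 0)) f" if "a \<le> ?l" for a
    using f(3) that by (auto simp: weight_vec_def)
  have gT: "?g \<in> tensors ?l k" using f(1) by (simp add: glop_tensors)
  have f0: "glop a ?l f = 0" if "a < ?l" for a using up that by auto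
  have g0: "glop a ?l ?g = 0" if "a < i" for a
    using glop_commutator[of a ?l ?l i f] f0[of a] up[of a i] that i by simp
  have gi: "glop i ?l ?g = f"
    using glop_commutator[of i ?l ?l i f] f0[of i] wt[of i] wt[of ?l] i by simp
  \<comment> \<open>The letters c and l do not occur in \<open>f\<close>: both weights are 0, so the
    string has length 0.\<close>
  have low: "glop ?l c f = 0" if "i < c" "c \<le> n" for c
    using lower_power_eq_0[of c ?l ?l f k 0 0 1] that f(1) up[of c ?l] wt[of c] wt[of ?l] i by simp
  have "glop a c ?g = 0" if "a < c" "c \<le> n" for a c
    using glop_commutator[of a c ?l i f] up[of a c] low[of c] that by auto
  then have sing: "singular n (tens k ?g \<xi>)"
    using \<xi> by (intro singular_tens[OF gT]) (auto simp: branch_vec_def singular_def)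
  have wg: "weight_vec ?l (\<lambda>a. if a < i \<or> a = ?l then 1 else 0) ?g"
    unfolding weight_vec_def
  proof (intro allI impI)
    fix a assume a: "a \<le> ?l"
    show "glop a a ?g = scl (of_nat (if a < i \<or> a = ?l then 1 else 0)) ?g"
      using glop_commutator[of a a ?l i f] wt[OF a] i a by (auto simp: glop_scl)
  qed
  have low_j: "Dseq ?l ?b j (tens k ?g \<xi>) = tens k ?g (Dseq ?l b j \<xi>)" if "j \<le> i" for j
    using Dseq_tens[OF gT, of j ?b \<xi>] Dseq_cong[of j ?b b ?l \<xi>] g0 that by auto
  have \<xi>van: "(glop j ?l ^^ Suc (b j)) (Dseq ?l b j \<xi>) = 0" if "j \<le> n" for j
    using \<xi> that by (auto simp: branch_vec_def vanishing_def)
  note pow = funpow_glop_tens'[OF gT f(1) gi f0[of i]]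
  have high_j: "Dseq ?l ?b j (tens k ?g \<xi>) = scl (of_nat (Suc (b i))) (tens k f (Dseq ?l b j \<xi>))"
    if "i < j" "j \<le> ?l" for j
    using that
  proof (induction j)
    case (Suc j)
    show ?case
    proof (cases "j = i")
      case True
      then have "Dseq ?l ?b (Suc j) (tens k ?g \<xi>) = (glop i ?l ^^ Suc (b i)) (tens k ?g (Dseq ?l b i \<xi>))"
        by (simp only: Dseq.simps low_j fun_upd_same le_refl)
      also have "\<dots> = scl (of_nat (Suc (b i))) (tens k f ((glop i ?l ^^ b i) (Dseq ?l b i \<xi>)))"
        using i by (simp only: pow less_Suc_eq_le \<xi>van tens_0_right add_0_left)
      finally show ?thesis using True by (simp only: Dseq.simps)
    next
      case False
      then show ?thesis
        using Suc f0[of j] by (simp add: funpow_glop_scl funpow_glop_tens[OF f(1)])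
    qed
  qed simp
  have van: "vanishing ?l ?b (tens k ?g \<xi>)"
    unfolding vanishing_def
  proof (intro allI impI)
    fix j assume j: "j < ?l"
    consider "j < i" | "j = i" | "i < j" by linarith
    then show "(glop j ?l ^^ Suc (?b j)) (Dseq ?l ?b j (tens k ?g \<xi>)) = 0"
    proof cases
      case 1
      then show ?thesis
        using low_j[of j] \<xi>van[of j] j funpow_glop_tens[OF gT g0[OF 1], of "Suc (b j)"] by simp
    next
      case 2
      have "(glop i ?l ^^ Suc (Suc (b i))) (Dseq ?l b i \<xi>) = 0"
        using \<xi>van[OF i] by (simp add: funpow_swap1)
      then show ?thesis
        using 2 i \<xi>van[OF i] pow[of "Suc (b i)" "Dseq ?l b i \<xi>"]
        by (simp only: low_j le_refl fun_upd_same) simp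
    next
      case 3
      then show ?thesis
        using high_j[of j] \<xi>van[of j] j funpow_glop_tens[OF f(1) f0[OF j], of "Suc (b j)"]
        by (simp only: funpow_glop_scl fun_upd_other) simp
    qed
  qed
  have "weight_vec ?l (\<lambda>a. (if a < i \<or> a = ?l then 1 else 0)
      + (if a \<le> n then (\<Sum>i=a..n. m i) - b a else \<Sum>i\<le>n. b i)) (tens k ?g \<xi>)"
    using \<xi> wg gT by (intro weight_vec_tens) (auto simp: branch_vec_def)
  moreover have "(if a < i \<or> a = ?l then 1 else 0)
       + (if a \<le> n then (\<Sum>i=a..n. m i) - b a else \<Sum>i\<le>n. b i)
     = (if a \<le> n then (\<Sum>j=a..n. (m(i := Suc (m i))) j) - ?b a else \<Sum>i\<le>n. ?b i)"
    if "a \<le> ?l" for a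
  proof (cases "a \<le> n")
    case True
    have "(\<Sum>j=a..n. (m(i := Suc (m i))) j) = (\<Sum>j=a..n. m j + (if j = i then 1 else 0))"
      by (intro sum.cong) auto
    then have "(\<Sum>j=a..n. (m(i := Suc (m i))) j) = (\<Sum>j=a..n. m j) + (if a \<le> i then 1 else 0)"
      using i by (simp add: sum.distrib)
    moreover have "b a \<le> (\<Sum>j=a..n. m j)"
      using b[OF True] member_le_sum[of a "{a..n}" m] True by auto
    ultimately show ?thesis using True by auto
  next
    case False
    have "(\<Sum>j\<le>n. ?b j) = (\<Sum>j\<le>n. b j + (if j = i then 1 else 0))"
      by (intro sum.cong) auto
    then show ?thesis using i False that by (simp add: sum.distrib)
  qed
  ultimately have "weight_vec ?l (\<lambda>a. if a \<le> n then (\<Sum>j=a..n. (m(i := Suc (m i))) j) - ?b a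
      else \<Sum>i\<le>n. ?b i) (tens k ?g \<xi>)"
    unfolding weight_vec_def by auto
  moreover obtain c where "c \<noteq> 0" "Dseq ?l b ?l \<xi> = scl c v"
    using \<xi> by (auto simp: branch_vec_def)
  then have "of_nat (Suc (b i)) * c \<noteq> 0"
      "Dseq ?l ?b ?l (tens k ?g \<xi>) = scl (of_nat (Suc (b i)) * c) (tens k f v)"
    using high_j[of ?l] i by (simp_all only: tens_scl_right ten.scale_scale) (simp_all del: of_nat_Suc)
  moreover have "tens k ?g \<xi> \<in> tensors ?l (k + N)"
    using \<xi> gT by (intro tens_tensors) (auto simp: branch_vec_def)
  ultimately show ?thesis
    using sing van unfolding branch_vec_def by blast
qed

text \<open>The vector is a product with m_i factors of rank i + 1, built by induction on their
  number. It has to be the same for all \<open>b\<close>, which is why both step lemmas multiply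
  \<open>v\<close> by the same \<open>f\<close>.\<close>

theorem ex_highest_weight_vector:
  obtains N v where "v \<in> tensors (Suc n) N" "v \<noteq> 0" "singular (Suc n) v"
    "weight_vec (Suc n) (\<lambda>a. \<Sum>i=a..n. m i) v"
    "\<And>b. (\<And>a. a \<le> n \<Longrightarrow> b a \<le> m a) \<Longrightarrow> \<exists>\<xi>. branch_vec n N m b v \<xi>"
proof -
  have "\<exists>N v. v \<in> tensors (Suc n) N \<and> v \<noteq> 0 \<and> singular (Suc n) v \<and>
      weight_vec (Suc n) (\<lambda>a. \<Sum>i=a..n. m i) v \<and>
      (\<forall>b. (\<forall>a\<le>n. b a \<le> m a) \<longrightarrow> (\<exists>\<xi>. branch_vec n N m b v \<xi>))"
  proof (induction "\<Sum>i\<le>n. m i" arbitrary: m)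
    case 0
    then have m0: "m i = 0" if "i \<le> n" for i using that by simp
    have ms: "(\<Sum>i=a..n. m i) = 0" for a using m0 by (intro sum.neutral) auto
    have D: "Dseq (Suc n) b k unit_tensor = unit_tensor" if "k \<le> Suc n" "\<forall>a\<le>n. b a = 0" for b k
      using that by (induction k) auto
    have "branch_vec n 0 m b unit_tensor unit_tensor" if "\<forall>a\<le>n. b a \<le> m a" for b
    proof -
      have b0: "\<forall>a\<le>n. b a = 0" using that m0 by auto
      show ?thesis
        using D b0 ms by (auto simp: branch_vec_def unit_tensor_props singular_def weight_vec_def
            vanishing_def intro!: exI[of _ 1])
    qed
    moreover have "singular (Suc n) unit_tensor" "weight_vec (Suc n) (\<lambda>a. \<Sum>i=a..n. m i) unit_tensor"
      by (auto simp: singular_def weight_vec_def ms)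
    ultimately show ?case using unit_tensor_props(1)[of "Suc n"] unit_tensor_props(2) by blast
  next
    case (Suc t)
    then obtain i where i: "i \<le> n" "m i \<noteq> 0" by (metis sum.neutral atMost_iff nat.distinct(1))
    define m' where "m' = m(i := m i - 1)"
    have m: "m = m'(i := Suc (m' i))" using i by (auto simp: m'_def)
    have "(\<Sum>j\<le>n. m j) = (\<Sum>j\<le>n. m' j + (if j = i then 1 else 0))"
      by (intro sum.cong) (auto simp: m)
    then have "t = (\<Sum>j\<le>n. m' j)" using Suc.hyps(2) i by (simp add: sum.distrib)
    from Suc.hyps(1)[OF this] obtain N v where v: "v \<in> tensors (Suc n) N" "v \<noteq> 0"
      "singular (Suc n) v" "weight_vec (Suc n) (\<lambda>a. \<Sum>i=a..n. m' i) v"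
      "\<And>b. (\<forall>a\<le>n. b a \<le> m' a) \<Longrightarrow> \<exists>\<xi>. branch_vec n N m' b v \<xi>" by blast
    obtain f where f: "f \<in> tensors (Suc n) (Suc i)" "f \<noteq> 0" "singular (Suc n) f"
      "weight_vec (Suc n) (\<lambda>a. if a < Suc i then 1 else 0) f"
      using ex_fundamental_vector[of "Suc i" "Suc n"] i by auto
    then have f4: "weight_vec (Suc n) (\<lambda>a. if a \<le> i then 1 else 0) f" by (simp add: less_Suc_eq_le)
    have "(\<lambda>a. (if a \<le> i then 1 else 0) + (\<Sum>i=a..n. m' i)) = (\<lambda>a. \<Sum>j=a..n. m j)"
    proof
      fix a
      have "(\<Sum>j=a..n. m j) = (\<Sum>j=a..n. m' j + (if j = i then 1 else 0))"
        by (intro sum.cong) (auto simp: m)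
      then show "(if a \<le> i then 1 else 0) + (\<Sum>i=a..n. m' i) = (\<Sum>j=a..n. m j)"
        using i by (simp add: sum.distrib)
    qed
    then have w: "weight_vec (Suc n) (\<lambda>a. \<Sum>j=a..n. m j) (tens (Suc i) f v)"
      using weight_vec_tens[OF f(1) f4 v(4)] by simp
    have "\<exists>\<xi>. branch_vec n (Suc i + N) m b (tens (Suc i) f v) \<xi>" if b: "\<forall>a\<le>n. b a \<le> m a" for b
    \<comment> \<open>The new factor is altered only if the old ones of its rank cannot provide all
      b_i replacements, that is, if b_i = m_i.\<close>
    proof (cases "b i \<le> m' i")
      case True
      then have b': "\<And>a. a \<le> n \<Longrightarrow> b a \<le> m' a" using b by (auto simp: m'_def split: if_splits)
      then obtain \<xi> where "branch_vec n N m' b v \<xi>" using v(5) by blast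
      from branch_vec_step_fix[OF i(1) f(1,3) f4 this b'] show ?thesis using m by metis
    next
      case False
      define b' where "b' = b(i := b i - 1)"
      have b'': "\<And>a. a \<le> n \<Longrightarrow> b' a \<le> m' a" using b by (auto simp: m'_def b'_def diff_le_mono)
      have bb: "b = b'(i := Suc (b' i))" using False by (auto simp: b'_def)
      obtain \<xi> where "branch_vec n N m' b' v \<xi>" using v(5) b'' by blast
      from branch_vec_step_move[OF i(1) f(1,3) f4 this b''] show ?thesis using m bb by metis
    qed
    moreover have "tens (Suc i) f v \<in> tensors (Suc n) (Suc i + N)" "tens (Suc i) f v \<noteq> 0"
        "singular (Suc n) (tens (Suc i) f v)"
      using v f tens_tensors tens_nonzero singular_tens by blast+
    ultimately show ?case using w by blast
  qed
  then show thesis using that by blast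
qed

section \<open>Branching of the module generated by a highest weight vector\<close>

lemma glop_raise_commute: "a \<noteq> l \<Longrightarrow> c \<noteq> l \<Longrightarrow> glop a l (glop c l x) = glop c l (glop a l x)"
  by (subst glop_commutator) simp

lemma glop_funpow_commute:
  assumes "\<And>x. glop a b (glop c d x) = glop c d (glop a b x)"
  shows "glop a b ((glop c d ^^ k) x) = (glop c d ^^ k) (glop a b x)"
  using assms by (induction k) auto

lemma funpow_raise_commute:
  assumes "a \<noteq> l" "c \<noteq> l"
  shows "(glop a l ^^ j) ((glop c l ^^ k) x) = (glop c l ^^ k) ((glop a l ^^ j) x)"
  by (induction j) (auto simp: glop_funpow_commute glop_raise_commute assms)

text \<open>The E_(i,l) with i < l commute, so any of them can be brought to the front of the
  ordered product.\<close>

lemma Dseq_extract: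
  assumes "i < k" "k \<le> l"
  shows "Dseq l b k x = (glop i l ^^ b i) (Dseq l (b(i := 0)) k x)"
  using assms
proof (induction k)
  case (Suc k)
  show ?case
  proof (cases "i = k")
    case True
    have "Dseq l b k x = Dseq l (b(k := 0)) k x" by (rule Dseq_cong) simp
    then show ?thesis using True by (simp add: fun_upd_same del: fun_upd_apply)
  next
    case False
    then show ?thesis using Suc funpow_raise_commute[of k l i] by simp
  qed
qed simp

lemma Dseq_Suc_index:
  assumes "i < k" "k \<le> l"
  shows "Dseq l (b(i := Suc (b i))) k x = glop i l (Dseq l b k x)"
  using Dseq_extract[OF assms, of "b(i := Suc (b i))" x] Dseq_extract[OF assms, of b x] by simp

lemma Dseq_0 [simp]: "Dseq l b k 0 = 0"
  by (induction k) auto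

lemma funpow_glop_add: "(glop a b ^^ k) (x + y) = (glop a b ^^ k) x + (glop a b ^^ k) y"
  by (induction k) (auto simp: glop_add)

lemma Dseq_add: "Dseq l b k (x + y) = Dseq l b k x + Dseq l b k y"
  by (induction k) (auto simp: funpow_glop_add)

lemma Dseq_diff: "Dseq l b k (x - y) = Dseq l b k x - Dseq l b k y"
  using Dseq_add[of l b k "x - y" y] by (simp add: eq_diff_eq)

lemma Dseq_sum: "Dseq l b k (\<Sum>i\<in>I. f i) = (\<Sum>i\<in>I. Dseq l b k (f i))"
  by (induction I rule: infinite_finite_induct) (auto simp: Dseq_add)

text \<open>E_(a,l) turns a letter l into a; the other factors do not touch a.\<close>

lemma Dseq_weight:
  assumes "a < l" "k \<le> l" "glop a a x = scl (of_nat r) x"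
  shows "glop a a (Dseq l b k x) = scl (of_nat (r + (if a < k then b a else 0))) (Dseq l b k x)"
  using assms(2)
proof (induction k)
  case (Suc k)
  have "glop a a ((glop k l ^^ j) y) = scl (of_nat (s + (if a = k then j else 0))) ((glop k l ^^ j) y)"
    if "glop a a y = scl (of_nat s) y" for j s y
  proof (induction j)
    case (Suc j)
    have "glop a a ((glop k l ^^ Suc j) y) = glop k l (glop a a ((glop k l ^^ j) y))
        + scl (if a = k then 1 else 0) ((glop k l ^^ Suc j) y)"
      using glop_commutator[of a a k l "(glop k l ^^ j) y"] assms(1) by simp
    also have "\<dots> = scl (of_nat (s + (if a = k then j else 0)) + (if a = k then 1 else 0)) ((glop k l ^^ Suc j) y)"
      unfolding Suc.IH glop_scl ten.scale_left_distrib by simp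
    finally show ?case by simp
  qed (simp add: that)
  from this[OF Suc.IH] show ?case using Suc.prems by (auto simp: less_Suc_eq)
qed (simp add: assms)

lemma ip_funpow_glop:
  assumes "a \<le> l" "b \<le> l"
  shows "ip l N ((glop a b ^^ k) x) y = ip l N x ((glop b a ^^ k) y)"
  by (induction k arbitrary: y) (auto simp: ip_glop assms funpow_swap1[of "glop b a"])

text \<open>[E_(i,i+1), E_(i+1,l)] = E_(i,l), and E_(i,l) commutes with both. Each application of
  E_(i,i+1) thus trades one factor E_(i+1,l) for one E_(i,l), and the coefficient is the old
  exponent, which is not 0. Read from right to left, this writes a monomial as a power of E_(i,i+1)
  applied to another one.\<close>

lemma raise_monomial:
  assumes i: "Suc i < l" and q: "glop i (Suc i) q = 0"
  shows "\<exists>c. c \<noteq> 0 \<and> (glop i (Suc i) ^^ k) ((glop i l ^^ p) ((glop (Suc i) l ^^ (r + k)) q))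
    = scl c ((glop i l ^^ (p + k)) ((glop (Suc i) l ^^ r) q))"
proof -
  let ?E = "glop i (Suc i)" and ?A = "glop i l" and ?B = "glop (Suc i) l"
  have EA: "?E (?A x) = ?A (?E x)" for x
    using glop_commutator[of i "Suc i" i l x] i by simp
  have EB: "?E (?B x) = ?B (?E x) + ?A x" for x
    using glop_commutator[of i "Suc i" "Suc i" l x] i by simp
  have AB: "?B (?A x) = ?A (?B x)" for x
    using i by (intro glop_raise_commute) auto
  have E1: "?E ((?B ^^ Suc r) q) = scl (of_nat (Suc r)) (?A ((?B ^^ r) q))" for r
  proof (induction r)
    case 0
    then show ?case by (simp add: EB q)
  next
    case (Suc r)
    have "?E ((?B ^^ Suc (Suc r)) q) = ?B (?E ((?B ^^ Suc r) q)) + ?A ((?B ^^ Suc r) q)"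
      by (simp add: EB)
    also have "\<dots> = scl (of_nat (Suc r)) (?A ((?B ^^ Suc r) q)) + scl 1 (?A ((?B ^^ Suc r) q))"
      unfolding Suc.IH by (simp add: glop_scl AB)
    finally show ?case by (simp only: ten.scale_left_distrib[symmetric]) (simp add: add.commute)
  qed
  have E2: "?E ((?A ^^ p) ((?B ^^ Suc r) q)) = scl (of_nat (Suc r)) ((?A ^^ Suc p) ((?B ^^ r) q))" for p r
    using E1[of r] by (simp add: glop_funpow_commute[of i "Suc i", OF EA] funpow_glop_scl funpow_swap1 del: of_nat_Suc)
  show ?thesis
  proof (induction k arbitrary: p)
    case 0
    then show ?case by (intro exI[of _ 1]) simp
  next
    case (Suc k)
    obtain c where c: "c \<noteq> 0" "(?E ^^ k) ((?A ^^ Suc p) ((?B ^^ (r + k)) q))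
      = scl c ((?A ^^ (Suc p + k)) ((?B ^^ r) q))" using Suc.IH by blast
    have "(?E ^^ Suc k) ((?A ^^ p) ((?B ^^ (r + Suc k)) q))
       = (?E ^^ k) (scl (of_nat (Suc (r + k))) ((?A ^^ Suc p) ((?B ^^ (r + k)) q)))"
      using E2[of p "r + k"] by (simp add: funpow_swap1 del: of_nat_Suc)
    also have "\<dots> = scl (of_nat (Suc (r + k)) * c) ((?A ^^ (p + Suc k)) ((?B ^^ r) q))"
      using c(2) by (simp add: funpow_glop_scl del: of_nat_Suc funpow.simps)
    finally show ?case using c(1) by (intro exI[of _ "of_nat (Suc (r + k)) * c"]) (simp del: of_nat_Suc)
  qed
qed

text \<open>Letter sums serve as height: a raising unit strictly decreases the largest letter sum in
  the support unless it gives 0. A nonzero element for which this maximum is least is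
  singular.\<close>

lemma singular_exists:
  assumes U: "U \<subseteq> tensors l N" "x \<in> U" "x \<noteq> 0"
    and closed: "\<And>a b x. a < b \<Longrightarrow> b \<le> n \<Longrightarrow> x \<in> U \<Longrightarrow> glop a b x \<in> U"
  obtains s where "s \<in> U" "s \<noteq> 0" "singular n s"
proof -
  define S where "S x = sum_list ` {w. x w \<noteq> (0::complex)}" for x :: tensor
  have fin: "finite (S x)" if "x \<in> U" for x
    unfolding S_def using U(1) that
    by (intro finite_imageI finite_subset[OF _ finite_words[of l N]]) (auto simp: tensors_def)
  have ne: "S x \<noteq> {}" if "x \<noteq> 0" for x
    using that by (auto simp: S_def fun_eq_iff pointwise)
  obtain s where s: "s \<in> U \<and> s \<noteq> 0" "\<And>y. y \<in> U \<and> y \<noteq> 0 \<Longrightarrow> Max (S s) \<le> Max (S y)"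
    using ex_has_least_nat[of "\<lambda>x. x \<in> U \<and> x \<noteq> 0" x "\<lambda>x. Max (S x)"] U by blast
  have "glop a b s = 0" if ab: "a < b" "b \<le> n" for a b
  proof (rule ccontr)
    assume nz: "glop a b s \<noteq> 0"
    let ?y = "glop a b s"
    have yU: "?y \<in> U" using closed ab s by auto
    then have "Max (S ?y) \<in> S ?y" using fin ne nz Max_in by blast
    then obtain w where w: "?y w \<noteq> 0" "sum_list w = Max (S ?y)" by (auto simp: S_def)
    obtain p where p: "p < length w" "w ! p = a" "s (w[p := b]) \<noteq> 0"
      using w(1) by (rule glop_nonzeroE)
    have "sum_list (w[p := b]) = sum_list w + b - a"
      using p by (simp add: sum_list_update)
    then have "sum_list w < sum_list (w[p := b])"
      using ab p by (simp add: elem_le_sum_list)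
    also have "\<dots> \<le> Max (S s)" using fin[of s] s(1) p(3) by (auto simp: S_def)
    finally show False using s(2)[of ?y] yU nz w(2) by auto
  qed
  then show thesis using that[of s] s(1) by (auto simp: singular_def)
qed

section \<open>The module generated by v and the scalars that determine its singular vectors\<close>

locale branching =
  fixes n N :: nat and m :: "nat \<Rightarrow> nat" and v :: tensor
  assumes v: "v \<in> tensors (Suc n) N" "v \<noteq> 0" "singular (Suc n) v"
      "weight_vec (Suc n) (\<lambda>a. \<Sum>i=a..n. m i) v"
    and branch: "(\<And>a. a \<le> n \<Longrightarrow> b a \<le> m a) \<Longrightarrow> \<exists>\<xi>. branch_vec n N m b v \<xi>"
begin

abbreviation "C \<equiv> cyc (Suc n) v"

definition box :: "(nat \<Rightarrow> nat) set" where
  "box = {b. (\<forall>a\<le>n. b a \<le> m a) \<and> (\<forall>a>n. b a = 0)}"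

lemma finite_box: "finite box"
proof (rule finite_subset)
  show "box \<subseteq> {b. \<forall>a. (a \<in> {..n} \<longrightarrow> b a \<in> {..Max (m ` {..n})}) \<and> (a \<notin> {..n} \<longrightarrow> b a = 0)}"
    by (auto simp: box_def) (meson Max_ge finite_imageI finite_atMost imageI atMost_iff le_trans)
  show "finite {b. \<forall>a. (a \<in> {..n} \<longrightarrow> b a \<in> {..Max (m ` {..n})}) \<and> (a \<notin> {..n} \<longrightarrow> b a = (0::nat))}"
    by (intro finite_set_of_finite_funs) auto
qed

lemma C_tensors: "x \<in> C \<Longrightarrow> x \<in> tensors (Suc n) N"
  using cyc_tensors v(1) by blast

lemma C_closed: "x \<in> C \<Longrightarrow> a \<le> Suc n \<Longrightarrow> b \<le> Suc n \<Longrightarrow> glop a b x \<in> C"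
  using cyc_closed v(3,4) by blast

lemma outside_box:
  assumes s: "s \<in> tensors (Suc n) N" "singular n s" and i: "i \<le> n" "m i < b i"
  shows "ip (Suc n) N (Dseq (Suc n) b (Suc n) s) v = 0"
proof (cases "i = n")
  case True
  \<comment> \<open>For i = n the outermost factor of D^b already belongs to a simple root, so its
    adjoint acts directly on \<open>v\<close>.\<close>
  have "(glop (Suc n) n ^^ b n) v = 0"
    using lower_power_eq_0[of n "Suc n" "Suc n" v N "m n" 0 "b n"] v i True
    by (auto simp: singular_def weight_vec_def)
  then show ?thesis by (simp add: ip_funpow_glop)
next
  case False
  then have i': "Suc i < Suc n" using i by simp
  let ?l = "Suc n"
  define q where "q = Dseq ?l (b(i := 0, Suc i := 0)) ?l s"
  have eq: "Dseq ?l b ?l s = (glop i ?l ^^ b i) ((glop (Suc i) ?l ^^ b (Suc i)) q)"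
    using Dseq_extract[of i ?l ?l b s] Dseq_extract[of "Suc i" ?l ?l "b(i := 0)" s] i'
    by (simp add: q_def del: Dseq.simps)
  \<comment> \<open>Among the factors of D^b only E_(i+1,l) fails to commute with E_(i,i+1); with
    that exponent set to 0, E_(i,i+1) reaches \<open>s\<close> and kills it.\<close>
  have "glop i (Suc i) (Dseq ?l c k s) = 0" if "k \<le> ?l" "c (Suc i) = 0" for c k
    using that
  proof (induction k)
    case 0
    then show ?case using s i' by (auto simp: singular_def)
  next
    case (Suc k)
    show ?case
    proof (cases "k = Suc i")
      case False
      then have "glop i (Suc i) (glop k ?l x) = glop k ?l (glop i (Suc i) x)" for x
        using glop_commutator[of i "Suc i" k ?l x] i' by simp
      then show ?thesis using Suc by (simp add: glop_funpow_commute)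
    qed (use Suc in simp)
  qed
  then have q0: "glop i (Suc i) q = 0" by (simp add: q_def del: Dseq.simps)
  \<comment> \<open>The eigenvalue of h_(i+1) on \<open>v\<close> is m_i, so the power m_i + 1 of
    E_(i+1,i) kills \<open>v\<close>; by assumption b_i is large enough to give up that many
    factors.\<close>
  define k where "k = Suc (m i)"
  have bk: "b i - k + k = b i" using i by (simp add: k_def)
  obtain c where c: "c \<noteq> 0" "(glop i (Suc i) ^^ k) ((glop i ?l ^^ (b i - k)) ((glop (Suc i) ?l ^^ (b (Suc i) + k)) q))
    = scl c (Dseq ?l b ?l s)"
    using raise_monomial[OF i' q0, of k "b i - k" "b (Suc i)"] unfolding bk eq by blast
  have "(\<Sum>j=i..n. m j) = m i + (\<Sum>j=Suc i..n. m j)" using i by (simp add: sum.atLeast_Suc_atMost)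
  then have less_k: "(\<Sum>j=i..n. m j) < (\<Sum>j=Suc i..n. m j) + k" "(\<Sum>j=Suc i..n. m j) \<le> (\<Sum>j=i..n. m j)"
    by (simp_all add: k_def)
  have "(glop (Suc i) i ^^ k) v = 0"
    using lower_power_eq_0[of i ?l "Suc i" v N "\<Sum>j=i..n. m j" "\<Sum>j=Suc i..n. m j" k] v i'
    by (auto simp: singular_def weight_vec_def less_k)
  then have "ip ?l N (scl c (Dseq ?l b ?l s)) v = 0"
    unfolding c(2)[symmetric] using i' by (simp add: ip_funpow_glop)
  then show ?thesis using c(1) by (simp add: ip_scl_left)
qed

text \<open>\<open>R\<close> lies in the span of all D^b s and is orthogonal to \<open>v\<close>.
  Being stable under the adjoints of the lowering units that generate \<open>C\<close> from
  \<open>v\<close>, it is orthogonal to \<open>C\<close>. As \<open>s\<close> lies in both, it is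
  orthogonal to itself.\<close>

lemma singular_vanishes:
  assumes s: "s \<in> C" "singular n s"
    and box: "\<And>b. b \<in> box \<Longrightarrow> ip (Suc n) N (Dseq (Suc n) b (Suc n) s) v = 0"
  shows "s = 0"
proof -
  let ?l = "Suc n"
  define R where "R = gen {(a, c). a \<le> n \<and> c = ?l} s"
  have all: "ip ?l N (Dseq ?l b ?l s) v = 0" for b
  proof (cases "\<exists>i\<le>n. m i < b i")
    case True
    then show ?thesis using outside_box C_tensors s by blast
  next
    case False
    then have "(\<lambda>a. if a \<le> n then b a else 0) \<in> box" by (auto simp: box_def not_less)
    from box[OF this] show ?thesis
      using Dseq_cong[of ?l b "\<lambda>a. if a \<le> n then b a else 0" ?l s] by (simp del: Dseq.simps)
  qed
  have "z \<in> ten.span (range (\<lambda>b. Dseq ?l b ?l s))" if "z \<in> R" for z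
    using that unfolding R_def
  proof (rule gen_minimal)
    have "Dseq ?l (\<lambda>_. 0) k s = s" for k by (induction k) auto
    then show "s \<in> ten.span (range (\<lambda>b. Dseq ?l b ?l s))"
      by (metis rangeI ten.span_base)
    fix a c z assume ac: "(a, c) \<in> {(a, c). a \<le> n \<and> c = ?l}"
      and "z \<in> ten.span (range (\<lambda>b. Dseq ?l b ?l s))"
    from this(2) show "glop a c z \<in> ten.span (range (\<lambda>b. Dseq ?l b ?l s))"
    proof (induction rule: ten.span_induct_alt)
      case (step k x y)
      then obtain b where "x = Dseq ?l b ?l s" by auto
      then have "glop a c x = Dseq ?l (b(a := Suc (b a))) ?l s"
        using ac Dseq_Suc_index[of a ?l ?l b s] by auto
      then have "glop a c x \<in> ten.span (range (\<lambda>b. Dseq ?l b ?l s))"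
        by (simp add: ten.span_base del: Dseq.simps)
      then show ?case using step by (simp add: glop_add glop_scl ten.span_add ten.span_scale)
    qed (simp add: ten.span_zero)
  qed simp
  moreover have "ip ?l N z v = 0" if "z \<in> ten.span (range (\<lambda>b. Dseq ?l b ?l s))" for z
    using that by (induction rule: ten.span_induct_alt)
      (auto simp: ip_add_left ip_scl_left all simp del: Dseq.simps)
  ultimately have Rv: "ip ?l N z v = 0" if "z \<in> R" for z using that by blast
  \<comment> \<open>The commutator of E_(a,c) with a generator E_(d,l) is E_(a,l) or 0, so it stays
    among the generators.\<close>
  have up: "glop a c z \<in> R" if "z \<in> R" "a < c" "c \<le> n" for z a c
    using that(1) unfolding R_def
  proof induction
    case (glop z d e)
    then have de: "d \<le> n" "e = ?l" by auto
    have "glop d ?l (glop a c z) \<in> gen {(a, c). a \<le> n \<and> c = ?l} s"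
         "glop a ?l z \<in> gen {(a, c). a \<le> n \<and> c = ?l} s"
      using glop that de by (auto intro!: gen.glop simp del: split_paired_All)
    then show ?case
      using glop_commutator[of a c d ?l z] that(2,3) de by (auto intro: gen.add)
  qed (use s(2) that in \<open>auto simp: singular_def glop_add glop_scl gen_0 intro: gen.intros\<close>)
  have up': "glop a c z \<in> R" if "z \<in> R" "(c, a) \<in> lowering ?l" for z a c
  proof (cases "c \<le> n")
    case False
    then show ?thesis using that unfolding R_def by (auto simp: lowering_def intro: gen.glop)
  qed (use that up in \<open>auto simp: lowering_def\<close>)
  have "s \<in> R" by (simp add: R_def gen.base)
  have "ip ?l N s s = 0"
    by (rule gen_orthogonal[OF s(1), where Z = R])
      (use Rv up' \<open>s \<in> R\<close> in \<open>auto simp: lowering_def\<close>)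
  then show ?thesis using ip_self_eq_0 C_tensors s by blast
qed

end

lemma orthogonal_sum_eq_0:
  assumes I: "finite I" and f: "\<And>i. i \<in> I \<Longrightarrow> f i \<in> tensors l N"
    and orth: "\<And>i j. i \<in> I \<Longrightarrow> j \<in> I \<Longrightarrow> i \<noteq> j \<Longrightarrow> ip l N (f i) (f j) = 0"
    and 0: "(\<Sum>i\<in>I. f i) = 0" and i: "i \<in> I"
  shows "f i = 0"
proof -
  have "0 = ip l N (\<Sum>j\<in>I. f j) (f i)" by (simp add: 0)
  also have "\<dots> = (\<Sum>j\<in>I. if j = i then ip l N (f i) (f i) else 0)"
    unfolding ip_sum_left by (intro sum.cong) (auto simp: orth i)
  also have "\<dots> = ip l N (f i) (f i)" using I i by simp
  finally show ?thesis using ip_self_eq_0 f i by metis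
qed

section \<open>Highest weight vectors of the components\<close>

context branching
begin

text \<open>\<open>C\<close> and its orthogonal complement are stable, so projection to
  \<open>C\<close> commutes with every E_ab and transfers all equations from \<xi> to
  \<open>x\<close>. As \<open>v\<close> is its own projection, D^b x is still a nonzero multiple of
  \<open>v\<close>, whence \<open>x\<close> is not 0.\<close>

lemma projected_branch_vec:
  assumes "b \<in> box"
  obtains x c where "x \<in> C" "singular n x" "x \<noteq> 0"
    "weight_vec (Suc n) (\<lambda>a. if a \<le> n then (\<Sum>i=a..n. m i) - b a else \<Sum>i\<le>n. b i) x"
    "c \<noteq> 0" "Dseq (Suc n) b (Suc n) x = scl c v"
proof -
  let ?l = "Suc n"
  have CT: "C \<subseteq> tensors ?l N" using C_tensors by blast
  obtain \<xi> where \<xi>: "branch_vec n N m b v \<xi>" using branch[of b] assms unfolding box_def by blast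
  then obtain c where c: "c \<noteq> 0" "Dseq ?l b ?l \<xi> = scl c v" by (auto simp: branch_vec_def)
  obtain x where x: "x \<in> C" "\<And>u. u \<in> C \<Longrightarrow> ip ?l N (\<xi> - x) u = 0"
    using orthogonal_projection[OF subspace_gen CT] by blast
  \<comment> \<open>The graph of the projection. Uniqueness of the image is proved where it is used,
    so no linear map has to be constructed.\<close>
  define K where "K = {(y, y'). y' \<in> C \<and> (\<forall>u\<in>C. ip ?l N (y - y') u = 0)}"
  have K_glop: "(glop a c y, glop a c y') \<in> K" if "(y, y') \<in> K" "a \<le> ?l" "c \<le> ?l" for a c y y'
    using that C_closed by (auto simp: K_def glop_diff[symmetric] ip_glop)
  have K_unique: "y' = z" if "(y, y') \<in> K" "y = z" "z \<in> C" for y y' z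
  proof -
    have "ip ?l N (y - y') (y - y') = 0" "y - y' \<in> C"
      using that gen_diff by (auto simp: K_def)
    then show ?thesis using ip_self_eq_0 C_tensors that(2) by fastforce
  qed
  have K_scl: "y' = z" if "(scl k y, y') \<in> K" "(y, z') \<in> K" "z = scl k z'" for k y y' z z'
  proof -
    have z: "z \<in> C" "\<And>u. u \<in> C \<Longrightarrow> ip ?l N (scl k y - z) u = 0"
      using that by (auto simp: K_def gen.scl ten.scale_right_diff_distrib[symmetric] ip_scl_left)
    have "ip ?l N (y' - z) u = ip ?l N (scl k y - z) u - ip ?l N (scl k y - y') u" for u
      by (simp add: ip_diff_left)
    then have "ip ?l N (y' - z) u = 0" if "u \<in> C" for u
      using z(2)[OF that] \<open>(scl k y, y') \<in> K\<close> that by (simp add: K_def)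
    moreover have "y' - z \<in> C" using z(1) that(1) by (auto simp: K_def gen_diff)
    ultimately show ?thesis using ip_self_eq_0[of "y' - z"] C_tensors by auto
  qed
  have xK: "(\<xi>, x) \<in> K" using x by (auto simp: K_def)
  have sing: "singular n x"
    unfolding singular_def
  proof (intro allI impI)
    fix a b' assume "b' \<le> n" "a < b'"
    then have "(scl 0 \<xi>, glop a b' x) \<in> K" using K_glop[OF xK, of a b'] \<xi>
      by (auto simp: branch_vec_def singular_def)
    from K_scl[OF this xK refl] show "glop a b' x = 0" by simp
  qed
  have wt: "weight_vec ?l (\<lambda>a. if a \<le> n then (\<Sum>i=a..n. m i) - b a else \<Sum>i\<le>n. b i) x"
    unfolding weight_vec_def
  proof (intro allI impI)
    fix a assume "a \<le> ?l"
    then have "(scl (of_nat (if a \<le> n then (\<Sum>i=a..n. m i) - b a else \<Sum>i\<le>n. b i)) \<xi>, glop a a x) \<in> K"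
      using K_glop[OF xK, of a a] \<xi> unfolding branch_vec_def weight_vec_def by metis
    then show "glop a a x = scl (of_nat (if a \<le> n then (\<Sum>i=a..n. m i) - b a else \<Sum>i\<le>n. b i)) x"
      using K_scl[OF _ xK] by blast
  qed
  have "((glop k ?l ^^ j) y, (glop k ?l ^^ j) y') \<in> K" if "(y, y') \<in> K" "k \<le> ?l" for k j y y'
    by (induction j) (auto intro: that K_glop)
  then have "(Dseq ?l b k \<xi>, Dseq ?l b k x) \<in> K" if "k \<le> ?l" for k
    using that by (induction k) (auto simp: xK)
  then have "Dseq ?l b ?l x = scl c v"
    using K_unique c(2) gen.scl[OF gen.base] by blast
  moreover have "x \<noteq> 0" using calculation c(1) v(2) ten.scale_eq_0_iff Dseq_0 by metis
  ultimately show thesis using that x(1) sing wt c(1) by blast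
qed

text \<open>The choice is meaningful for \<open>b \<in> box\<close> only.\<close>

definition hwv :: "(nat \<Rightarrow> nat) \<Rightarrow> tensor" where
  "hwv b = (SOME x. x \<in> C \<and> singular n x \<and> x \<noteq> 0 \<and>
    weight_vec (Suc n) (\<lambda>a. if a \<le> n then (\<Sum>i=a..n. m i) - b a else \<Sum>i\<le>n. b i) x \<and>
    (\<exists>c. c \<noteq> 0 \<and> Dseq (Suc n) b (Suc n) x = scl c v))"

lemma hwv:
  assumes "b \<in> box"
  shows hwv_C: "hwv b \<in> C" and hwv_singular: "singular n (hwv b)" and hwv_nonzero: "hwv b \<noteq> 0"
    and hwv_weight: "weight_vec (Suc n) (\<lambda>a. if a \<le> n then (\<Sum>i=a..n. m i) - b a else \<Sum>i\<le>n. b i) (hwv b)"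
    and hwv_Dseq: "\<exists>c. c \<noteq> 0 \<and> Dseq (Suc n) b (Suc n) (hwv b) = scl c v"
proof -
  obtain x c where "x \<in> C" "singular n x" "x \<noteq> 0"
    "weight_vec (Suc n) (\<lambda>a. if a \<le> n then (\<Sum>i=a..n. m i) - b a else \<Sum>i\<le>n. b i) x"
    "c \<noteq> 0" "Dseq (Suc n) b (Suc n) x = scl c v"
    by (rule projected_branch_vec[OF assms])
  then have "\<exists>x. x \<in> C \<and> singular n x \<and> x \<noteq> 0 \<and>
    weight_vec (Suc n) (\<lambda>a. if a \<le> n then (\<Sum>i=a..n. m i) - b a else \<Sum>i\<le>n. b i) x \<and>
    (\<exists>c. c \<noteq> 0 \<and> Dseq (Suc n) b (Suc n) x = scl c v)" by blast
  from someI_ex[OF this, folded hwv_def]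
  show "hwv b \<in> C" "singular n (hwv b)" "hwv b \<noteq> 0"
    "weight_vec (Suc n) (\<lambda>a. if a \<le> n then (\<Sum>i=a..n. m i) - b a else \<Sum>i\<le>n. b i) (hwv b)"
    "\<exists>c. c \<noteq> 0 \<and> Dseq (Suc n) b (Suc n) (hwv b) = scl c v" by blast+
qed

lemma weights_orthogonal:
  assumes "glop a a x = scl (of_nat r) x" "glop a a y = scl (of_nat s) y" "r \<noteq> s" "a \<le> Suc n"
  shows "ip (Suc n) N x y = 0"
proof -
  have "of_nat r * ip (Suc n) N x y = of_nat s * ip (Suc n) N x y"
    using ip_glop[OF assms(4,4), of N x y] by (simp add: assms ip_scl_left ip_scl_right)
  then show ?thesis using assms(3) by simp
qed

lemma le_sum_m: "a \<le> n \<Longrightarrow> m a \<le> (\<Sum>i=a..n. m i)"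
  by (rule member_le_sum) auto

lemma box_eqI:
  assumes "b \<in> box" "b' \<in> box" "\<And>a. a \<le> n \<Longrightarrow> b a = b' a"
  shows "b = b'"
proof
  fix a show "b a = b' a" using assms by (cases "a \<le> n") (auto simp: box_def)
qed

lemma box_neqE:
  assumes "b \<in> box" "b' \<in> box" "b \<noteq> b'"
  obtains a where "a \<le> n" "b a \<noteq> b' a"
  using assms box_eqI by blast

lemma hwv_weight': "b \<in> box \<Longrightarrow> a \<le> n \<Longrightarrow> glop a a (hwv b) = scl (of_nat ((\<Sum>i=a..n. m i) - b a)) (hwv b)"
  using hwv_weight[of b] by (simp add: weight_vec_def)

lemma box_le: "b \<in> box \<Longrightarrow> a \<le> n \<Longrightarrow> b a \<le> (\<Sum>i=a..n. m i)"
  using le_sum_m[of a] by (auto simp: box_def intro: le_trans)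

text \<open>D^b' raises the count of a by b'_a, while \<open>hwv b\<close> lies b_a below
  \<open>v\<close>. Unless b = b' the weight differs from that of \<open>v\<close>, and vectors of
  different weight are orthogonal.\<close>

lemma ip_Dseq_X:
  assumes "b \<in> box" "b' \<in> box"
  shows "ip (Suc n) N (Dseq (Suc n) b' (Suc n) (hwv b)) v = 0 \<longleftrightarrow> b \<noteq> b'"
proof (cases "b = b'")
  case True
  then obtain c where "c \<noteq> 0" "Dseq (Suc n) b' (Suc n) (hwv b) = scl c v" using hwv_Dseq assms by blast
  then show ?thesis using True v(1,2) ip_self_eq_0 by (auto simp: ip_scl_left simp del: Dseq.simps)
next
  case False
  then obtain a where a: "a \<le> n" "b a \<noteq> b' a" using box_neqE assms by blast
  have "glop a a (Dseq (Suc n) b' (Suc n) (hwv b))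
      = scl (of_nat ((\<Sum>i=a..n. m i) - b a + b' a)) (Dseq (Suc n) b' (Suc n) (hwv b))"
    using Dseq_weight[OF _ _ hwv_weight'[OF assms(1) a(1)], of "Suc n" "Suc n" b'] a by simp
  moreover have "glop a a v = scl (of_nat (\<Sum>i=a..n. m i)) v" using v(4) a by (simp add: weight_vec_def)
  moreover have "(\<Sum>i=a..n. m i) - b a + b' a \<noteq> (\<Sum>i=a..n. m i)"
    using box_le[OF assms(1) a(1)] a(2) by linarith
  ultimately have "ip (Suc n) N (Dseq (Suc n) b' (Suc n) (hwv b)) v = 0"
    using a(1) by (intro weights_orthogonal) auto
  then show ?thesis using False by simp
qed

text \<open>By \<open>ip_Dseq_X\<close> the scalars of the overview and the vectors
  \<open>hwv b\<close> are dual up to nonzero factors. The coefficients are chosen so that all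
  scalars of the difference vanish.\<close>

lemma singular_in_span:
  assumes s: "s \<in> C" "singular n s"
  obtains c where "s = (\<Sum>b\<in>box. scl (c b) (hwv b))"
proof -
  let ?l = "Suc n"
  define c where "c b = ip ?l N (Dseq ?l b ?l s) v / ip ?l N (Dseq ?l b ?l (hwv b)) v" for b
  define d where "d = s - (\<Sum>b\<in>box. scl (c b) (hwv b))"
  have "(\<Sum>b\<in>box. scl (c b) (hwv b)) \<in> C"
    by (rule ten.subspace_sum[OF subspace_gen]) (auto intro: gen.scl hwv_C)
  then have "d \<in> C" unfolding d_def using s by (intro gen_diff)
  moreover have "glop a b' (\<Sum>b\<in>box. scl (c b) (hwv b)) = 0" if "a < b'" "b' \<le> n" for a b'
    unfolding glop_sum using hwv_singular that by (intro sum.neutral) (auto simp: glop_scl singular_def)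
  then have "singular n d" unfolding d_def using s by (intro singular_diff) (auto simp: singular_def)
  moreover have "ip ?l N (Dseq ?l b ?l d) v = 0" if b: "b \<in> box" for b
  proof -
    have "ip ?l N (Dseq ?l b ?l (\<Sum>b\<in>box. scl (c b) (hwv b))) v
      = (\<Sum>b'\<in>box. c b' * ip ?l N (Dseq ?l b ?l (hwv b')) v)"
      by (simp only: Dseq_sum Dseq_scl ip_sum_left ip_scl_left)
    also have "\<dots> = (\<Sum>b'\<in>box. if b' = b then c b * ip ?l N (Dseq ?l b ?l (hwv b)) v else 0)"
      using ip_Dseq_X b by (intro sum.cong) (auto simp del: Dseq.simps)
    also have "\<dots> = ip ?l N (Dseq ?l b ?l s) v"
      using finite_box b ip_Dseq_X[OF b b] by (simp add: c_def del: Dseq.simps)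
    finally show ?thesis by (simp only: d_def Dseq_diff ip_diff_left) simp
  qed
  ultimately have "d = 0" by (rule singular_vanishes)
  then show thesis using that[of c] by (simp add: d_def)
qed

section \<open>Orthogonal decomposition of C under the smaller algebra\<close>

lemma hwv_cyc_subset: "b \<in> box \<Longrightarrow> x \<in> cyc n (hwv b) \<Longrightarrow> x \<in> C"
proof (erule gen_minimal)
  fix a c y assume ac: "(a, c) \<in> lowering n" and "y \<in> C"
  have "a \<le> Suc n" "c \<le> Suc n" using ac by (auto simp: lowering_def)
  then show "glop a c y \<in> C" using \<open>y \<in> C\<close> by (intro C_closed)
qed (auto intro: subspace_gen hwv_C)

lemma hwv_cyc_closed:
  assumes b: "b \<in> box" and x: "x \<in> cyc n (hwv b)" and ac: "a \<le> n" "c \<le> n"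
  shows "glop a c x \<in> cyc n (hwv b)"
  using cyc_closed[OF x hwv_singular[OF b] _ ac, of "\<lambda>a. (\<Sum>i=a..n. m i) - b a"] hwv_weight'[OF b]
  by (auto simp: weight_vec_def)

text \<open>The smaller algebra leaves the letter l = n + 1 alone, so its count is constant on a
  component.\<close>

lemma hwv_cyc_degree:
  assumes b: "b \<in> box" and x: "x \<in> cyc n (hwv b)"
  shows "glop (Suc n) (Suc n) x = scl (of_nat (\<Sum>i\<le>n. b i)) x"
  using x
proof induction
  case base
  then show ?case using hwv_weight[OF b] by (simp add: weight_vec_def)
next
  case (glop x a c)
  then show ?case using glop_commutator[of "Suc n" "Suc n" a c x]
    by (auto simp: lowering_def glop_scl)
qed (auto simp: glop_add glop_scl ten.scale_right_distrib mult.commute)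

text \<open>The two generators have different weights, hence are orthogonal. Singularity extends
  this first to one whole module and stability then to the other.\<close>

lemma hwv_cyc_orthogonal:
  assumes b: "b \<in> box" "b' \<in> box" "b \<noteq> b'" and x: "x \<in> cyc n (hwv b)" and y: "y \<in> cyc n (hwv b')"
  shows "ip (Suc n) N x y = 0"
proof -
  obtain a where a: "a \<le> n" "b a \<noteq> b' a" using box_neqE b by blast
  have "ip (Suc n) N (hwv b) (hwv b') = 0"
    using a box_le[of b a] box_le[of b' a] b
    by (intro weights_orthogonal[of a _ "(\<Sum>i=a..n. m i) - b a" _ "(\<Sum>i=a..n. m i) - b' a"]) (auto simp: hwv_weight')
  then have "ip (Suc n) N (hwv b) z = 0" if "z \<in> cyc n (hwv b')" for z
    using singular_orthogonal[OF that, of "Suc n" "hwv b"] hwv_singular b by auto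
  then have *: "ip (Suc n) N z (hwv b) = 0" if "z \<in> cyc n (hwv b')" for z
    using that ip_eq_0_commute by blast
  have "ip (Suc n) N y x = 0"
    by (rule gen_orthogonal[OF x, where Z = "cyc n (hwv b')"])
      (use * hwv_cyc_closed[OF b(2)] y in \<open>auto simp: lowering_def\<close>)
  then show ?thesis by (rule ip_eq_0_commute)
qed

text \<open>The orthogonal complement of the sum \<open>V\<close> in \<open>C\<close> is stable
  under the smaller algebra. If it were nonzero, it would contain a nonzero singular vector, and by
  \<open>singular_in_span\<close> that vector lies in \<open>V\<close>.\<close>

lemma decomposition:
  assumes x: "x \<in> C"
  obtains f where "\<And>b. b \<in> box \<Longrightarrow> f b \<in> cyc n (hwv b)" "x = (\<Sum>b\<in>box. f b)"
proof -
  let ?l = "Suc n"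
  define V where "V = {\<Sum>b\<in>box. f b | f. \<forall>b\<in>box. f b \<in> cyc n (hwv b)}"
  have VI: "(\<Sum>b\<in>box. f b) \<in> V" if "\<And>b. b \<in> box \<Longrightarrow> f b \<in> cyc n (hwv b)" for f
    using that by (auto simp: V_def)
  have sub: "ten.subspace V"
    unfolding ten.subspace_def
  proof (intro conjI ballI allI)
    show "0 \<in> V" using VI[of "\<lambda>_. 0"] by (simp add: gen_0)
    fix x y assume "x \<in> V" "y \<in> V"
    then obtain f g where "x = (\<Sum>b\<in>box. f b)" "y = (\<Sum>b\<in>box. g b)"
      "\<forall>b\<in>box. f b \<in> cyc n (hwv b) \<and> g b \<in> cyc n (hwv b)" by (auto simp: V_def)
    then show "x + y \<in> V" using VI[of "\<lambda>b. f b + g b"] by (auto simp: sum.distrib gen.add)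
  next
    fix c x assume "x \<in> V"
    then obtain f where "x = (\<Sum>b\<in>box. f b)" "\<forall>b\<in>box. f b \<in> cyc n (hwv b)" by (auto simp: V_def)
    then show "scl c x \<in> V" using VI[of "\<lambda>b. scl c (f b)"] by (auto simp: ten.scale_sum_right gen.scl)
  qed
  have closed: "glop a c y \<in> V" if "y \<in> V" "a \<le> n" "c \<le> n" for a c y
  proof -
    obtain f where "y = (\<Sum>b\<in>box. f b)" "\<forall>b\<in>box. f b \<in> cyc n (hwv b)" using \<open>y \<in> V\<close> by (auto simp: V_def)
    then show ?thesis using VI[of "\<lambda>b. glop a c (f b)"] that by (auto simp: glop_sum hwv_cyc_closed)
  qed
  have VC: "V \<subseteq> C" using hwv_cyc_subset by (auto simp: V_def intro!: ten.subspace_sum[OF subspace_gen])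
  have VT: "V \<subseteq> tensors ?l N" using VC C_tensors by blast
  have XV: "hwv b \<in> V" if "b \<in> box" for b
  proof -
    have "(\<Sum>b'\<in>box. if b' = b then hwv b else 0) \<in> V" by (rule VI) (auto simp: gen_0 gen.base)
    then show ?thesis using finite_box that by simp
  qed
  define U where "U = {z \<in> C. \<forall>u\<in>V. ip ?l N z u = 0}"
  obtain y where y: "y \<in> V" "\<And>u. u \<in> V \<Longrightarrow> ip ?l N (x - y) u = 0"
    using orthogonal_projection[OF sub VT] by blast
  have "x - y = 0"
  proof (rule ccontr)
    assume nz: "x - y \<noteq> 0"
    have U: "x - y \<in> U" using y VC x by (auto simp: U_def intro: gen_diff)
    obtain s where s: "s \<in> U" "s \<noteq> 0" "singular n s"
    proof (rule singular_exists[OF _ U nz, of ?l N n])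
      show "U \<subseteq> tensors ?l N" using C_tensors by (auto simp: U_def)
      show "glop a b z \<in> U" if "a < b" "b \<le> n" "z \<in> U" for a b z
        using that C_closed closed by (auto simp: U_def ip_glop)
    qed blast
    obtain c where "s = (\<Sum>b\<in>box. scl (c b) (hwv b))" using singular_in_span s by (auto simp: U_def)
    then have "s \<in> V" using XV sub by (auto intro!: ten.subspace_sum ten.subspace_scale)
    then have "ip ?l N s s = 0" using s(1) by (auto simp: U_def)
    then show False using s ip_self_eq_0 C_tensors by (auto simp: U_def)
  qed
  then have "x \<in> V" using y(1) by simp
  then show thesis using that by (auto simp: V_def)
qed

end

section \<open>Dimensions of weight spaces\<close>

text \<open>A common element of two of the bases would be orthogonal to itself, and a linear
  relation splits into one relation for each summand; so the union of bases is a basis.\<close>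

lemma dim_orthogonal_sum:
  assumes I: "finite I" and A: "\<And>i. i \<in> I \<Longrightarrow> ten.subspace (A i)" "\<And>i. i \<in> I \<Longrightarrow> A i \<subseteq> tensors l N"
    and orth: "\<And>i j x y. i \<in> I \<Longrightarrow> j \<in> I \<Longrightarrow> i \<noteq> j \<Longrightarrow> x \<in> A i \<Longrightarrow> y \<in> A j \<Longrightarrow> ip l N x y = 0"
  shows "ten.dim {\<Sum>i\<in>I. f i | f. \<forall>i\<in>I. f i \<in> A i} = (\<Sum>i\<in>I. ten.dim (A i))"
proof -
  let ?S = "{\<Sum>i\<in>I. f i | f. \<forall>i\<in>I. f i \<in> A i}"
  have "\<exists>B. B \<subseteq> A i \<and> ten.independent B \<and> A i \<subseteq> ten.span B \<and> card B = ten.dim (A i)" if "i \<in> I" for i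
    using ten.basis_exists[of "A i"] by metis
  then obtain B where B: "\<And>i. i \<in> I \<Longrightarrow> B i \<subseteq> A i" "\<And>i. i \<in> I \<Longrightarrow> ten.independent (B i)"
    "\<And>i. i \<in> I \<Longrightarrow> A i \<subseteq> ten.span (B i)" "\<And>i. i \<in> I \<Longrightarrow> card (B i) = ten.dim (A i)" by metis
  obtain T where T: "finite T" "tensors l N \<subseteq> ten.span T" using finite_dim_tensors by blast
  have fin: "finite (B i)" if "i \<in> I" for i
    using ten.independent_span_bound[OF T(1) B(2)[OF that]] B(1)[OF that] A(2)[OF that] T(2) by blast
  have disj: "B i \<inter> B j = {}" if "i \<in> I" "j \<in> I" "i \<noteq> j" for i j
  proof (rule ccontr)
    assume "B i \<inter> B j \<noteq> {}"
    then obtain x where x: "x \<in> B i" "x \<in> B j" by blast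
    then have "x = 0" using orth[OF that] B(1) A(2) ip_self_eq_0 that by blast
    then show False using x B(2)[OF that(1)] ten.dependent_zero by blast
  qed
  let ?B = "\<Union>i\<in>I. B i"
  have finB: "finite ?B" using I fin by blast
  have "ten.independent ?B"
  proof
    assume "ten.dependent ?B"
    then obtain u x where u: "x \<in> ?B" "u x \<noteq> 0" "(\<Sum>x\<in>?B. scl (u x) x) = 0"
      using ten.dependent_finite[OF finB] by auto
    then obtain i where i: "i \<in> I" "x \<in> B i" by blast
    let ?f = "\<lambda>i. \<Sum>x\<in>B i. scl (u x) x"
    have fA: "?f i \<in> A i" if "i \<in> I" for i
      using B(1)[OF that] by (intro ten.subspace_sum[OF A(1)[OF that]] ten.subspace_scale[OF A(1)[OF that]]) auto
    have "(\<Sum>i\<in>I. ?f i) = 0"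
      using u(3) I fin disj by (subst (asm) sum.UNION_disjoint) auto
    from orthogonal_sum_eq_0[OF I _ _ this i(1), of l N] have "?f i = 0"
      using fA A(2) orth by blast
    then have "ten.dependent (B i)" using ten.dependent_finite[OF fin[OF i(1)]] i(2) u(2) by blast
    then show False using B(2) i(1) by blast
  qed
  moreover have "?B \<subseteq> ?S"
  proof
    fix x assume "x \<in> ?B"
    then obtain i where i: "i \<in> I" "x \<in> A i" using B(1) by blast
    then have "x = (\<Sum>j\<in>I. if j = i then x else 0)" using I by simp
    moreover have "\<forall>j\<in>I. (if j = i then x else 0) \<in> A j" using i A(1) ten.subspace_0 by auto
    ultimately show "x \<in> ?S" by blast
  qed
  moreover have "?S \<subseteq> ten.span ?B"
  proof clarify
    fix f assume "\<forall>i\<in>I. f i \<in> A i"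
    then have "f i \<in> ten.span ?B" if "i \<in> I" for i
      using B(3)[OF that] ten.span_mono[of "B i" ?B] that by blast
    then show "(\<Sum>i\<in>I. f i) \<in> ten.span ?B" by (rule ten.span_sum)
  qed
  ultimately have "card ?B = ten.dim ?S" by (intro ten.basis_card_eq_dim)
  moreover have "card ?B = (\<Sum>i\<in>I. card (B i))" using I fin disj by (intro card_UN_disjoint) auto
  ultimately show ?thesis using B(4) by simp
qed

text \<open>The counterpart of \<open>weight_space\<close> for tensors, where h_i acts as
  E_(i-1,i-1) - E_(i,i).\<close>

definition hwt :: "nat \<Rightarrow> (nat \<Rightarrow> int) \<Rightarrow> tensor set \<Rightarrow> tensor set" where
  "hwt n \<mu> U = {x \<in> U. \<forall>i\<in>{1..n}. glop (i - 1) (i - 1) x - glop i i x = scl (of_int (\<mu> i)) x}"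

lemma subspace_hwt:
  assumes "ten.subspace U"
  shows "ten.subspace (hwt n \<mu> U)"
  unfolding ten.subspace_def
proof (intro conjI ballI allI)
  show "0 \<in> hwt n \<mu> U" using assms ten.subspace_0 by (auto simp: hwt_def)
  fix x y assume "x \<in> hwt n \<mu> U" "y \<in> hwt n \<mu> U"
  moreover have "glop a a (x + y) - glop c c (x + y) = (glop a a x - glop c c x) + (glop a a y - glop c c y)" for a c
    by (simp add: glop_add)
  ultimately show "x + y \<in> hwt n \<mu> U"
    using assms ten.subspace_add by (simp add: hwt_def ten.scale_right_distrib)
next
  fix c x assume "x \<in> hwt n \<mu> U"
  moreover have "glop a a (scl c x) - glop b b (scl c x) = scl c (glop a a x - glop b b x)" for a b
    by (simp add: glop_scl ten.scale_right_diff_distrib)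
  ultimately show "scl c x \<in> hwt n \<mu> U"
    using assms ten.subspace_scale by (simp add: hwt_def mult.commute)
qed

section \<open>Letter counts and the dominance order\<close>

lemma sum_count_words: "w \<in> words l N \<Longrightarrow> (\<Sum>c\<le>l. count_list w c) = N"
  by (auto simp: words_def intro!: sum_count_set)

lemma count_list_update:
  "p < length w \<Longrightarrow> count_list (w[p := b]) c + (if w ! p = c then 1 else 0)
     = count_list w c + (if b = c then 1 else 0)"
proof (induction w arbitrary: p)
  case (Cons x w)
  show ?case
  proof (cases p)
    case (Suc q)
    then show ?thesis using Cons.IH[of q] Cons.prems by auto
  qed simp
qed simp

lemma glop_diag_eq_iff:
  "glop a a x = scl (of_nat k) x \<longleftrightarrow> (\<forall>w. x w \<noteq> 0 \<longrightarrow> count_list w a = k)"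
  by (auto simp: fun_eq_iff pointwise glop_diag)

lemma glop_diag_diff_eq_iff:
  "glop a a x - glop b b x = scl (of_int k) x
    \<longleftrightarrow> (\<forall>w. x w \<noteq> 0 \<longrightarrow> int (count_list w a) - int (count_list w b) = k)"
proof -
  have "of_nat p * y - of_nat q * y = of_int k * y \<longleftrightarrow> (y \<noteq> 0 \<longrightarrow> int p - int q = k)"
    for p q and y :: complex
  proof -
    have "(of_nat p - of_nat q :: complex) = of_int (int p - int q)" by simp
    then show ?thesis
      by (simp only: left_diff_distrib[symmetric] mult_cancel_right of_int_eq_iff) blast
  qed
  then show ?thesis by (simp add: fun_eq_iff pointwise glop_diag)
qed

text \<open>A lowering unit replaces a letter by a larger one and cannot increase the number of
  letters below i.\<close>

lemma cyc_dominated: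
  assumes x: "x \<in> cyc n y" and y: "weight_vec n \<kappa> y" and i: "i \<le> n" and w: "x w \<noteq> 0"
  shows "(\<Sum>c<i. count_list w c) \<le> (\<Sum>c<i. \<kappa> c)"
proof -
  have "x \<in> {x. \<forall>w. x w \<noteq> 0 \<longrightarrow> (\<Sum>c<i. count_list w c) \<le> (\<Sum>c<i. \<kappa> c)}" (is "x \<in> ?U")
    using x
  proof (rule gen_minimal)
    show "ten.subspace ?U"
      by (auto simp: ten.subspace_def pointwise) (metis add_0)
    have "count_list w c = \<kappa> c" if "y w \<noteq> 0" "c < i" for w c
      using y that i glop_diag_eq_iff[of c y "\<kappa> c"] by (auto simp: weight_vec_def)
    then show "y \<in> ?U" by auto
    fix a b x assume ab: "(a, b) \<in> lowering n" and x: "x \<in> ?U"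
    show "glop a b x \<in> ?U"
    proof (intro CollectI allI impI)
      fix w assume "glop a b x w \<noteq> 0"
      then obtain p where p: "p < length w" "w ! p = a" "x (w[p := b]) \<noteq> 0" by (rule glop_nonzeroE)
      have "(\<Sum>c<i. count_list (w[p := b]) c) + (\<Sum>c<i. if a = c then 1 else 0)
         = (\<Sum>c<i. count_list w c) + (\<Sum>c<i. if b = c then 1 else 0)"
        unfolding sum.distrib[symmetric] using count_list_update[OF p(1), of b] p(2) by simp
      moreover have "(\<Sum>c<i. if a = c then 1 else 0) \<le> (\<Sum>c<i. if b = c then 1 else (0::nat))"
        using ab by (auto simp: lowering_def)
      ultimately have "(\<Sum>c<i. count_list w c) \<le> (\<Sum>c<i. count_list (w[p := b]) c)" by linarith
      also have "\<dots> \<le> (\<Sum>c<i. \<kappa> c)" using x p(3) by blast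
      finally show "(\<Sum>c<i. count_list w c) \<le> (\<Sum>c<i. \<kappa> c)" .
    qed
  qed
  then show ?thesis using w by blast
qed

section \<open>Simple root coefficients and the index set\<close>

lemma root_comb_nth:
  assumes "i \<in> {1..l}"
  shows "root_comb l a i = 2 * int (a i) - (if i = 1 then 0 else int (a (i - 1)))
    - (if i = l then 0 else int (a (i + 1)))"
proof -
  have "root_comb l a i = (\<Sum>j=1..l. (if j = i then 2 * int (a i) else 0)
      - (if j = i - 1 then int (a (i - 1)) else 0) - (if j = i + 1 then int (a (i + 1)) else 0))"
    unfolding root_comb_def using assms by (intro sum.cong) (auto simp: simple_root_def)
  also have "\<dots> = 2 * int (a i) - (if i = 1 then 0 else int (a (i - 1))) - (if i = l then 0 else int (a (i + 1)))"
    unfolding sum_subtractf using assms by (auto simp: sum.delta)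
  finally show ?thesis .
qed

lemma root_comb_outside: "i \<notin> {1..l} \<Longrightarrow> root_comb l a i = 0"
  by (simp add: root_comb_def simple_root_def)

text \<open>The translation from b to P, with inverse \<open>increments\<close>; the cut-offs by 0
  match the conventions of \<open>Pi_prime\<close> and \<open>box\<close>.\<close>

definition partial_sums :: "nat \<Rightarrow> (nat \<Rightarrow> nat) \<Rightarrow> nat \<Rightarrow> nat" where
  "partial_sums n b i = (if i \<le> Suc n then \<Sum>a<i. b a else 0)"

definition increments :: "nat \<Rightarrow> (nat \<Rightarrow> nat) \<Rightarrow> nat \<Rightarrow> nat" where
  "increments n P a = (if a \<le> n then P (Suc a) - P a else 0)"

context branching
begin

text \<open>Any word in the support of \<open>v\<close> shows the weight of \<open>v\<close> as its
  letter counts, with no letter l.\<close>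

lemma N_eq: "N = (\<Sum>c\<le>n. \<Sum>i=c..n. m i)"
proof -
  obtain w where w: "v w \<noteq> 0" using v(2) by (auto simp: fun_eq_iff pointwise)
  then have "w \<in> words (Suc n) N" using v(1) by (auto simp: tensors_def)
  moreover have "count_list w c = (\<Sum>i=c..n. m i)" if "c \<le> Suc n" for c
    using v(4) w that by (auto simp: weight_vec_def glop_diag_eq_iff simp del: of_nat_sum)
  ultimately show ?thesis using sum_count_words[of w "Suc n" N] by simp
qed

text \<open>The defects \<open>g b\<close> of the weight equation lie in mutually orthogonal modules
  and add up to 0, so each one vanishes: components of a weight vector have the same weight.\<close>

lemma dim_weight_decomposition:
  "ten.dim (hwt (Suc n) \<mu> C) = (\<Sum>b\<in>box. ten.dim (hwt (Suc n) \<mu> (cyc n (hwv b))))"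
proof -
  let ?A = "\<lambda>b. hwt (Suc n) \<mu> (cyc n (hwv b))"
  have "hwt (Suc n) \<mu> C = {\<Sum>b\<in>box. f b | f. \<forall>b\<in>box. f b \<in> ?A b}" (is "_ = ?S")
  proof (intro equalityI subsetI)
    fix x assume x: "x \<in> hwt (Suc n) \<mu> C"
    then obtain f where f: "\<And>b. b \<in> box \<Longrightarrow> f b \<in> cyc n (hwv b)" "x = (\<Sum>b\<in>box. f b)"
      using decomposition by (auto simp: hwt_def)
    have "f b \<in> ?A b" if b: "b \<in> box" for b
    proof -
      have "glop (i - 1) (i - 1) (f b) - glop i i (f b) = scl (of_int (\<mu> i)) (f b)" if i: "i \<in> {1..Suc n}" for i
      proof -
        define g where "g b = glop (i - 1) (i - 1) (f b) - glop i i (f b) - scl (of_int (\<mu> i)) (f b)" for b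
        have diag: "glop a a (f b) \<in> cyc n (hwv b)" if "b \<in> box" "a \<le> Suc n" for a b
          using hwv_cyc_closed[OF that(1) f(1)[OF that(1)], of a a] hwv_cyc_degree[OF that(1) f(1)[OF that(1)]]
            f(1)[OF that(1)] that(2) by (cases "a = Suc n") (auto intro: gen.scl)
        have g: "g b \<in> cyc n (hwv b)" if "b \<in> box" for b
          unfolding g_def using diag[OF that] f(1)[OF that] i by (intro gen_diff gen.scl) auto
        have "(\<Sum>b\<in>box. g b) = 0"
          using x i by (simp add: g_def hwt_def sum_subtractf f(2) glop_sum ten.scale_sum_right)
        from orthogonal_sum_eq_0[OF finite_box _ _ this b, of "Suc n" N] have "g b = 0"
          using g hwv_cyc_orthogonal hwv_cyc_subset C_tensors by blast
        then show ?thesis by (simp add: g_def)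
      qed
      then show ?thesis using f(1)[OF b] by (simp add: hwt_def)
    qed
    then show "x \<in> ?S" using f(2) by blast
  next
    fix x assume "x \<in> ?S"
    then obtain f where f: "x = (\<Sum>b\<in>box. f b)" "\<And>b. b \<in> box \<Longrightarrow> f b \<in> ?A b" by blast
    have "f b \<in> hwt (Suc n) \<mu> C" if "b \<in> box" for b
      using f(2)[OF that] hwv_cyc_subset[OF that] by (auto simp: hwt_def)
    then show "x \<in> hwt (Suc n) \<mu> C"
      unfolding f(1) by (intro ten.subspace_sum subspace_hwt subspace_gen)
  qed
  moreover have "ten.dim ?S = (\<Sum>b\<in>box. ten.dim (?A b))"
    using hwv_cyc_subset C_tensors hwv_cyc_orthogonal
    by (intro dim_orthogonal_sum[where l = "Suc n" and N = N] finite_box subspace_hwt subspace_gen)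
      (auto simp: hwt_def)
  ultimately show ?thesis by simp
qed

context
  fixes lam mu :: "nat \<Rightarrow> int"
  assumes lam: "\<And>i. i \<in> {1..Suc n} \<Longrightarrow> lam i = int (m (i - 1))"
    "\<And>i. i \<notin> {1..Suc n} \<Longrightarrow> lam i = 0" and mu: "\<And>i. i \<notin> {1..Suc n} \<Longrightarrow> mu i = 0"
begin

lemma bij_partial_sums: "bij_betw (partial_sums n) box (Pi_prime (Suc n) lam)"
proof (rule bij_betw_byWitness[where f' = "increments n"])
  show "\<forall>b\<in>box. increments n (partial_sums n b) = b"
    by (auto simp: increments_def partial_sums_def box_def fun_eq_iff)
  show "\<forall>P\<in>Pi_prime (Suc n) lam. partial_sums n (increments n P) = P"
  proof (intro ballI ext)
    fix P i assume P: "P \<in> Pi_prime (Suc n) lam"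
    have "i \<le> Suc n \<Longrightarrow> (\<Sum>a<i. increments n P a) = P i" for i
    proof (induction i)
      case 0
      then show ?case using P by (auto simp: Pi_prime_def)
    next
      case (Suc i)
      have "\<forall>i\<in>{1..Suc n}. P (i - 1) \<le> P i" using P by (auto simp: Pi_prime_def)
      from bspec[OF this, of "Suc i"] show ?case using Suc by (simp add: increments_def)
    qed
    then show "partial_sums n (increments n P) i = P i"
      using P by (auto simp: partial_sums_def Pi_prime_def)
  qed
  show "partial_sums n ` box \<subseteq> Pi_prime (Suc n) lam"
  proof clarify
    fix b assume b: "b \<in> box"
    have "partial_sums n b i = partial_sums n b (i - 1) + b (i - 1)" if "i \<in> {1..Suc n}" for i
      using that by (cases i) (auto simp: partial_sums_def)
    then show "partial_sums n b \<in> Pi_prime (Suc n) lam"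
      using b lam by (auto simp: Pi_prime_def box_def partial_sums_def)
  qed
  show "increments n ` Pi_prime (Suc n) lam \<subseteq> box"
  proof clarify
    fix P assume P: "P \<in> Pi_prime (Suc n) lam"
    have "P (Suc a) - P a \<le> m a" if "a \<le> n" for a
    proof -
      have "\<forall>i\<in>{1..Suc n}. int (P i) - int (P (i - 1)) \<le> lam i" using P by (auto simp: Pi_prime_def)
      from bspec[OF this, of "Suc a"] show ?thesis using lam(1)[of "Suc a"] that by auto
    qed
    then show "increments n P \<in> box" by (auto simp: box_def increments_def)
  qed
qed

text \<open>One word in the support of \<open>x\<close> suffices. Its count of l gives p_l = a_l,
  and dominance inside the component gives p_i \<le> a_i.\<close>

lemma root_ll_if_weight:
  assumes b: "b \<in> box" and x: "x \<in> hwt (Suc n) mu (cyc n (hwv b))" "x \<noteq> 0"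
  shows "root_ll (Suc n) (partial_sums n b) (\<lambda>i. lam i - mu i)"
proof -
  let ?L = "\<lambda>c. \<Sum>i=c..n. m i"
  obtain w where w: "x w \<noteq> 0" using x(2) by (auto simp: fun_eq_iff pointwise)
  have xC: "x \<in> cyc n (hwv b)" using x by (simp add: hwt_def)
  define k where "k = count_list w"
  have mu_k: "mu i = int (k (i - 1)) - int (k i)" if "i \<in> {1..Suc n}" for i
    using x(1) w that by (auto simp: hwt_def glop_diag_diff_eq_iff k_def)
  have k_last: "k (Suc n) = (\<Sum>i\<le>n. b i)"
    using hwv_cyc_degree[OF b xC] w by (simp add: glop_diag_eq_iff k_def del: of_nat_sum)
  have "w \<in> words (Suc n) N" using C_tensors[OF hwv_cyc_subset[OF b xC]] w by (auto simp: tensors_def)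
  then have k_sum: "(\<Sum>c\<le>n. k c) + k (Suc n) = (\<Sum>c\<le>n. ?L c)"
    using sum_count_words[of w "Suc n" N] N_eq by (simp add: k_def)
  have dom: "(\<Sum>c<i. k c) + (\<Sum>c<i. b c) \<le> (\<Sum>c<i. ?L c)" if i: "i \<le> n" for i
  proof -
    have "weight_vec n (\<lambda>a. ?L a - b a) (hwv b)" using hwv_weight'[OF b] by (simp add: weight_vec_def)
    from cyc_dominated[OF xC this i w] have "(\<Sum>c<i. k c) \<le> (\<Sum>c<i. ?L c - b c)" by (simp add: k_def)
    moreover have "(\<Sum>c<i. ?L c - b c) + (\<Sum>c<i. b c) = (\<Sum>c<i. ?L c)"
      unfolding sum.distrib[symmetric] using box_le[OF b] i by (intro sum.cong) auto
    ultimately show ?thesis by linarith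
  qed
  \<comment> \<open>Since \<alpha>_i moves one letter from i - 1 to i, the coefficient of \<alpha>_i
    in \<lambda> - \<mu> is the loss in the number of letters below i.\<close>
  define a where "a i = (\<Sum>c<i. ?L c) - (\<Sum>c<i. k c)" for i
  have le: "(\<Sum>c<i. k c) \<le> (\<Sum>c<i. ?L c)" if "i \<le> Suc n" for i
  proof (cases "i = Suc n")
    case True
    then show ?thesis using k_sum by (simp add: lessThan_Suc_atMost)
  next
    case False
    then show ?thesis using dom[of i] that by linarith
  qed
  have a_int: "int (a i) = (\<Sum>c<i. int (?L c)) - (\<Sum>c<i. int (k c))" if "i \<le> Suc n" for i
    using le[OF that] by (simp add: a_def of_nat_diff)
  have a_step: "int (a (Suc i)) = int (a i) + int (?L i) - int (k i)" if "i \<le> n" for i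
    using that by (simp add: a_int)
  have a_last: "a (Suc n) = k (Suc n)"
    unfolding a_def lessThan_Suc_atMost using k_sum by simp
  have L_step: "int (?L i) = int (m i) + int (?L (Suc i))" if "i \<le> n" for i
    using that by (simp add: sum.atLeast_Suc_atMost)
  have "lam i - mu i = root_comb (Suc n) a i" for i
  proof (cases "i \<in> {1..Suc n}")
    case True
    then obtain j where j: "i = Suc j" "j \<le> n" by (cases i) auto
    have a0: "a 0 = 0" by (simp add: a_def)
    have "root_comb (Suc n) a i = 2 * int (a (Suc j)) - int (a j) - (if j = n then 0 else int (a (Suc (Suc j))))"
      using root_comb_nth[OF True, of a] j a0 by auto
    also have "\<dots> = int (?L j) - int (k j) - (int (?L (Suc j)) - int (k (Suc j)))"
      using a_step[of j] a_step[of "Suc j"] a_last j by (cases "j = n") auto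
    finally show ?thesis using lam(1)[OF True] mu_k[OF True] j L_step[of j] by simp
  qed (simp add: lam mu root_comb_outside)
  moreover have "partial_sums n b (Suc n) = a (Suc n)"
    using k_last a_last by (simp add: partial_sums_def lessThan_Suc_atMost)
  moreover have "partial_sums n b i \<le> a i" if "i \<in> {1..Suc n - 1}" for i
    using dom[of i] that by (simp add: partial_sums_def a_def)
  ultimately show ?thesis unfolding root_ll_def by blast
qed

text \<open>Only the last condition, at n + 1, is at stake. The other conditions make the deviation
  of the actual letter counts from the expected ones constant on 0, ..., n; the count of l and the
  total N are right, so this constant is 0.\<close>

lemma weight_space_if_root_ll:
  assumes b: "b \<in> box" and ll: "root_ll (Suc n) (partial_sums n b) (\<lambda>i. lam i - mu i)"
  shows "hwt (Suc n) mu (cyc n (hwv b)) = hwt n mu (cyc n (hwv b))"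
proof (intro equalityI subsetI)
  fix x assume x: "x \<in> hwt n mu (cyc n (hwv b))"
  let ?L = "\<lambda>c. \<Sum>i=c..n. m i"
  have xC: "x \<in> cyc n (hwv b)" using x by (simp add: hwt_def)
  obtain a where a: "\<And>i. lam i - mu i = root_comb (Suc n) a i" "partial_sums n b (Suc n) = a (Suc n)"
    using ll unfolding root_ll_def fun_eq_iff by blast
  \<comment> \<open>The expected count of the letter c in weight \<lambda> - (a_1 \<alpha>_1 + ... +
    a_l \<alpha>_l): one letter c is lost per \<alpha>_(c+1) and one gained per \<alpha>_c.\<close>
  define K where "K c = int (?L c) - (if c = Suc n then 0 else int (a (Suc c))) + (if c = 0 then 0 else int (a c))" for c
  have L_step: "int (?L i) = int (m i) + int (?L (Suc i))" if "i \<le> n" for i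
    using that by (simp add: sum.atLeast_Suc_atMost)
  have mu_K: "mu (Suc j) = K j - K (Suc j)" if "j \<le> n" for j
    using a(1)[of "Suc j"] root_comb_nth[of "Suc j" "Suc n" a] lam(1)[of "Suc j"] L_step[OF that] that
    by (auto simp: K_def)
  have "j \<le> n \<Longrightarrow> (\<Sum>c\<le>j. K c) = (\<Sum>c\<le>j. int (?L c)) - int (a (Suc j))" for j
    by (induction j) (auto simp: K_def)
  from this[of n] have K_sum: "(\<Sum>c\<le>n. K c) = int N - K (Suc n)"
    using N_eq by (simp add: K_def)
  have "int (count_list w n) - int (count_list w (Suc n)) = mu (Suc n)" if w: "x w \<noteq> 0" for w
  proof -
    define k where "k c = int (count_list w c)" for c
    have k_last: "k (Suc n) = K (Suc n)"
      using hwv_cyc_degree[OF b xC] w a(2)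
      by (simp add: glop_diag_eq_iff k_def K_def partial_sums_def lessThan_Suc_atMost del: of_nat_sum)
    have "w \<in> words (Suc n) N" using C_tensors[OF hwv_cyc_subset[OF b xC]] w by (auto simp: tensors_def)
    then have "int N = (\<Sum>c\<le>Suc n. k c)"
      using sum_count_words[of w "Suc n" N] by (simp only: k_def of_nat_sum[symmetric])
    then have "(\<Sum>c\<le>n. k c - K c) = 0" using K_sum k_last by (simp add: sum_subtractf)
    moreover have step: "k j - K j = k (Suc j) - K (Suc j)" if "j < n" for j
    proof -
      have "\<forall>i\<in>{1..n}. glop (i - 1) (i - 1) x - glop i i x = scl (of_int (mu i)) x"
        using x by (simp add: hwt_def)
      from bspec[OF this, of "Suc j"] have "glop j j x - glop (Suc j) (Suc j) x = scl (of_int (mu (Suc j))) x"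
        using that by simp
      then have "mu (Suc j) = k j - k (Suc j)" using w by (simp add: glop_diag_diff_eq_iff k_def)
      then show ?thesis using mu_K[of j] that by simp
    qed
    have const: "k j - K j = k 0 - K 0" if "j \<le> n" for j
      using that by (induction j) (auto simp: step[symmetric])
    have "(\<Sum>c\<le>n. k c - K c) = (\<Sum>c\<le>n. k 0 - K 0)"
      by (rule sum.cong[OF refl], rule const) simp
    ultimately have "int (Suc n) * (k 0 - K 0) = 0" by simp
    then have "k n = K n" using const[of n] by simp
    then show ?thesis using mu_K[of n] k_last by (simp add: k_def)
  qed
  then have "glop n n x - glop (Suc n) (Suc n) x = scl (of_int (mu (Suc n))) x"
    by (simp add: glop_diag_diff_eq_iff)
  then show "x \<in> hwt (Suc n) mu (cyc n (hwv b))"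
    using x by (auto simp: hwt_def atLeastAtMostSuc_conv)
qed (auto simp: hwt_def)

text \<open>Components whose index violates \<open>root_ll\<close> contribute {0}; for the others
  the weight condition reduces to that of the smaller algebra.\<close>

lemma dim_branching:
  "ten.dim (hwt (Suc n) mu C)
    = (\<Sum>P | P \<in> Pi_prime (Suc n) lam \<and> root_ll (Suc n) P (\<lambda>i. lam i - mu i).
        ten.dim (hwt n mu (cyc n (hwv (increments n P)))))"
proof -
  let ?ll = "\<lambda>P. root_ll (Suc n) P (\<lambda>i. lam i - mu i)"
  have inc: "increments n (partial_sums n b) = b" if "b \<in> box" for b
    using that by (auto simp: increments_def partial_sums_def box_def fun_eq_iff)
  have "ten.dim (hwt (Suc n) mu C) = (\<Sum>b\<in>box. ten.dim (hwt (Suc n) mu (cyc n (hwv b))))"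
    by (rule dim_weight_decomposition)
  also have "\<dots> = (\<Sum>b\<in>box. if ?ll (partial_sums n b)
      then ten.dim (hwt n mu (cyc n (hwv (increments n (partial_sums n b))))) else 0)"
  proof (intro sum.cong refl)
    fix b assume b: "b \<in> box"
    show "ten.dim (hwt (Suc n) mu (cyc n (hwv b))) = (if ?ll (partial_sums n b)
      then ten.dim (hwt n mu (cyc n (hwv (increments n (partial_sums n b))))) else 0)"
    proof (cases "?ll (partial_sums n b)")
      case True
      then show ?thesis using weight_space_if_root_ll[OF b] inc[OF b] by simp
    next
      case False
      then have "hwt (Suc n) mu (cyc n (hwv b)) = {0}"
        using root_ll_if_weight[OF b] ten.subspace_0[OF subspace_hwt[OF subspace_gen]] by blast
      moreover have "ten.dim {0} = 0" using ten.dim_eq_card[of "{}" "{0}"] ten.independent_empty by simp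
      ultimately show ?thesis using False by simp
    qed
  qed
  also have "\<dots> = (\<Sum>P\<in>Pi_prime (Suc n) lam. if ?ll P
      then ten.dim (hwt n mu (cyc n (hwv (increments n P)))) else 0)"
    by (rule sum.reindex_bij_betw[OF bij_partial_sums])
  also have "\<dots> = (\<Sum>P | P \<in> Pi_prime (Suc n) lam \<and> ?ll P. ten.dim (hwt n mu (cyc n (hwv (increments n P)))))"
    using bij_betw_finite[OF bij_partial_sums] finite_box
    by (simp add: sum.inter_filter)
  finally show ?thesis .
qed

end

end

section \<open>Comparison with an abstract irreducible module\<close>

text \<open>Partners of a basis of \<open>A\<close> are chosen and extended linearly; injectivity of
  \<open>G\<close> on both sides makes the extension a bijection onto \<open>B\<close>. With a
  relation, no isomorphism of the ambient modules has to be defined.\<close>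

lemma dim_eq_of_relation:
  fixes s1 :: "complex \<Rightarrow> 'a::ab_group_add \<Rightarrow> 'a" and s2 :: "complex \<Rightarrow> 'b::ab_group_add \<Rightarrow> 'b"
  assumes "vector_space s1" "vector_space s2"
    and AB: "module.subspace s1 A" "module.subspace s2 B"
    and G_add: "\<And>x y x' y'. G x y \<Longrightarrow> G x' y' \<Longrightarrow> G (x + x') (y + y')"
    and G_scale: "\<And>c x y. G x y \<Longrightarrow> G (s1 c x) (s2 c y)"
    and G_inj: "\<And>x. G x 0 \<Longrightarrow> x = 0" "\<And>y. G 0 y \<Longrightarrow> y = 0"
    and G_total: "\<And>x. x \<in> A \<Longrightarrow> \<exists>y\<in>B. G x y" "\<And>y. y \<in> B \<Longrightarrow> \<exists>x\<in>A. G x y"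
  shows "vector_space.dim s1 A = vector_space.dim s2 B"
proof -
  interpret v1: vector_space s1 by fact
  interpret v2: vector_space s2 by fact
  interpret vp: vector_space_pair s1 s2 by unfold_locales
  have G_diff: "G (x - x') (y - y')" if "G x y" "G x' y'" for x x' y y'
    using G_add[OF that(1) G_scale[OF that(2), of "-1"]] by simp
  obtain S where S: "S \<subseteq> A" "v1.independent S" "A \<subseteq> v1.span S" "card S = v1.dim A"
    using v1.basis_exists[of A] by metis
  have span_S: "v1.span S = A" using S AB(1) v1.span_minimal by blast
  obtain \<phi> where \<phi>: "\<And>x. x \<in> A \<Longrightarrow> \<phi> x \<in> B \<and> G x (\<phi> x)" using G_total(1) by metis
  obtain g where g: "Vector_Spaces.linear s1 s2 g" "\<And>x. x \<in> S \<Longrightarrow> g x = \<phi> x"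
    using vp.linear_independent_extend[OF S(2), of \<phi>] by blast
  interpret g: Vector_Spaces.linear s1 s2 g by fact
  have "g x \<in> B \<and> G x (g x)" if "x \<in> v1.span S" for x
    using that
  proof (induction rule: v1.span_induct_alt)
    case base
    have "G 0 0" using G_total(1) v1.subspace_0[OF AB(1)] G_scale[of _ _ 0] by fastforce
    then show ?case using v2.subspace_0[OF AB(2)] by (simp add: g.zero)
  next
    case (step c x y)
    then have "g x \<in> B" "G x (g x)" using g(2) \<phi> S(1) by auto
    then show ?case using step AB(2)
      by (simp add: g.add g.scale G_add G_scale v2.subspace_add v2.subspace_scale)
  qed
  then have gA: "g x \<in> B" "G x (g x)" if "x \<in> A" for x using that span_S by auto
  have inj: "inj_on g A"
  proof (rule inj_onI)
    fix x y assume "x \<in> A" "y \<in> A" "g x = g y"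
    then have "G (x - y) (g x - g y)" by (intro G_diff gA)
    then have "G (x - y) 0" using \<open>g x = g y\<close> by simp
    then show "x = y" using G_inj(1) by fastforce
  qed
  have img: "g ` A = B"
  proof (intro equalityI subsetI)
    fix y assume "y \<in> B"
    then obtain x where x: "x \<in> A" "G x y" using G_total(2) by blast
    then have "G (x - x) (y - g x)" by (intro G_diff gA)
    then have "G 0 (y - g x)" by simp
    then have "y = g x" using G_inj(2) by fastforce
    then show "y \<in> g ` A" using x by blast
  qed (use gA in blast)
  have "v2.independent (g ` S)"
    using vp.linear_independent_injective_image[OF g(1) S(2)] inj span_S by simp
  moreover have "v2.span (g ` S) = B"
    using vp.linear_span_image[OF g(1), of S] span_S img by simp
  moreover have "g ` S \<subseteq> B" using S(1) img by blast
  ultimately have "card (g ` S) = v2.dim B" using v2.basis_card_eq_dim by blast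
  moreover have "card (g ` S) = card S" using inj S(1) by (meson card_image inj_on_subset)
  ultimately show ?thesis using S(4) by simp
qed

section \<open>Brackets of matrix units and Chevalley generators\<close>

lemma elementary_mat_carrier [simp]: "elementary_mat k i j \<in> carrier_mat k k"
  by (simp add: elementary_mat_def)

lemma elementary_mat_mult:
  assumes "j < k"
  shows "elementary_mat k i j * elementary_mat k p q = (if j = p then elementary_mat k i q else 0\<^sub>m k k)"
proof (rule eq_matI)
  fix r c assume "r < dim_row (if j = p then elementary_mat k i q else 0\<^sub>m k k)"
    "c < dim_col (if j = p then elementary_mat k i q else 0\<^sub>m k k)"
  then have rc: "r < k" "c < k" by (auto simp: elementary_mat_def split: if_splits)
  have "(elementary_mat k i j * elementary_mat k p q) $$ (r, c)
     = (\<Sum>t = 0..<k. (if r = i \<and> t = j then 1 else 0) * (if t = p \<and> c = q then 1 else 0))"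
    using rc by (simp add: elementary_mat_def scalar_prod_def)
  also have "\<dots> = (\<Sum>t = 0..<k. (if t = j then (if r = i \<and> j = p \<and> c = q then 1 else 0) else 0))"
    by (intro sum.cong) auto
  finally show "(elementary_mat k i j * elementary_mat k p q) $$ (r, c)
     = (if j = p then elementary_mat k i q else 0\<^sub>m k k) $$ (r, c)"
    using assms rc by (auto simp: elementary_mat_def)
qed (auto simp: elementary_mat_def)

lemma bracket_e_f:
  assumes "i \<in> {1..l}" "j \<in> {1..l}"
  shows "lie_bracket (chevalley_e l i) (chevalley_f l j)
    = (if i = j then chevalley_h l i else 0\<^sub>m (l + 1) (l + 1))"
  using assms unfolding lie_bracket_def chevalley_e_def chevalley_f_def chevalley_h_def
  by (auto simp: elementary_mat_mult)

lemma bracket_h_f: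
  assumes "i \<in> {1..l}" "j \<in> {1..l}"
  shows "lie_bracket (chevalley_h l i) (chevalley_f l j) = - of_int (simple_root l j i) \<cdot>\<^sub>m chevalley_f l j"
proof -
  let ?E = "elementary_mat (l + 1)"
  have "lie_bracket (chevalley_h l i) (chevalley_f l j)
    = (?E (i - 1) (i - 1) * ?E j (j - 1) - ?E i i * ?E j (j - 1))
      - (?E j (j - 1) * ?E (i - 1) (i - 1) - ?E j (j - 1) * ?E i i)"
    unfolding lie_bracket_def chevalley_f_def chevalley_h_def
    by (simp only: minus_mult_distrib_mat[OF elementary_mat_carrier elementary_mat_carrier elementary_mat_carrier]
        mult_minus_distrib_mat[OF elementary_mat_carrier elementary_mat_carrier elementary_mat_carrier])
  also have "\<dots> = ((if i - 1 = j then ?E (i - 1) (j - 1) else 0\<^sub>m (l + 1) (l + 1))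
        - (if i = j then ?E i (j - 1) else 0\<^sub>m (l + 1) (l + 1)))
      - ((if j - 1 = i - 1 then ?E j (i - 1) else 0\<^sub>m (l + 1) (l + 1))
        - (if j - 1 = i then ?E j i else 0\<^sub>m (l + 1) (l + 1)))"
  proof -
    have "i - 1 < l + 1" "i < l + 1" "j - 1 < l + 1" using assms by auto
    then show ?thesis by (simp only: elementary_mat_mult)
  qed
  also have "\<dots> = - of_int (simple_root l j i) \<cdot>\<^sub>m ?E j (j - 1)"
  proof -
    obtain p q where pq: "i = Suc p" "j = Suc q" using assms by (metis atLeastAtMost_iff not0_implies_Suc not_one_le_zero)
    consider "p = q" | "p = Suc q" | "q = Suc p" | "p \<noteq> q" "p \<noteq> Suc q" "q \<noteq> Suc p" by blast
    then show ?thesis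
      using assms by cases (simp_all add: pq simple_root_def, (rule eq_matI; simp add: elementary_mat_def)+)
  qed
  finally show ?thesis by (simp add: chevalley_f_def)
qed

lemma generators_in_subalgebra:
  assumes "i \<in> {1..n}"
  shows "chevalley_e l i \<in> type_A_subalgebra l n" "chevalley_f l i \<in> type_A_subalgebra l n"
    "chevalley_h l i \<in> type_A_subalgebra l n"
  unfolding type_A_subalgebra_def using assms by (auto intro!: lie_subalgebra_generated.generator)

text \<open>The submodule generated by \<open>(v, y)\<close> in the product of two modules; for irreducible modules with
  the same highest weight it is the graph of an isomorphism.\<close>

inductive pairing :: "(complex \<Rightarrow> 'v::ab_group_add \<Rightarrow> 'v) \<Rightarrow> (nat \<Rightarrow> 'v \<Rightarrow> 'v) \<Rightarrow> nat \<Rightarrow> 'v \<Rightarrow> tensor \<Rightarrow>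
    'v \<Rightarrow> tensor \<Rightarrow> bool"
  for smul F n v y where
  base: "pairing smul F n v y v y"
| add: "pairing smul F n v y x z \<Longrightarrow> pairing smul F n v y x' z' \<Longrightarrow> pairing smul F n v y (x + x') (z + z')"
| scale: "pairing smul F n v y x z \<Longrightarrow> pairing smul F n v y (smul c x) (scl c z)"
| lower: "i \<in> {1..n} \<Longrightarrow> pairing smul F n v y x z \<Longrightarrow> pairing smul F n v y (F i x) (glop i (i - 1) z)"

text \<open>The rank \<open>n\<close> is separate from \<open>l\<close> and \<open>l'\<close>
  because the comparison serves both the full algebra and the smaller one, whose elements keep the
  larger matrix size and act on tensors with the additional letter.\<close>

locale highest_weight_comparison =
  irreducible_highest_weight_module smul "type_A_subalgebra l n" V act l n \<nu>
  for smul :: "complex \<Rightarrow> 'v::ab_group_add \<Rightarrow> 'v" and V act and l n :: nat and \<nu> +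
  fixes l' N :: nat and \<kappa> :: "nat \<Rightarrow> nat" and y :: tensor and v :: 'v
  assumes nl: "n \<le> l" "n \<le> l'" and y: "y \<in> tensors l' N" "y \<noteq> 0" "singular n y" "weight_vec n \<kappa> y"
    and \<nu>: "\<And>i. i \<in> {1..n} \<Longrightarrow> \<nu> i = int (\<kappa> (i - 1)) - int (\<kappa> i)"
    and v: "v \<in> weight_space l n smul V act \<nu>" "v \<noteq> 0" "\<forall>i\<in>{1..n}. act (chevalley_e l i) v = 0"
begin

abbreviation "L \<equiv> type_A_subalgebra l n"
abbreviation "e i \<equiv> act (chevalley_e l i)"
abbreviation "f i \<equiv> act (chevalley_f l i)"
abbreviation "h i \<equiv> act (chevalley_h l i)"
abbreviation "G \<equiv> pairing smul f n v y"

lemma in_L: "i \<in> {1..n} \<Longrightarrow> chevalley_e l i \<in> L" "i \<in> {1..n} \<Longrightarrow> chevalley_f l i \<in> L"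
    "i \<in> {1..n} \<Longrightarrow> chevalley_h l i \<in> L"
  by (fact generators_in_subalgebra)+

lemma zero_in_L: "0\<^sub>m (l + 1) (l + 1) \<in> L"
  by (simp add: type_A_subalgebra_def lie_subalgebra_generated.zero)

lemma act_zero_mat: "x \<in> V \<Longrightarrow> act (0\<^sub>m (l + 1) (l + 1)) x = 0"
  using act_add_left[OF zero_in_L zero_in_L, of x] by simp

lemma V_closed: "x \<in> V \<Longrightarrow> x' \<in> V \<Longrightarrow> x + x' \<in> V" "x \<in> V \<Longrightarrow> smul c x \<in> V" "0 \<in> V"
    "x \<in> V \<Longrightarrow> x' \<in> V \<Longrightarrow> x - x' \<in> V"
  using subspace_V subspace_add subspace_scale subspace_0 subspace_diff by blast+

lemma efh_closed: "i \<in> {1..n} \<Longrightarrow> x \<in> V \<Longrightarrow> e i x \<in> V" "i \<in> {1..n} \<Longrightarrow> x \<in> V \<Longrightarrow> f i x \<in> V"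
    "i \<in> {1..n} \<Longrightarrow> x \<in> V \<Longrightarrow> h i x \<in> V"
  using act_closed in_L by blast+

lemma e_f: "i \<in> {1..n} \<Longrightarrow> j \<in> {1..n} \<Longrightarrow> x \<in> V \<Longrightarrow> e i (f j x) = f j (e i x) + (if i = j then h i x else 0)"
  using act_bracket[of "chevalley_e l i" "chevalley_f l j" x] bracket_e_f[of i l j] in_L nl act_zero_mat
  by (auto simp: algebra_simps split: if_splits)

lemma h_f: "i \<in> {1..n} \<Longrightarrow> j \<in> {1..n} \<Longrightarrow> x \<in> V \<Longrightarrow>
    h i (f j x) = f j (h i x) - smul (of_int (simple_root l j i)) (f j x)"
  using act_bracket[of "chevalley_h l i" "chevalley_f l j" x] bracket_h_f[of i l j] in_L nl
    act_smult_left[of "chevalley_f l j" x "- of_int (simple_root l j i)"]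
  by (auto simp: algebra_simps)

lemma v_V: "v \<in> V" and h_v: "i \<in> {1..n} \<Longrightarrow> h i v = smul (of_int (\<nu> i)) v"
  using v(1) by (auto simp: weight_space_def)

text \<open>h_i = [e_i, f_i], and stability passes through the inductive generation of the
  algebra.\<close>

lemma stable_subspace:
  assumes U: "subspace U" "U \<subseteq> V"
    and ef: "\<And>i u. i \<in> {1..n} \<Longrightarrow> u \<in> U \<Longrightarrow> e i u \<in> U" "\<And>i u. i \<in> {1..n} \<Longrightarrow> u \<in> U \<Longrightarrow> f i u \<in> U"
  shows "U = {0} \<or> U = V"
proof (rule irreducible[OF U])
  fix A u assume A: "A \<in> L" and u: "u \<in> U"
  have hU: "h i u \<in> U" if "i \<in> {1..n}" "u \<in> U" for i u
    using e_f[OF that(1,1), of u] ef that U subspace_diff[OF U(1), of "e i (f i u)" "f i (e i u)"]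
    by (auto simp: algebra_simps)
  show "act A u \<in> U"
    using A u unfolding type_A_subalgebra_def
  proof (induction arbitrary: u)
    case (generator A)
    then show ?case using ef hU by auto
  next
    case zero
    then show ?case using act_zero_mat U subspace_0 by auto
  next
    case (add A B)
    then show ?case using act_add_left[of A B u] U subspace_add
      by (auto simp: type_A_subalgebra_def)
  next
    case (smult A c)
    then show ?case using act_smult_left[of A u c] U subspace_scale
      by (auto simp: type_A_subalgebra_def)
  next
    case (bracket A B)
    then show ?case using act_bracket[of A B u] U subspace_diff
      by (auto simp: type_A_subalgebra_def)
  qed
qed

section \<open>A grading that isolates the highest weight vector\<close>

text \<open>The action of the half sum of the positive coroots: every \<open>f\<^sub>i\<close> lowers its eigenvalues by 1.\<close>

definition grading :: "'v \<Rightarrow> 'v" where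
  "grading x = (\<Sum>i=1..n. smul (of_nat i * (of_nat n + 1 - of_nat i) / 2) (h i x))"

lemma grading_closed: "x \<in> V \<Longrightarrow> grading x \<in> V"
  unfolding grading_def by (intro subspace_sum subspace_V V_closed efh_closed)

lemma grading_linear:
  assumes "x \<in> V" "x' \<in> V"
  shows "grading (smul c x + x') = smul c (grading x) + grading x'"
proof -
  have "h i (smul c x + x') = smul c (h i x) + h i x'" if "i \<in> {1..n}" for i
    using act_add_right act_scale_right in_L that assms V_closed by auto
  then show ?thesis
    unfolding grading_def scale_sum_right sum.distrib[symmetric]
    by (intro sum.cong refl) (simp add: scale_right_distrib mult.commute)
qed

text \<open>The coefficients c_i = i (n + 1 - i) / 2 have second difference -1. As c_0 = c_(n+1) =
  0, the first and last rows of the Cartan matrix need no separate treatment.\<close>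

lemma sum_cartan_row:
  assumes "j \<in> {1..n}"
  shows "(\<Sum>i=1..n. of_nat i * (of_nat n + 1 - of_nat i) / 2 * of_int (simple_root l j i)) = (1::complex)"
proof -
  let ?c = "\<lambda>i::nat. of_nat i * (of_nat n + 1 - of_nat i) / (2::complex)"
  have "(\<Sum>i=1..n. ?c i * of_int (simple_root l j i))
     = (\<Sum>i=1..n. (if i = j then 2 * ?c j else 0) - (if i = j + 1 then ?c (j + 1) else 0)
        - (if i = j - 1 then ?c (j - 1) else 0))"
    using assms nl by (intro sum.cong) (auto simp: simple_root_def)
  also have "\<dots> = 2 * ?c j - (if j = n then 0 else ?c (j + 1)) - (if j = 1 then 0 else ?c (j - 1))"
    unfolding sum_subtractf using assms by (auto simp: sum.delta)
  also have "\<dots> = 2 * ?c j - ?c (j + 1) - ?c (j - 1)" by auto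
  also have "\<dots> = 1"
    using assms by (cases j) (auto simp: field_simps)
  finally show ?thesis .
qed

lemma grading_f:
  assumes "j \<in> {1..n}" "x \<in> V"
  shows "grading (f j x) = f j (grading x) - f j x"
proof -
  let ?c = "\<lambda>i::nat. of_nat i * (of_nat n + 1 - of_nat i) / (2::complex)"
  have f_sum: "f j (\<Sum>i\<in>I. g i) = (\<Sum>i\<in>I. f j (g i))" if "finite I" "\<And>i. i \<in> I \<Longrightarrow> g i \<in> V" for I :: "nat set" and g
    using that
  proof (induction I rule: finite_induct)
    case empty
    have "f j (0 + 0) = f j 0 + f j 0" using assms(1) by (intro act_add_right in_L V_closed)
    then show ?case by simp
  next
    case (insert a I)
    then have "(\<Sum>i\<in>I. g i) \<in> V" by (intro subspace_sum subspace_V) auto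
    then show ?case using insert assms(1) act_add_right in_L by simp
  qed
  have "grading (f j x) = (\<Sum>i=1..n. f j (smul (?c i) (h i x)) - smul (?c i * of_int (simple_root l j i)) (f j x))"
    unfolding grading_def
  proof (intro sum.cong refl)
    fix i assume i: "i \<in> {1..n}"
    have "f j (smul (?c i) (h i x)) = smul (?c i) (f j (h i x))"
      by (rule act_scale_right[OF in_L(2)[OF assms(1)] efh_closed(3)[OF i assms(2)]])
    then show "smul (?c i) (h i (f j x)) = f j (smul (?c i) (h i x)) - smul (?c i * of_int (simple_root l j i)) (f j x)"
      by (simp add: h_f[OF i assms] scale_right_diff_distrib)
  qed
  also have "\<dots> = f j (grading x) - smul 1 (f j x)"
    unfolding sum_subtractf scale_sum_left[symmetric] sum_cartan_row[OF assms(1)] grading_def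
    using assms efh_closed V_closed by (subst f_sum) auto
  finally show ?thesis by simp
qed

definition top_degree :: complex where
  "top_degree = (\<Sum>i=1..n. of_nat i * (of_nat n + 1 - of_nat i) / 2 * of_int (\<nu> i))"

lemma grading_v: "grading v = smul top_degree v"
  unfolding grading_def top_degree_def scale_sum_left by (intro sum.cong refl) (simp add: h_v)

text \<open>A substitute for the sum of the lower weight spaces. It has to avoid \<open>v\<close>
  and contain every f_j v, which gives the coefficient of \<open>v\<close> a meaning on the vectors
  generated from it.\<close>

definition lower_part :: "'v set" where
  "lower_part = span {x \<in> V. \<exists>k\<ge>1. grading x = smul (top_degree - of_nat k) x}"

lemma subspace_lower_part: "subspace lower_part"
  unfolding lower_part_def by (rule subspace_span)

lemma lower_part_V: "lower_part \<subseteq> V"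
  unfolding lower_part_def by (rule span_minimal) (auto intro: subspace_V)

text \<open>The product of the operators grading - (top_degree - j) for j = 1, ..., k, which
  separates lower eigenvalues from the top one.\<close>

primrec annihilate :: "nat \<Rightarrow> 'v \<Rightarrow> 'v" where
  "annihilate 0 x = x"
| "annihilate (Suc k) x = grading (annihilate k x) - smul (top_degree - of_nat (Suc k)) (annihilate k x)"

lemma annihilate_closed: "x \<in> V \<Longrightarrow> annihilate k x \<in> V"
  by (induction k) (auto intro!: V_closed grading_closed)

lemma annihilate_linear:
  "x \<in> V \<Longrightarrow> x' \<in> V \<Longrightarrow> annihilate k (smul c x + x') = smul c (annihilate k x) + annihilate k x'"
  by (induction k)
    (auto simp: grading_linear annihilate_closed scale_right_distrib scale_right_diff_distrib mult.commute)

lemma annihilate_eigenvector: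
  assumes "grading x = smul a x" "x \<in> V"
  shows "annihilate k x = smul (\<Prod>j=1..k. a - top_degree + of_nat j) x"
proof (induction k)
  case (Suc k)
  have "grading (smul c x + 0) = smul c (grading x) + grading 0" for c
    using grading_linear V_closed assms(2) by blast
  moreover have "grading 0 = 0" using grading_linear[of 0 0 1] V_closed by simp
  ultimately have "grading (smul c x) = smul (c * a) x" for c by (simp add: assms(1))
  then have "annihilate (Suc k) x = smul ((\<Prod>j=1..k. a - top_degree + of_nat j) * a
      - (top_degree - of_nat (Suc k)) * (\<Prod>j=1..k. a - top_degree + of_nat j)) x"
    by (simp only: annihilate.simps Suc scale_scale scale_left_diff_distrib)
  then show ?case by (simp add: algebra_simps)
qed simp

text \<open>Every element of \<open>lower_part\<close> is killed by \<open>annihilate k\<close> for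
  large k, whereas on \<open>v\<close> this operator is multiplication by k!.\<close>

lemma v_notin_lower_part: "v \<notin> lower_part"
proof
  assume "v \<in> lower_part"
  then have "v \<in> V \<and> (\<exists>k0. \<forall>k\<ge>k0. annihilate k v = 0)"
    unfolding lower_part_def
  proof (induction rule: span_induct_alt)
    case base
    have "annihilate k 0 = 0" for k using annihilate_linear[of 0 0 k 1] V_closed by simp
    then show ?case using V_closed by simp
  next
    case (step c x x')
    then obtain d where d: "d \<ge> 1" "grading x = smul (top_degree - of_nat d) x" "x \<in> V" by auto
    have "annihilate k x = 0" if "k \<ge> d" for k
    proof -
      have "(\<Prod>j=1..k. top_degree - of_nat d - top_degree + of_nat j) = (0::complex)"
        using d that by (intro prod_zero bexI[of _ d]) auto
      then show ?thesis using annihilate_eigenvector[OF d(2,3), of k] by simp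
    qed
    moreover obtain k0 where "\<forall>k\<ge>k0. annihilate k x' = 0" using step by blast
    ultimately have "\<forall>k\<ge>max d k0. annihilate k (smul c x + x') = 0"
      using annihilate_linear d(3) step by simp
    then show ?case using d(3) step V_closed by blast
  qed
  then obtain k where "annihilate k v = 0" by blast
  moreover have "(\<Prod>j=1..k. top_degree - top_degree + of_nat j) \<noteq> (0::complex)" by simp
  ultimately show False using annihilate_eigenvector[OF grading_v v_V, of k] v(2) by simp
qed

lemma f_lower_part:
  assumes j: "j \<in> {1..n}" and x: "x \<in> lower_part"
  shows "f j x \<in> lower_part"
proof -
  have "x \<in> V \<and> f j x \<in> lower_part"
    using x unfolding lower_part_def
  proof (induction rule: span_induct_alt)
    case base
    have "f j (0 + 0) = f j 0 + f j 0" using j by (intro act_add_right in_L V_closed)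
    then show ?case using V_closed by (simp add: span_zero)
  next
    case (step c x x')
    then obtain k where k: "k \<ge> 1" "grading x = smul (top_degree - of_nat k) x" "x \<in> V" by auto
    have x': "x' \<in> V" using step by simp
    have "grading (f j x) = smul (top_degree - of_nat k) (f j x) - smul 1 (f j x)"
      using grading_f[OF j k(3)] act_scale_right[OF in_L(2)[OF j] k(3)] by (simp only: k(2) scale_one)
    also have "\<dots> = smul (top_degree - of_nat k - 1) (f j x)"
      by (simp only: scale_left_diff_distrib)
    finally have "grading (f j x) = smul (top_degree - of_nat (Suc k)) (f j x)"
      by (simp add: algebra_simps)
    then have "f j x \<in> span {x \<in> V. \<exists>k\<ge>1. grading x = smul (top_degree - of_nat k) x}"
      using efh_closed(2)[OF j k(3)] k(1) by (intro span_base CollectI conjI exI[of _ "Suc k"]) auto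
    moreover have "f j (smul c x + x') = smul c (f j x) + f j x'"
      using act_add_right[OF in_L(2)[OF j] V_closed(2)[OF k(3)] x'] act_scale_right[OF in_L(2)[OF j] k(3)] by simp
    ultimately show ?case using step k(3) x' V_closed by (simp add: span_add span_scale)
  qed
  then show ?thesis by simp
qed

lemma f_v: "j \<in> {1..n} \<Longrightarrow> f j v \<in> lower_part"
  using grading_f[OF _ v_V, of j] act_scale_right[OF in_L(2) v_V, of j top_degree] efh_closed v_V
  unfolding lower_part_def
  by (intro span_base) (auto simp: grading_v scale_left_diff_distrib intro!: exI[of _ 1])

section \<open>The pairing is the graph of an isomorphism\<close>

lemma G_0: "G 0 0"
  using pairing.scale[OF pairing.base, of smul f n v y 0] by simp

lemma G_diff:
  assumes "G x z" "G x' z'"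
  shows "G (x - x') (z - z')"
  using pairing.add[OF assms(1) pairing.scale[OF assms(2), of "-1"]] by simp

lemma G_in:
  assumes "G x z"
  shows "x \<in> V" "z \<in> cyc n y"
  using assms
proof induction
  case (lower i x z)
  {
    case 1
    show ?case using lower efh_closed by blast
  next
    case 2
    show ?case using lower by (intro gen.glop) (auto simp: lowering_def)
  }
qed (auto intro: v_V V_closed gen.intros)

text \<open>The pairing is generated by lowering alone. As in \<open>cyc_closed\<close>, e_j and h_j
  are moved past f_i, and the commutation relations agree on both sides.\<close>

lemma G_e_h:
  assumes "G x z" "j \<in> {1..n}"
  shows "G (e j x) (glop (j - 1) j z)" "G (h j x) (glop (j - 1) (j - 1) z - glop j j z)"
  using assms
proof induction
  case base
  {
    case 1
    have "glop (j - 1) j y = 0" using y(3) 1 by (auto simp: singular_def)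
    then show ?case using v(3) 1 G_0 by simp
  next
    case 2
    have "glop (j - 1) (j - 1) y - glop j j y = scl (of_int (\<nu> j)) y"
      using y(4) 2 \<nu>[OF 2] by (auto simp: weight_vec_def ten.scale_left_diff_distrib)
    then show ?case using h_v[OF 2] pairing.scale[OF pairing.base] by simp
  }
next
  case (add x z x' z')
  {
    case 1
    show ?case using add G_in 1 by (simp add: glop_add act_add_right in_L pairing.add)
  next
    case 2
    have "glop (j - 1) (j - 1) (z + z') - glop j j (z + z')
      = (glop (j - 1) (j - 1) z - glop j j z) + (glop (j - 1) (j - 1) z' - glop j j z')"
      by (simp add: glop_add)
    then show ?case using add G_in 2 by (simp add: act_add_right in_L pairing.add)
  }
next
  case (scale x z c)
  {
    case 1
    show ?case using scale G_in 1 by (simp add: glop_scl act_scale_right in_L pairing.scale)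
  next
    case 2
    have "glop (j - 1) (j - 1) (scl c z) - glop j j (scl c z) = scl c (glop (j - 1) (j - 1) z - glop j j z)"
      by (simp add: glop_scl ten.scale_right_diff_distrib)
    then show ?case using scale G_in 2 by (simp add: act_scale_right in_L pairing.scale)
  }
next
  case (lower i x z)
  note xV = G_in(1)[OF lower(2)]
  {
    case 1
    have "glop (j - 1) j (glop i (i - 1) z) = glop i (i - 1) (glop (j - 1) j z)
        + (if j = i then glop (j - 1) (j - 1) z - glop j j z else 0)"
      using glop_commutator[of "j - 1" j i "i - 1" z] lower(1) 1 by auto
    moreover have "G (f i (e j x) + (if j = i then h j x else 0)) (glop i (i - 1) (glop (j - 1) j z)
        + (if j = i then glop (j - 1) (j - 1) z - glop j j z else 0))"
      using lower 1 G_0 by (intro pairing.add pairing.lower) auto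
    ultimately show ?case using e_f[OF 1 lower(1) xV] by simp
  next
    case 2
    have "glop (j - 1) (j - 1) (glop i (i - 1) z) - glop j j (glop i (i - 1) z)
      = glop i (i - 1) (glop (j - 1) (j - 1) z - glop j j z) - scl (of_int (simple_root l i j)) (glop i (i - 1) z)"
    proof -
      let ?w = "glop i (i - 1) z"
      have "glop (j - 1) (j - 1) ?w - glop j j ?w = glop i (i - 1) (glop (j - 1) (j - 1) z - glop j j z)
        + ((if j - 1 = i then ?w else 0) - (if i = j then ?w else 0) - (if j = i then ?w else 0)
           + (if i = j + 1 then ?w else 0))"
        using glop_commutator[of "j - 1" "j - 1" i "i - 1" z] glop_commutator[of j j i "i - 1" z] lower(1) 2
        by (auto simp: glop_diff)
      moreover have "(if j - 1 = i then ?w else 0) - (if i = j then ?w else 0) - (if j = i then ?w else 0)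
           + (if i = j + 1 then ?w else 0) = - scl (of_int (simple_root l i j)) ?w"
      proof -
        have "scl 2 ?w = ?w + ?w" using ten.scale_left_distrib[of 1 1 ?w] by simp
        then show ?thesis using lower(1) 2 nl by (auto simp: simple_root_def)
      qed
      ultimately show ?thesis by simp
    qed
    moreover have "G (f i (h j x) - smul (of_int (simple_root l i j)) (f i x))
      (glop i (i - 1) (glop (j - 1) (j - 1) z - glop j j z) - scl (of_int (simple_root l i j)) (glop i (i - 1) z))"
      using lower 2 by (intro G_diff pairing.scale pairing.lower) auto
    ultimately show ?case using h_f[OF 2 lower(1) xV] by simp
  }
qed

text \<open>Paired vectors have the same leading coefficient: that of \<open>v\<close> modulo
  \<open>lower_part\<close>, and that of \<open>y\<close> in the orthogonal projection. This keeps
  (v, 0) and (0, y) out of the pairing.\<close>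

lemma G_top:
  assumes "G x z"
  shows "\<exists>c. x - smul c v \<in> lower_part \<and> ip l' N z y = c * ip l' N y y"
  using assms
proof induction
  case base
  show ?case by (intro exI[of _ 1]) (simp add: lower_part_def span_zero)
next
  case (add x z x' z')
  then obtain c c' where c: "x - smul c v \<in> lower_part" "ip l' N z y = c * ip l' N y y"
    "x' - smul c' v \<in> lower_part" "ip l' N z' y = c' * ip l' N y y" by blast
  have "(x + x') - smul (c + c') v = (x - smul c v) + (x' - smul c' v)"
    by (simp add: scale_left_distrib)
  then have "(x + x') - smul (c + c') v \<in> lower_part"
    using subspace_add[OF subspace_lower_part] c by metis
  then show ?case using c by (intro exI[of _ "c + c'"]) (simp add: ip_add_left distrib_right)
next
  case (scale x z a)
  then obtain c where c: "x - smul c v \<in> lower_part" "ip l' N z y = c * ip l' N y y" by blast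
  have "smul a x - smul (a * c) v = smul a (x - smul c v)"
    by (simp add: scale_right_diff_distrib)
  then have "smul a x - smul (a * c) v \<in> lower_part"
    using subspace_scale[OF subspace_lower_part] c by metis
  then show ?case using c by (intro exI[of _ "a * c"]) (simp add: ip_scl_left)
next
  case (lower i x z)
  then obtain c where c: "x - smul c v \<in> lower_part" by blast
  have "f i (x - smul c v) + smul c (f i v) = f i ((x - smul c v) + smul c v)"
    using act_add_right[OF in_L(2)[OF lower(1)] _ V_closed(2)[OF v_V], of "x - smul c v" c]
      act_scale_right[OF in_L(2)[OF lower(1)] v_V] c lower_part_V by auto
  then have "f i x \<in> lower_part"
    using f_lower_part[OF lower(1) c] f_v[OF lower(1)] subspace_lower_part
    by (metis diff_add_cancel subspace_add subspace_scale)
  moreover have "glop (i - 1) i y = 0" using y(3) lower(1) by (auto simp: singular_def)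
  then have "ip l' N (glop i (i - 1) z) y = 0" using lower(1) nl by (subst ip_glop) auto
  ultimately show ?case by (intro exI[of _ 0]) simp
qed

lemma ip_y: "ip l' N y y \<noteq> 0"
  using ip_self_eq_0 y(1,2) by blast

text \<open>The vectors paired with 0 form a submodule of an irreducible module, and by
  \<open>G_top\<close> it misses the highest weight vector.\<close>

lemma G_injective: "G x 0 \<Longrightarrow> x = 0" "G 0 z \<Longrightarrow> z = 0"
proof -
  have "subspace {x. G x 0}"
    using G_0 pairing.add[of smul f n v y _ 0 _ 0] pairing.scale[of smul f n v y _ 0]
    by (auto simp: subspace_def)
  moreover have "G (e i u) 0" "G (f i u) 0" if "i \<in> {1..n}" "G u 0" for i u
    using G_e_h(1)[OF that(2,1)] pairing.lower[OF that] by auto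
  ultimately have "{x. G x 0} = {0} \<or> {x. G x 0} = V"
    using G_in(1) by (intro stable_subspace) auto
  moreover have "\<not> G v 0"
  proof
    assume "G v 0"
    then show False using G_top[of v 0] v_notin_lower_part ip_y by auto
  qed
  ultimately show "x = 0" if "G x 0" using that v_V by blast
  have sub: "ten.subspace {z. G 0 z}"
    using G_0 pairing.add[of smul f n v y 0 _ 0] pairing.scale[of smul f n v y 0]
    by (auto simp: ten.subspace_def)
  have "f i 0 = 0" "e i 0 = 0" if "i \<in> {1..n}" for i
    using that act_add_right[OF in_L(1), of i 0 0] act_add_right[OF in_L(2), of i 0 0] V_closed by auto
  then have "G 0 (glop i (Suc i) u)" "G 0 (glop (Suc i) i u)" if "i < n" "G 0 u" for i u
    using G_e_h(1)[OF that(2), of "Suc i"] pairing.lower[OF _ that(2), of "Suc i"] that(1) by auto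
  then have "{z. G 0 z} = {0} \<or> {z. G 0 z} = cyc n y"
    using G_in(2) by (intro cyc_irreducible[OF nl(2) y(1,3) sub]) auto
  moreover have "\<not> G 0 y"
  proof
    assume "G 0 y"
    then have "0 - smul 1 v \<in> lower_part" using G_top[of 0 y] ip_y by auto
    then have "smul (-1) (0 - smul 1 v) \<in> lower_part" unfolding lower_part_def by (rule span_scale)
    then show False using v_notin_lower_part by simp
  qed
  ultimately show "z = 0" if "G 0 z" using that gen.base by blast
qed

text \<open>Both projections of the pairing are submodules, nonzero because of the pair (v,
  y).\<close>

lemma G_total: "x \<in> V \<Longrightarrow> \<exists>z. G x z" "z \<in> cyc n y \<Longrightarrow> \<exists>x. G x z"
proof -
  have sub: "subspace {x. \<exists>z. G x z}"
    using G_0 by (auto simp: subspace_def intro: pairing.add pairing.scale)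
  have "{x. \<exists>z. G x z} = {0} \<or> {x. \<exists>z. G x z} = V"
    using G_in(1) by (intro stable_subspace[OF sub]) (blast intro: G_e_h(1) pairing.lower)+
  then show "\<exists>z. G x z" if "x \<in> V" using that v(2) pairing.base by blast
  have sub: "ten.subspace {z. \<exists>x. G x z}"
    using G_0 by (auto simp: ten.subspace_def intro: pairing.add pairing.scale)
  have "\<exists>x. G x (glop i (Suc i) u)" "\<exists>x. G x (glop (Suc i) i u)" if "i < n" "G x u" for i x u
    using G_e_h(1)[OF that(2), of "Suc i"] pairing.lower[OF _ that(2), of "Suc i"] that(1) by auto
  then have "{z. \<exists>x. G x z} = {0} \<or> {z. \<exists>x. G x z} = cyc n y"
    using G_in(2) by (intro cyc_irreducible[OF nl(2) y(1,3) sub]) blast+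
  then show "\<exists>x. G x z" if "z \<in> cyc n y" using that y(2) pairing.base by blast
qed

text \<open>The defect of the weight equation at \<open>x\<close> is paired with the one at
  \<open>z\<close>. By injectivity one vanishes exactly if the other does.\<close>

lemma dim_weight_space: "dim (weight_space l n smul V act \<mu>) = ten.dim (hwt n \<mu> (cyc n y))"
proof (rule dim_eq_of_relation[where G = G])
  show "vector_space smul" "vector_space scl" by unfold_locales
  show "subspace (weight_space l n smul V act \<mu>)"
    unfolding subspace_def
  proof (intro conjI ballI allI)
    have "h i 0 = 0" if "i \<in> {1..n}" for i
      using that act_add_right[OF in_L(3), of i 0 0] V_closed by auto
    then show "0 \<in> weight_space l n smul V act \<mu>" using V_closed by (auto simp: weight_space_def)
  qed (auto simp: weight_space_def V_closed act_add_right act_scale_right in_L scale_right_distrib mult.commute)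
  show "ten.subspace (hwt n \<mu> (cyc n y))" by (intro subspace_hwt subspace_gen)
  have G_weight: "G (h i x - smul (of_int (\<mu> i)) x) (glop (i - 1) (i - 1) z - glop i i z - scl (of_int (\<mu> i)) z)"
    if "G x z" "i \<in> {1..n}" for x z i
    using G_e_h(2)[OF that] that(1) by (intro G_diff pairing.scale)
  show "\<exists>z\<in>hwt n \<mu> (cyc n y). G x z" if x: "x \<in> weight_space l n smul V act \<mu>" for x
  proof -
    obtain z where z: "G x z" using x G_total(1) by (auto simp: weight_space_def)
    then have "glop (i - 1) (i - 1) z - glop i i z = scl (of_int (\<mu> i)) z" if "i \<in> {1..n}" for i
      using G_weight[OF z that] G_injective(2) x that by (fastforce simp: weight_space_def)
    then have "z \<in> hwt n \<mu> (cyc n y)" using G_in(2)[OF z] by (simp add: hwt_def)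
    then show ?thesis using z by blast
  qed
  show "\<exists>x\<in>weight_space l n smul V act \<mu>. G x z" if z: "z \<in> hwt n \<mu> (cyc n y)" for z
  proof -
    obtain x where x: "G x z" using z G_total(2) by (auto simp: hwt_def)
    then have "h i x = smul (of_int (\<mu> i)) x" if "i \<in> {1..n}" for i
      using G_weight[OF x that] G_injective(1) z that by (fastforce simp: hwt_def)
    then have "x \<in> weight_space l n smul V act \<mu>" using G_in(1)[OF x] by (simp add: weight_space_def)
    then show ?thesis using x by blast
  qed
qed (auto intro: pairing.add pairing.scale G_injective)

end

section \<open>The branching rule\<close>

lemma lie_bracket_elementary:
  assumes "j < k" "p < k" "p \<noteq> i"
  shows "lie_bracket (elementary_mat k i j) (elementary_mat k j p) = elementary_mat k i p"
  unfolding lie_bracket_def using assms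
  by (auto simp: elementary_mat_mult) (auto simp: elementary_mat_def)

lemma trace_elementary:
  assumes "p < k"
  shows "(\<Sum>i<k. elementary_mat k p q $$ (i, i)) = (if p = q then 1 else 0)"
proof -
  have "(\<Sum>i<k. elementary_mat k p q $$ (i, i)) = (\<Sum>i<k. if i = p then (if p = q then 1 else 0) else 0)"
    by (intro sum.cong) (auto simp: elementary_mat_def)
  then show ?thesis using assms by simp
qed

lemma elementary_in_subalgebra:
  assumes "a < b" "b \<le> l"
  shows "elementary_mat (l + 1) a b \<in> type_A_subalgebra l l" "elementary_mat (l + 1) b a \<in> type_A_subalgebra l l"
proof -
  let ?E = "elementary_mat (l + 1)" and ?S = "type_A_subalgebra l l"
  have bracket: "lie_bracket A B \<in> ?S" if "A \<in> ?S" "B \<in> ?S" for A B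
    using that by (simp add: type_A_subalgebra_def lie_subalgebra_generated.bracket)
  have simple: "?E a (Suc a) \<in> ?S" "?E (Suc a) a \<in> ?S" if "a < l" for a
    using generators_in_subalgebra[of "Suc a" l l] that by (auto simp: chevalley_e_def chevalley_f_def)
  have "?E a b \<in> ?S \<and> ?E b a \<in> ?S" using assms
  proof (induction b)
    case (Suc b)
    show ?case
    proof (cases "a = b")
      case True
      then show ?thesis using simple[of a] Suc.prems by simp
    next
      case False
      then have "?E a (Suc b) = lie_bracket (?E a b) (?E b (Suc b))"
          "?E (Suc b) a = lie_bracket (?E (Suc b) b) (?E b a)"
        using Suc.prems by (auto simp: lie_bracket_elementary)
      then show ?thesis using Suc False simple[of b] bracket by auto
    qed
  qed simp
  then show "?E a b \<in> ?S" "?E b a \<in> ?S" by auto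
qed

lemma trace_mult_commute:
  fixes A B :: "complex mat"
  assumes "A \<in> carrier_mat k k" "B \<in> carrier_mat k k"
  shows "(\<Sum>i<k. (A * B) $$ (i, i)) = (\<Sum>i<k. (B * A) $$ (i, i))"
proof -
  have "(\<Sum>i<k. (A * B) $$ (i, i)) = (\<Sum>i<k. \<Sum>j<k. A $$ (i, j) * B $$ (j, i))"
    using assms by (intro sum.cong) (auto simp: scalar_prod_def lessThan_atLeast0)
  also have "\<dots> = (\<Sum>j<k. \<Sum>i<k. B $$ (j, i) * A $$ (i, j))"
    by (subst sum.swap) (simp add: mult.commute)
  also have "\<dots> = (\<Sum>i<k. (B * A) $$ (i, i))"
    using assms by (intro sum.cong) (auto simp: scalar_prod_def lessThan_atLeast0)
  finally show ?thesis .
qed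

lemma type_A_algebraI:
  "A \<in> carrier_mat (l + 1) (l + 1) \<Longrightarrow> (\<Sum>i<l + 1. A $$ (i, i)) = 0 \<Longrightarrow> A \<in> type_A_algebra l"
  by (simp add: type_A_algebra_def)

text \<open>The large algebra is defined by the trace, the small one by generators; the comparison
  works with generators. Off-diagonal units are iterated brackets, and the diagonal part is a
  combination of the h_i.\<close>

lemma type_A_algebra_eq: "type_A_algebra l = type_A_subalgebra l l"
proof (intro equalityI subsetI)
  let ?k = "l + 1"
  fix A assume "A \<in> type_A_subalgebra l l"
  then show "A \<in> type_A_algebra l"
    unfolding type_A_subalgebra_def
  proof induction
    case (generator A)
    then obtain i where i: "i \<in> {1..l}" and A: "A \<in> {chevalley_e l i, chevalley_f l i, chevalley_h l i}"
      by blast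
    then have ik: "i - 1 < ?k" "i < ?k" "i - 1 \<noteq> i" by auto
    have "(\<Sum>j<?k. chevalley_h l i $$ (j, j))
      = (\<Sum>j<?k. elementary_mat ?k (i - 1) (i - 1) $$ (j, j) - elementary_mat ?k i i $$ (j, j))"
      by (intro sum.cong) (auto simp: chevalley_h_def elementary_mat_def)
    also have "\<dots> = 0"
      unfolding sum_subtractf trace_elementary[OF ik(1)] trace_elementary[OF ik(2)] by simp
    finally have "(\<Sum>j<?k. chevalley_h l i $$ (j, j)) = 0" .
    moreover have "(\<Sum>j<?k. chevalley_e l i $$ (j, j)) = 0" "(\<Sum>j<?k. chevalley_f l i $$ (j, j)) = 0"
      unfolding chevalley_e_def chevalley_f_def trace_elementary[OF ik(1)] trace_elementary[OF ik(2)]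
      using ik by simp_all
    moreover have "chevalley_e l i \<in> carrier_mat ?k ?k" "chevalley_f l i \<in> carrier_mat ?k ?k"
        "chevalley_h l i \<in> carrier_mat ?k ?k"
      by (simp_all add: chevalley_e_def chevalley_f_def chevalley_h_def minus_carrier_mat)
    ultimately show ?case using A type_A_algebraI by blast
  next
    case (bracket A B)
    then have AB: "A \<in> carrier_mat ?k ?k" "B \<in> carrier_mat ?k ?k" by (auto simp: type_A_algebra_def)
    have "(\<Sum>i<?k. (A * B - B * A) $$ (i, i)) = (\<Sum>i<?k. (A * B) $$ (i, i) - (B * A) $$ (i, i))"
      using AB by (intro sum.cong) auto
    then have tr: "(\<Sum>i<?k. (A * B - B * A) $$ (i, i)) = 0"
      unfolding sum_subtractf trace_mult_commute[OF AB] by simp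
    have "A * B - B * A \<in> carrier_mat ?k ?k" using AB by auto
    from type_A_algebraI[OF this tr] show ?case by (simp only: lie_bracket_def)
  next
    case (add A B)
    then have AB: "A \<in> carrier_mat ?k ?k" "B \<in> carrier_mat ?k ?k"
        "(\<Sum>i<?k. A $$ (i, i)) = 0" "(\<Sum>i<?k. B $$ (i, i)) = 0" by (simp_all add: type_A_algebra_def)
    have "(\<Sum>i<?k. (A + B) $$ (i, i)) = (\<Sum>i<?k. A $$ (i, i) + B $$ (i, i))"
      using AB by (intro sum.cong) auto
    then have tr: "(\<Sum>i<?k. (A + B) $$ (i, i)) = 0" by (simp only: sum.distrib AB) simp
    show ?case by (rule type_A_algebraI[OF _ tr]) (use AB in simp)
  next
    case (smult A c)
    then have A: "A \<in> carrier_mat ?k ?k" "(\<Sum>i<?k. A $$ (i, i)) = 0" by (simp_all add: type_A_algebra_def)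
    have "(\<Sum>i<?k. (c \<cdot>\<^sub>m A) $$ (i, i)) = (\<Sum>i<?k. c * A $$ (i, i))"
      using A by (intro sum.cong) auto
    then have tr: "(\<Sum>i<?k. (c \<cdot>\<^sub>m A) $$ (i, i)) = 0" by (simp only: sum_distrib_left[symmetric] A) simp
    show ?case by (rule type_A_algebraI[OF _ tr]) (use A in simp)
  qed (simp add: type_A_algebra_def)
next
  let ?k = "l + 1" and ?S = "type_A_subalgebra l l"
  have S: "A \<in> ?S \<Longrightarrow> B \<in> ?S \<Longrightarrow> A + B \<in> ?S" "A \<in> ?S \<Longrightarrow> c \<cdot>\<^sub>m A \<in> ?S" "0\<^sub>m ?k ?k \<in> ?S" for A B c
    by (simp_all add: type_A_subalgebra_def lie_subalgebra_generated.intros)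
  fix A assume "A \<in> type_A_algebra l"
  then have A: "A \<in> carrier_mat ?k ?k" and tr: "(\<Sum>i<?k. A $$ (i, i)) = 0" by (auto simp: type_A_algebra_def)
  have off: "mat ?k ?k (\<lambda>p. if p \<in> I then A $$ p else 0) \<in> ?S"
    if "finite I" "I \<subseteq> {(i, j). i \<noteq> j \<and> i < ?k \<and> j < ?k}" for I
    using that
  proof (induction I rule: finite_induct)
    case empty
    have "mat ?k ?k (\<lambda>p. if p \<in> {} then A $$ p else 0) = 0\<^sub>m ?k ?k" by (intro eq_matI) auto
    then show ?case using S by simp
  next
    case (insert p I)
    obtain i j where p: "p = (i, j)" by force
    have "elementary_mat ?k i j \<in> ?S"
      using insert.prems p elementary_in_subalgebra[of i j l] elementary_in_subalgebra[of j i l]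
      by (cases "i < j") auto
    moreover have "mat ?k ?k (\<lambda>q. if q \<in> insert p I then A $$ q else 0)
        = mat ?k ?k (\<lambda>q. if q \<in> I then A $$ q else 0) + A $$ p \<cdot>\<^sub>m elementary_mat ?k i j"
      using insert.hyps p by (intro eq_matI) (auto simp: elementary_mat_def)
    ultimately show ?case using insert S by simp
  qed
  \<comment> \<open>The first t diagonal entries of \<open>A\<close>, with a compensating entry at
    place t that makes the trace 0. Adding a multiple of h_(t+1) passes to t + 1; at t = l the
    compensating entry is that of \<open>A\<close>, whose trace is 0.\<close>
  have diag: "mat ?k ?k (\<lambda>(i, j). if i = j then if i < t then A $$ (i, i)
      else if i = t then - (\<Sum>s<t. A $$ (s, s)) else 0 else 0) \<in> ?S" (is "?D t \<in> _") if "t \<le> l" for t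
    using that
  proof (induction t)
    case 0
    have "?D 0 = 0\<^sub>m ?k ?k" by (intro eq_matI) auto
    then show ?case using S by simp
  next
    case (Suc t)
    have "?D (Suc t) = ?D t + (\<Sum>s<Suc t. A $$ (s, s)) \<cdot>\<^sub>m chevalley_h l (Suc t)"
      using Suc.prems by (intro eq_matI) (auto simp: chevalley_h_def elementary_mat_def)
    then show ?case using Suc S generators_in_subalgebra(3)[of "Suc t" l l] by simp
  qed
  let ?I = "{(i, j). i \<noteq> j \<and> i < ?k \<and> j < ?k}"
  have fin: "finite ?I" by (rule finite_subset[of _ "{..<?k} \<times> {..<?k}"]) auto
  have A_eq: "A = mat ?k ?k (\<lambda>p. if p \<in> ?I then A $$ p else 0) + ?D l"
    using A tr by (intro eq_matI) (auto simp: add_eq_0_iff less_Suc_eq)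
  show "A \<in> ?S"
    by (subst A_eq) (rule S(1)[OF off[OF fin subset_refl] diag[OF order_refl]])
qed

lemma (in irreducible_highest_weight_module) dim_weight_space_eq:
  assumes L: "L = type_A_subalgebra l n" and nl: "n \<le> l" "n \<le> l'"
    and y: "y \<in> tensors l' N" "y \<noteq> 0" "singular n y" "weight_vec n \<kappa> y"
    and \<nu>: "\<And>i. i \<in> {1..n} \<Longrightarrow> \<nu> i = int (\<kappa> (i - 1)) - int (\<kappa> i)"
  shows "dim (weight_space l n smul V act \<mu>) = ten.dim (hwt n \<mu> (cyc n y))"
proof -
  obtain v where v: "v \<in> weight_space l n smul V act \<nu>" "v \<noteq> 0" "\<forall>i\<in>{1..n}. act (chevalley_e l i) v = 0"
    using highest_weight_vector by blast
  have "irreducible_highest_weight_module smul (type_A_subalgebra l n) V act l n \<nu>"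
    using irreducible_highest_weight_module_axioms L by simp
  then interpret highest_weight_comparison smul V act l n \<nu> l' N \<kappa> y v
    using nl y \<nu> v by (intro highest_weight_comparison.intro highest_weight_comparison_axioms.intro) auto
  show ?thesis by (rule dim_weight_space)
qed

text \<open>Subtracting P\<alpha> subtracts a second difference of P, hence a difference of
  increments. The result is the h_i eigenvalue of the component with index b.\<close>

lemma branch_weight_nth:
  assumes "P \<in> Pi_prime (Suc n) lam" "i \<in> {1..n}"
  shows "branch_weight (Suc n) lam P i = lam i - int (increments n P (i - 1)) + int (increments n P i)"
proof -
  have P: "P 0 = 0" "\<And>i. i \<in> {1..Suc n} \<Longrightarrow> P (i - 1) \<le> P i" using assms(1) by (auto simp: Pi_prime_def)
  obtain j where j: "i = Suc j" "j < n" using assms(2) by (cases i) auto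
  have "root_comb (Suc n) P i = 2 * int (P (Suc j)) - int (P j) - int (P (Suc (Suc j)))"
    using root_comb_nth[of i "Suc n" P] j P(1) by auto
  moreover have "P j \<le> P (Suc j)" "P (Suc j) \<le> P (Suc (Suc j))"
    using P(2)[of "Suc j"] P(2)[of "Suc (Suc j)"] j by auto
  ultimately show ?thesis
    using j by (simp add: branch_weight_def restrict_weight_def increments_def of_nat_diff)
qed

text \<open>The modules \<open>W\<close> are given for dominant weights only. Positivity comes from
  b_(i-1) \<le> \<lambda>_i.\<close>

lemma branch_weight_dominant:
  assumes "P \<in> Pi_prime (Suc n) lam"
  shows "branch_weight (Suc n) lam P \<in> dominant_weights n"
proof -
  have "0 \<le> branch_weight (Suc n) lam P i" if "i \<in> {1..n}" for i
  proof -
    have "\<forall>i\<in>{1..Suc n}. P (i - 1) \<le> P i \<and> int (P i) - int (P (i - 1)) \<le> lam i"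
      using assms by (simp add: Pi_prime_def)
    from bspec[OF this, of i] that have "int (increments n P (i - 1)) \<le> lam i"
      by (auto simp: increments_def of_nat_diff)
    then show ?thesis using branch_weight_nth[OF assms that] by simp
  qed
  then show ?thesis
    by (auto simp: dominant_weights_def integral_weights_def branch_weight_def restrict_weight_def)
qed

theorem theorem4p9:
  fixes l :: nat
    and lam mu :: "nat \<Rightarrow> int"
    and scaleV :: "complex \<Rightarrow> 'v::ab_group_add \<Rightarrow> 'v"
    and V :: "'v set"
    and actV :: "complex mat \<Rightarrow> 'v \<Rightarrow> 'v"
    and scaleW :: "complex \<Rightarrow> 'w::ab_group_add \<Rightarrow> 'w"
    and W :: "(nat \<Rightarrow> int) \<Rightarrow> 'w set"
    and actW :: "(nat \<Rightarrow> int) \<Rightarrow> complex mat \<Rightarrow> 'w \<Rightarrow> 'w"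
  assumes l: "l \<ge> 2"
    and lam: "lam \<in> dominant_weights l"
    and V: "irreducible_highest_weight_module scaleV (type_A_algebra l) V actV l l lam"
    and W: "\<And>\<nu>. \<nu> \<in> dominant_weights (l - 1) \<Longrightarrow>
      irreducible_highest_weight_module scaleW (type_A_subalgebra l (l - 1)) (W \<nu>) (actW \<nu>)
        l (l - 1) \<nu>"
    and mu: "is_weight l l scaleV V actV mu"
  shows "weight_multiplicity l l scaleV V actV mu =
      (\<Sum>P | P \<in> Pi_prime l lam \<and> root_ll l P (\<lambda>i. lam i - mu i).
        vector_space.dim scaleW
          (weight_space l (l - 1) scaleW (W (branch_weight l lam P)) (actW (branch_weight l lam P))
            (restrict_weight (l - 1) mu)))
    \<and> (\<Sum>P | P \<in> Pi_prime l lam \<and> root_ll l P (\<lambda>i. lam i - mu i).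
        vector_space.dim scaleW
          (weight_space l (l - 1) scaleW (W (branch_weight l lam P)) (actW (branch_weight l lam P))
            (restrict_weight (l - 1) mu))) =
      (\<Sum>P | P \<in> Pi_prime l lam \<and> root_ll l P (\<lambda>i. lam i - mu i).
        weight_multiplicity l (l - 1) scaleW (W (branch_weight l lam P)) (actW (branch_weight l lam P))
          (restrict_weight (l - 1) mu))"
proof -
  obtain n where n: "l = Suc n" using l by (cases l) auto
  \<comment> \<open>Roots are numbered from 1 and letters from 0, so m_i is \<lambda>_(i+1).\<close>
  define m where "m i = nat (lam (Suc i))" for i
  let ?L = "\<lambda>a. \<Sum>i=a..n. m i"
  have lam_m: "lam i = int (m (i - 1))" if "i \<in> {1..Suc n}" for i
    using lam that n by (auto simp: dominant_weights_def m_def)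
  have lam_0: "lam i = 0" and mu_0: "mu i = 0" if "i \<notin> {1..Suc n}" for i
    using lam mu that n by (auto simp: dominant_weights_def integral_weights_def is_weight_def)
  have L_step: "int (?L (i - 1)) - int (?L i) = int (m (i - 1))" if "i \<in> {1..Suc n}" for i
    using that by (cases i) (auto simp: sum.atLeast_Suc_atMost)
  obtain N v where v: "v \<in> tensors (Suc n) N" "v \<noteq> 0" "singular (Suc n) v" "weight_vec (Suc n) ?L v"
    "\<And>b. (\<And>a. a \<le> n \<Longrightarrow> b a \<le> m a) \<Longrightarrow> \<exists>\<xi>. branch_vec n N m b v \<xi>"
    using ex_highest_weight_vector[of n m] by blast
  interpret B: branching n N m v by unfold_locales (fact v)+
  interpret V: irreducible_highest_weight_module scaleV "type_A_algebra l" V actV l l lam by (fact V)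
  have "V.dim (weight_space l l scaleV V actV mu) = ten.dim (hwt l mu (cyc l v))"
    using v(1-4) lam_m L_step n
    by (intro V.dim_weight_space_eq[where l' = "Suc n" and N = N and \<kappa> = ?L] type_A_algebra_eq) auto
  then have "weight_multiplicity l l scaleV V actV mu
      = (\<Sum>P | P \<in> Pi_prime l lam \<and> root_ll l P (\<lambda>i. lam i - mu i).
          ten.dim (hwt n mu (cyc n (B.hwv (increments n P)))))"
    unfolding weight_multiplicity_def n using B.dim_branching[of lam mu] lam_m lam_0 mu_0 by metis
  also have "\<dots> = (\<Sum>P | P \<in> Pi_prime l lam \<and> root_ll l P (\<lambda>i. lam i - mu i).
        vector_space.dim scaleW
          (weight_space l (l - 1) scaleW (W (branch_weight l lam P)) (actW (branch_weight l lam P))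
            (restrict_weight (l - 1) mu)))"
  proof (intro sum.cong refl)
    fix P assume "P \<in> {P. P \<in> Pi_prime l lam \<and> root_ll l P (\<lambda>i. lam i - mu i)}"
    then have P: "P \<in> Pi_prime (Suc n) lam" by (simp add: n)
    let ?\<nu> = "branch_weight l lam P" and ?b = "increments n P"
    have b: "?b \<in> B.box"
    proof -
      have *: "\<forall>i\<in>{1..Suc n}. int (P i) - int (P (i - 1)) \<le> lam i"
        using P by (simp add: Pi_prime_def)
      have "?b a \<le> m a" if "a \<le> n" for a
        using bspec[OF *, of "Suc a"] that lam_m[of "Suc a"] by (simp add: increments_def)
      then show ?thesis by (auto simp: B.box_def increments_def)
    qed
    have "irreducible_highest_weight_module scaleW (type_A_subalgebra l n) (W ?\<nu>) (actW ?\<nu>) l n ?\<nu>"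
      using W[of ?\<nu>] branch_weight_dominant[OF P] n by simp
    then interpret W: irreducible_highest_weight_module scaleW "type_A_subalgebra l n" "W ?\<nu>" "actW ?\<nu>" l n ?\<nu> .
    \<comment> \<open>The highest weight of the component, as a difference of letter counts of its
      generator, is the branch weight; \<open>box_le\<close> keeps the natural-number differences
      exact.\<close>
    have "?\<nu> i = int (?L (i - 1) - ?b (i - 1)) - int (?L i - ?b i)" if i: "i \<in> {1..n}" for i
    proof -
      have "i \<le> n" "i - 1 \<le> n" using i by auto
      then have "?b i \<le> ?L i" "?b (i - 1) \<le> ?L (i - 1)" using B.box_le[OF b] by blast+
      then show ?thesis
        using branch_weight_nth[OF P i] lam_m[of i] L_step[of i] i by (simp add: n of_nat_diff)
    qed
    then have "W.dim (weight_space l n scaleW (W ?\<nu>) (actW ?\<nu>) (restrict_weight n mu))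
      = ten.dim (hwt n (restrict_weight n mu) (cyc n (B.hwv ?b)))"
      using B.hwv_C[OF b] B.C_tensors B.hwv_nonzero[OF b] B.hwv_singular[OF b] B.hwv_weight'[OF b] n
      by (intro W.dim_weight_space_eq[where l' = "Suc n" and N = N and \<kappa> = "\<lambda>a. ?L a - ?b a"])
        (auto simp: weight_vec_def)
    \<comment> \<open>\<open>hwt n\<close> reads only the coordinates 1, ..., n, which restriction
      leaves unchanged.\<close>
    moreover have "hwt n (restrict_weight n mu) U = hwt n mu U" for U
      by (auto simp: hwt_def restrict_weight_def)
    ultimately show "ten.dim (hwt n mu (cyc n (B.hwv (increments n P)))) = vector_space.dim scaleW
          (weight_space l (l - 1) scaleW (W (branch_weight l lam P)) (actW (branch_weight l lam P))
            (restrict_weight (l - 1) mu))"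
      by (simp add: n)
  qed
  finally show ?thesis by (simp add: weight_multiplicity_def)
qed

end
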